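(* Let $\Gamma,\Lambda$ be countable residually finite groups. Let $G=\varprojlim\Gamma/\Gamma_n$ and $H=\varprojlim\Lambda/\Lambda_n$ be the profinite completions of $\Gamma$ and $\Lambda$ with respect to descending chains $\{\Gamma_n\}_n$, $\{\Lambda_n\}_n$ of finite index normal subgroups with trivial intersection. Denote by $m_G$ and $m_H$ the Haar (probability) measures of $G$ and $H$. Assume that the left translation action $\Gamma\curvearrowright(G,m_G)$ has spectral gap. Then the following hold: (1) $\Gamma\curvearrowright(G,m_G)$ is stably orbit equivalent (respectively, orbit equivalent) to $\Lambda\curvearrowright(H,m_H)$ if and only if there exist open subgroups $G_0<G$ and $H_0<H$ and a continuous isomorphism $\delta:G_0\rightarrow H_0$ such that $\delta(\Gamma\cap G_0)=\Lambda\cap H_0$ (and, respectively, in addition $[G:G_0]=[H:H_0]$). (2) $\mathcal R(\Gamma\curvearrowright G)$ is Borel reducible to $\mathcal R(\Lambda\curvearrowright H)$ if and only if there exist an open subgroup $G_0<G$, a closed subgroup $H_0<H$, and a continuous isomorphism $\delta:G_0\rightarrow H_0$ such that $\delta(\Gamma\cap G_0)=\Lambda\cap H_0$.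
   Context: $\Gamma$ is viewed as a dense subgroup of $G$ via $g\mapsto(g\Gamma_n)_n$ (similarly $\Lambda<H$), and the left translation action is $g\cdot x=gx$. An ergodic p.m.p. (probability measure preserving) action $\Gamma\curvearrowright(X,\mu)$ has spectral gap if the Koopman representation of $\Gamma$ on $L^2(X,\mu)\ominus\mathbb C1$ has no almost invariant vectors, i.e. there is no sequence of unit vectors $\xi_n$ with $\|\pi(g)\xi_n-\xi_n\|_2\to0$ for all $g\in\Gamma$. For an action $\Gamma\curvearrowright X$, $\mathcal R(\Gamma\curvearrowright X)=\{(x,y)\in X^2\mid\Gamma x=\Gamma y\}$. Countable p.m.p. equivalence relations $\mathcal R$ on $(X,\mu)$ and $\mathcal S$ on $(Y,\nu)$ are orbit equivalent if there is an isomorphism of probability spaces $\theta:(X,\mu)\to(Y,\nu)$ with $(\theta\times\theta)(\mathcal R)=\mathcal S$ (almost everywhere). They are stably orbit equivalent if there are Borel sets $A\subset X$, $B\subset Y$ of positive measure such that the restrictions $\mathcal R_{|A}=\mathcal R\cap(A\times A)$ and $\mathcal S_{|B}$ (with normalized restricted measures) are orbit equivalent. Two p.m.p. actions are (stably) orbit equivalent if their orbit equivalence relations are. A countable Borel equivalence relation $\mathcal R$ on $X$ is Borel reducible to $\mathcal S$ on $Y$ if there is a Borel map $\theta:X\to Y$ such that $(x,y)\in\mathcal R$ if and only if $(\theta(x),\theta(y))\in\mathcal S$. "Continuous isomorphism" means isomorphism of topological groups. *)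

theory Defs
  imports
    "HOL-Algebra.Group_Action"
    "HOL-Algebra.Product_Groups"
    "HOL-Analysis.Analysis"
    "HOL-Probability.Probability_Measure"
begin

section \<open>Profinite completions\<close>

definition residually_finite :: "('a, 'c) monoid_scheme \<Rightarrow> bool" where
  "residually_finite \<Gamma> \<longleftrightarrow>
     (\<forall>g \<in> carrier \<Gamma> - {\<one>\<^bsub>\<Gamma>\<^esub>}. \<exists>K. K \<lhd> \<Gamma> \<and> finite (rcosets\<^bsub>\<Gamma>\<^esub> K) \<and> g \<notin> K)"

definition residual_chain :: "('a, 'c) monoid_scheme \<Rightarrow> (nat \<Rightarrow> 'a set) \<Rightarrow> bool" where
  "residual_chain \<Gamma> N \<longleftrightarrow>
     (\<forall>n. N n \<lhd> \<Gamma> \<and> finite (rcosets\<^bsub>\<Gamma>\<^esub> (N n))) \<and> decseq N \<and> (\<Inter>n. N n) = {\<one>\<^bsub>\<Gamma>\<^esub>}"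

text \<open>For \<open>m \<le> n\<close> the connecting map from \<open>\<Gamma> Mod N n\<close> to \<open>\<Gamma> Mod N m\<close> sends a coset \<open>C\<close>
  to \<open>N m <#> C\<close>, the coset of \<open>N m\<close> that contains \<open>C\<close>.\<close>

definition profinite_completion ::
    "('a, 'c) monoid_scheme \<Rightarrow> (nat \<Rightarrow> 'a set) \<Rightarrow> (nat \<Rightarrow> 'a set) monoid" where
  "profinite_completion \<Gamma> N =
     (let P = product_group UNIV (\<lambda>n. \<Gamma> Mod N n)
      in P\<lparr>carrier := {x \<in> carrier P. \<forall>m n. m \<le> n \<longrightarrow> N m <#>\<^bsub>\<Gamma>\<^esub> x n = x m}\<rparr>)"

definition profinite_topology ::
    "('a, 'c) monoid_scheme \<Rightarrow> (nat \<Rightarrow> 'a set) \<Rightarrow> (nat \<Rightarrow> 'a set) topology" where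
  "profinite_topology \<Gamma> N =
     subtopology (product_topology (\<lambda>n. discrete_topology (carrier (\<Gamma> Mod N n))) UNIV)
       (carrier (profinite_completion \<Gamma> N))"

definition profinite_embedding ::
    "('a, 'c) monoid_scheme \<Rightarrow> (nat \<Rightarrow> 'a set) \<Rightarrow> 'a \<Rightarrow> nat \<Rightarrow> 'a set" where
  "profinite_embedding \<Gamma> N g = (\<lambda>n. N n #>\<^bsub>\<Gamma>\<^esub> g)"

definition left_translation ::
    "('a, 'c) monoid_scheme \<Rightarrow> (nat \<Rightarrow> 'a set) \<Rightarrow> 'a \<Rightarrow> (nat \<Rightarrow> 'a set) \<Rightarrow> nat \<Rightarrow> 'a set" where
  "left_translation \<Gamma> N g =
     (\<lambda>x \<in> carrier (profinite_completion \<Gamma> N).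
        profinite_embedding \<Gamma> N g \<otimes>\<^bsub>profinite_completion \<Gamma> N\<^esub> x)"

section \<open>Topological groups and Haar measure\<close>

text \<open>The space of \<^term>\<open>borel_of T\<close> carries the Borel sets of \<open>T\<close>; its measure is zero and is
  never used.\<close>

definition borel_of :: "'x topology \<Rightarrow> 'x measure" where
  "borel_of T = sigma (topspace T) {U. openin T U}"

text \<open>On a compact metrizable group there is exactly one such measure (regularity is automatic).\<close>

definition haar_probability_measure ::
    "('x, 'c) monoid_scheme \<Rightarrow> 'x topology \<Rightarrow> 'x measure \<Rightarrow> bool" where
  "haar_probability_measure G T M \<longleftrightarrow>
     prob_space M \<and> sets M = sets (borel_of T) \<and>
     (\<forall>g \<in> carrier G. \<forall>A \<in> sets M. emeasure M (g <#\<^bsub>G\<^esub> A) = emeasure M A)"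

definition topological_group_iso ::
    "('x, 'c) monoid_scheme \<Rightarrow> 'x topology \<Rightarrow> ('y, 'd) monoid_scheme \<Rightarrow> 'y topology \<Rightarrow> ('x \<Rightarrow> 'y) set"
  where "topological_group_iso G T H S = {\<delta> \<in> iso G H. homeomorphic_map T S \<delta>}"

section \<open>Probability measure preserving actions and spectral gap\<close>

definition pmp_action ::
    "('a, 'c) monoid_scheme \<Rightarrow> 'x measure \<Rightarrow> ('a \<Rightarrow> 'x \<Rightarrow> 'x) \<Rightarrow> bool" where
  "pmp_action \<Gamma> M \<phi> \<longleftrightarrow>
     prob_space M \<and> group_action \<Gamma> (space M) \<phi> \<and>
     (\<forall>g \<in> carrier \<Gamma>. \<phi> g \<in> M \<rightarrow>\<^sub>M M \<and> distr M M (\<phi> g) = M)"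

definition ergodic_action ::
    "('a, 'c) monoid_scheme \<Rightarrow> 'x measure \<Rightarrow> ('a \<Rightarrow> 'x \<Rightarrow> 'x) \<Rightarrow> bool" where
  "ergodic_action \<Gamma> M \<phi> \<longleftrightarrow>
     (\<forall>A \<in> sets M. (\<forall>g \<in> carrier \<Gamma>. \<phi> g ` A = A) \<longrightarrow> emeasure M A = 0 \<or> emeasure M A = 1)"

text \<open>Elements of $L^2$ are represented by square integrable functions; none of the notions
  below distinguishes functions that agree almost everywhere.\<close>

definition L2_norm :: "'x measure \<Rightarrow> ('x \<Rightarrow> complex) \<Rightarrow> real" where
  "L2_norm M \<xi> = sqrt (\<integral>x. (cmod (\<xi> x))\<^sup>2 \<partial>M)"

text \<open>The orthogonal complement of the constants in $L^2$ of a probability space.\<close>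

definition L2_mean_zero :: "'x measure \<Rightarrow> ('x \<Rightarrow> complex) set" where
  "L2_mean_zero M =
     {\<xi> \<in> borel_measurable M. integrable M (\<lambda>x. (cmod (\<xi> x))\<^sup>2) \<and> (\<integral>x. \<xi> x \<partial>M) = 0}"

definition koopman ::
    "('a, 'c) monoid_scheme \<Rightarrow> ('a \<Rightarrow> 'x \<Rightarrow> 'x) \<Rightarrow> 'a \<Rightarrow> ('x \<Rightarrow> complex) \<Rightarrow> 'x \<Rightarrow> complex" where
  "koopman \<Gamma> \<phi> g \<xi> = (\<lambda>x. \<xi> (\<phi> (inv\<^bsub>\<Gamma>\<^esub> g) x))"

definition spectral_gap ::
    "('a, 'c) monoid_scheme \<Rightarrow> 'x measure \<Rightarrow> ('a \<Rightarrow> 'x \<Rightarrow> 'x) \<Rightarrow> bool" where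
  "spectral_gap \<Gamma> M \<phi> \<longleftrightarrow>
     pmp_action \<Gamma> M \<phi> \<and> ergodic_action \<Gamma> M \<phi> \<and>
     \<not> (\<exists>\<xi> :: nat \<Rightarrow> 'x \<Rightarrow> complex.
          (\<forall>n. \<xi> n \<in> L2_mean_zero M \<and> L2_norm M (\<xi> n) = 1) \<and>
          (\<forall>g \<in> carrier \<Gamma>. (\<lambda>n. L2_norm M (\<lambda>x. koopman \<Gamma> \<phi> g (\<xi> n) x - \<xi> n x)) \<longlonglongrightarrow> 0))"

section \<open>Orbit equivalence and Borel reducibility\<close>

definition orbit_relation ::
    "('a, 'c) monoid_scheme \<Rightarrow> 'x set \<Rightarrow> ('a \<Rightarrow> 'x \<Rightarrow> 'x) \<Rightarrow> ('x \<times> 'x) set" where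
  "orbit_relation \<Gamma> X \<phi> = {(x, y) \<in> X \<times> X. orbit \<Gamma> \<phi> x = orbit \<Gamma> \<phi> y}"

definition measure_space_iso :: "'x measure \<Rightarrow> 'y measure \<Rightarrow> ('x \<Rightarrow> 'y) \<Rightarrow> bool" where
  "measure_space_iso M N \<theta> \<longleftrightarrow>
     \<theta> \<in> M \<rightarrow>\<^sub>M N \<and> bij_betw \<theta> (space M) (space N) \<and>
     the_inv_into (space M) \<theta> \<in> N \<rightarrow>\<^sub>M M \<and> distr M N \<theta> = N"

text \<open>Isomorphisms of probability spaces are defined between conull measurable subsets, and
  the relations are compared there.\<close>

definition orbit_equivalent ::
    "'x measure \<Rightarrow> ('x \<times> 'x) set \<Rightarrow> 'y measure \<Rightarrow> ('y \<times> 'y) set \<Rightarrow> bool" where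
  "orbit_equivalent M R N S \<longleftrightarrow>
     (\<exists>X\<^sub>0 \<in> sets M. \<exists>Y\<^sub>0 \<in> sets N. \<exists>\<theta>.
        (AE x in M. x \<in> X\<^sub>0) \<and> (AE y in N. y \<in> Y\<^sub>0) \<and>
        measure_space_iso (restrict_space M X\<^sub>0) (restrict_space N Y\<^sub>0) \<theta> \<and>
        map_prod \<theta> \<theta> ` (R \<inter> X\<^sub>0 \<times> X\<^sub>0) = S \<inter> Y\<^sub>0 \<times> Y\<^sub>0)"

definition normalized_restriction :: "'x measure \<Rightarrow> 'x set \<Rightarrow> 'x measure" where
  "normalized_restriction M A = scale_measure (1 / emeasure M A) (restrict_space M A)"

definition stably_orbit_equivalent ::
    "'x measure \<Rightarrow> ('x \<times> 'x) set \<Rightarrow> 'y measure \<Rightarrow> ('y \<times> 'y) set \<Rightarrow> bool" where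
  "stably_orbit_equivalent M R N S \<longleftrightarrow>
     (\<exists>A \<in> sets M. \<exists>B \<in> sets N. emeasure M A > 0 \<and> emeasure N B > 0 \<and>
        orbit_equivalent (normalized_restriction M A) (R \<inter> A \<times> A)
                         (normalized_restriction N B) (S \<inter> B \<times> B))"

definition orbit_equivalent_actions ::
    "('a, 'c) monoid_scheme \<Rightarrow> 'x measure \<Rightarrow> ('a \<Rightarrow> 'x \<Rightarrow> 'x) \<Rightarrow>
     ('b, 'd) monoid_scheme \<Rightarrow> 'y measure \<Rightarrow> ('b \<Rightarrow> 'y \<Rightarrow> 'y) \<Rightarrow> bool" where
  "orbit_equivalent_actions \<Gamma> M \<phi> \<Lambda> N \<psi> \<longleftrightarrow>
     orbit_equivalent M (orbit_relation \<Gamma> (space M) \<phi>) N (orbit_relation \<Lambda> (space N) \<psi>)"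

definition stably_orbit_equivalent_actions ::
    "('a, 'c) monoid_scheme \<Rightarrow> 'x measure \<Rightarrow> ('a \<Rightarrow> 'x \<Rightarrow> 'x) \<Rightarrow>
     ('b, 'd) monoid_scheme \<Rightarrow> 'y measure \<Rightarrow> ('b \<Rightarrow> 'y \<Rightarrow> 'y) \<Rightarrow> bool" where
  "stably_orbit_equivalent_actions \<Gamma> M \<phi> \<Lambda> N \<psi> \<longleftrightarrow>
     stably_orbit_equivalent M (orbit_relation \<Gamma> (space M) \<phi>) N (orbit_relation \<Lambda> (space N) \<psi>)"

text \<open>Only the \<open>\<sigma>\<close>-algebras of \<open>M\<close> and \<open>N\<close> matter here.\<close>

definition borel_reducible ::
    "'x measure \<Rightarrow> ('x \<times> 'x) set \<Rightarrow> 'y measure \<Rightarrow> ('y \<times> 'y) set \<Rightarrow> bool" where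
  "borel_reducible M R N S \<longleftrightarrow>
     (\<exists>\<theta> \<in> M \<rightarrow>\<^sub>M N. \<forall>x \<in> space M. \<forall>y \<in> space M. (x, y) \<in> R \<longleftrightarrow> (\<theta> x, \<theta> y) \<in> S)"

end

theory Submission
  imports Defs
begin

text \<open>Let \<open>\<theta> : G \<rightarrow> H\<close> be a Borel map that sends orbits into orbits. For \<open>t\<close> in \<open>G\<close> close to the identity,
  \<open>x \<mapsto> inv (\<theta> x) \<otimes> \<theta> (x \<otimes> t)\<close> is almost invariant under left translation, because the cocycle
  \<open>\<theta> (g \<otimes> x) \<otimes> inv (\<theta> x)\<close> takes values in the countable group \<open>\<Lambda>\<close> and right translations are continuous in
  measure. By spectral gap this function is nearly constant, with value \<open>\<delta> t\<close>, say. As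
  \<open>G\<close> is profinite, \<open>\<delta>\<close> is then a continuous homomorphism on an open subgroup, and \<open>\<theta> (r \<otimes> y) = \<delta>' r \<otimes> \<theta> y\<close>
  holds for a conjugate \<open>\<delta>'\<close> of \<open>\<delta>\<close> whenever \<open>y\<close> and \<open>r \<otimes> y\<close> lie in a suitable set of positive measure.
  If \<open>\<theta>\<close> is a reduction on that set, then \<open>\<delta>' r\<close> lies in \<open>\<Lambda>\<close> exactly when \<open>r\<close> lies in \<open>\<Gamma>\<close>; the
  kernel of \<open>\<delta>'\<close> is a closed countable group, hence finite, and \<open>\<delta>'\<close> is injective on a smaller open
  subgroup. Comparing Haar measures shows that its image is open, with the right index, when
  \<open>\<theta>\<close> is a (stable) orbit equivalence.\<close>

section \<open>Compact groups filtered by open normal subgroups\<close>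

text \<open>Near constancy is read off the distribution of F x =
  \<open>inv (\<theta> x) \<otimes> \<theta> (x \<otimes> t)\<close>. If, for t tending to the
  identity, Borel sets had preimages under F of measure in [e, 1-e], these preimages would be almost
  invariant. So each Borel set is nearly null or nearly conull for the law of F, and such a law has
  a large atom. The bound 1/3 serves twice: 2e < 1-e lets this dichotomy pass to unions, and 3e < 1
  makes three sets of measure at least 1-e meet, so that \<open>\<delta>\<close> is exactly
  multiplicative. As the neighbourhoods \<open>K n\<close> are subgroups, this is at once a
  homomorphism on an open subgroup, with nothing left to extend. The agreement obtained,
  \<open>\<theta> (x \<otimes> t) = \<theta> x \<otimes> \<delta> t\<close>, concerns right
  translations and a set of x depending on t, whereas orbits require left translations on one fixed
  set. Fixing x = p with many good t gives \<open>\<theta> y = \<theta> p \<otimes> \<delta> (inv p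
  \<otimes> y)\<close> on such a set; rewriting left multiplication there is what produces the
  conjugate \<open>\<delta>'\<close>.\<close>

lemma (in group) inv_mult_eq_one_iff:
  assumes "a \<in> carrier G" "b \<in> carrier G"
  shows "inv a \<otimes> b = \<one> \<longleftrightarrow> b = a"
proof
  assume "inv a \<otimes> b = \<one>"
  then have "a \<otimes> (inv a \<otimes> b) = a" using assms by simp
  then show "b = a" using assms by (simp add: m_assoc[symmetric])
qed (use assms in simp)

text \<open>In the application \<open>K n\<close> is the kernel of the projection to the \<open>n\<close>-th finite quotient and
  \<open>L\<close> is the image of the countable dense group.\<close>

locale haar_group = group G + prob_space M
  for G :: "('g, 'e) monoid_scheme" (structure) and M :: "'g measure" +
  fixes K :: "nat \<Rightarrow> 'g set" and T :: "'g topology" and L :: "'g set"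
  assumes normal_K: "K n \<lhd> G"
    and decseq_K: "decseq K"
    and Inter_K: "(\<Inter>n. K n) = {\<one>}"
    and topspace_T: "topspace T = carrier G"
    and openin_iff: "openin T U \<longleftrightarrow>
      U \<subseteq> carrier G \<and> (\<forall>x\<in>U. \<exists>n. {y \<in> carrier G. inv x \<otimes> y \<in> K n} \<subseteq> U)"
    and compact_T: "compact_space T"
    and subgroup_L: "subgroup L G"
    and countable_L: "countable L"
    and dense_L: "x \<in> carrier G \<Longrightarrow> \<exists>l\<in>L. inv x \<otimes> l \<in> K n"
    and sets_M: "sets M = sets (borel_of T)"
    and left_invariant: "g \<in> carrier G \<Longrightarrow> A \<in> sets M \<Longrightarrow> emeasure M (g <# A) = emeasure M A"
begin

section \<open>Cells: cosets of the groups \<open>K n\<close>, behaving like ultrametric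
  balls\<close>

definition cell :: "nat \<Rightarrow> 'g \<Rightarrow> 'g set" where
  "cell n x = {y \<in> carrier G. inv x \<otimes> y \<in> K n}"

lemma mult_inv_cancel [simp]:
  "x \<in> carrier G \<Longrightarrow> y \<in> carrier G \<Longrightarrow> x \<otimes> (inv x \<otimes> y) = y"
  "x \<in> carrier G \<Longrightarrow> y \<in> carrier G \<Longrightarrow> inv x \<otimes> (x \<otimes> y) = y"
  by (simp_all add: m_assoc[symmetric])

lemma K_subgroup: "subgroup (K n) G"
  using normal_K normal_imp_subgroup by blast

lemma K_carrier: "x \<in> K n \<Longrightarrow> x \<in> carrier G"
  by (rule subgroup.mem_carrier[OF K_subgroup])

lemma K_mono: "m \<le> n \<Longrightarrow> x \<in> K n \<Longrightarrow> x \<in> K m"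
  using decseq_K by (auto simp: decseq_def)

lemma one_K [simp]: "\<one> \<in> K n"
  by (simp add: K_subgroup subgroup.one_closed)

lemma K_mult: "x \<in> K n \<Longrightarrow> y \<in> K n \<Longrightarrow> x \<otimes> y \<in> K n"
  by (rule subgroup.m_closed[OF K_subgroup])

lemma K_inv: "x \<in> K n \<Longrightarrow> inv x \<in> K n"
  by (rule subgroup.m_inv_closed[OF K_subgroup])

lemma K_conj: "x \<in> K n \<Longrightarrow> g \<in> carrier G \<Longrightarrow> g \<otimes> x \<otimes> inv g \<in> K n"
  by (rule normal.inv_op_closed2[OF normal_K])

lemma K_conj': "x \<in> K n \<Longrightarrow> g \<in> carrier G \<Longrightarrow> inv g \<otimes> x \<otimes> g \<in> K n"
  by (rule normal.inv_op_closed1[OF normal_K])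

lemma L_carrier: "x \<in> L \<Longrightarrow> x \<in> carrier G"
  by (rule subgroup.mem_carrier[OF subgroup_L])

lemma cell_carrier: "y \<in> cell n x \<Longrightarrow> y \<in> carrier G"
  by (simp add: cell_def)

lemma cell_subset: "cell n x \<subseteq> carrier G"
  by (auto simp: cell_def)

lemma cell_refl: "x \<in> carrier G \<Longrightarrow> x \<in> cell n x"
  by (simp add: cell_def)

lemma cell_sym:
  assumes "y \<in> cell n x" "x \<in> carrier G" shows "x \<in> cell n y"
proof -
  have "inv y \<otimes> x = inv (inv x \<otimes> y)"
    using assms by (simp add: cell_def inv_mult_group)
  then show ?thesis using assms K_inv by (simp add: cell_def)
qed

lemma cell_trans:
  assumes "y \<in> cell n x" "z \<in> cell n y" "x \<in> carrier G" shows "z \<in> cell n x"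
proof -
  have "inv x \<otimes> z = (inv x \<otimes> y) \<otimes> (inv y \<otimes> z)"
    using assms by (simp add: cell_def m_assoc)
  then show ?thesis using assms K_mult by (simp add: cell_def)
qed

lemma cell_mono: "m \<le> n \<Longrightarrow> cell n x \<subseteq> cell m x"
  using K_mono by (auto simp: cell_def)

lemma cell_eq:
  assumes "y \<in> cell n x" "x \<in> carrier G" shows "cell n y = cell n x"
  using cell_trans[OF assms(1) _ assms(2)]
    cell_trans[OF cell_sym[OF assms] _ cell_carrier[OF assms(1)]] by blast

text \<open>Normality of \<open>K n\<close> enters here: the deviation of the first factor is
  conjugated past x' before the two deviations are multiplied.\<close>

lemma cell_mult:
  assumes "y \<in> cell n x" "y' \<in> cell n x'" "x \<in> carrier G" "x' \<in> carrier G"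
  shows "y \<otimes> y' \<in> cell n (x \<otimes> x')"
proof -
  have c: "y \<in> carrier G" "y' \<in> carrier G" using assms cell_carrier by auto
  have "inv (x \<otimes> x') \<otimes> (y \<otimes> y') = (inv x' \<otimes> (inv x \<otimes> y) \<otimes> x') \<otimes> (inv x' \<otimes> y')"
    using assms c by (simp add: m_assoc inv_mult_group)
  then show ?thesis using assms c K_mult K_conj' by (simp add: cell_def)
qed

lemma cell_inv:
  assumes "y \<in> cell n x" "x \<in> carrier G"
  shows "inv y \<in> cell n (inv x)"
proof -
  have c: "y \<in> carrier G" using assms cell_carrier by auto
  have "x \<otimes> inv y = x \<otimes> inv (inv x \<otimes> y) \<otimes> inv x"
    using assms c by (simp add: m_assoc inv_mult_group)
  then show ?thesis using assms c K_inv K_conj by (simp add: cell_def)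
qed

lemma cell_one: "cell n \<one> = K n"
  using K_carrier by (auto simp: cell_def)

lemma cell_mult_K:
  assumes "x \<in> carrier G" "t \<in> K n"
  shows "x \<otimes> t \<in> cell n x" "t \<otimes> x \<in> cell n x"
  using cell_mult[of x n x t \<one>] cell_mult[of t n \<one> x x] assms cell_refl K_carrier
  by (auto simp: cell_one)

lemma cell_all_eq:
  assumes "\<And>n. y \<in> cell n x" "x \<in> carrier G" shows "y = x"
proof -
  have "inv x \<otimes> y \<in> (\<Inter>n. K n)" using assms(1) by (auto simp: cell_def)
  then have "inv x \<otimes> y = \<one>" using Inter_K by blast
  moreover have "y \<in> carrier G" using assms(1)[of 0] cell_carrier by auto
  ultimately show ?thesis
    using inv_solve_left'[of \<one> x y] assms(2) by simp
qed

lemma dense_cell: "x \<in> carrier G \<Longrightarrow> \<exists>l\<in>L. l \<in> cell n x"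
  using dense_L L_carrier by (auto simp: cell_def)

lemma dense_cell': "x \<in> carrier G \<Longrightarrow> \<exists>l\<in>L. x \<in> cell n l"
  using dense_cell cell_sym L_carrier by blast

lemma openin_iff_cell:
  "openin T U \<longleftrightarrow> U \<subseteq> carrier G \<and> (\<forall>x\<in>U. \<exists>n. cell n x \<subseteq> U)"
  by (simp add: openin_iff cell_def)

lemma openin_cell:
  assumes "x \<in> carrier G" shows "openin T (cell n x)"
  unfolding openin_iff_cell using cell_subset cell_eq assms by blast

lemma openin_K: "openin T (K n)"
  using openin_cell[of \<one> n] by (simp add: cell_one)

lemma closedin_cell:
  assumes "x \<in> carrier G" shows "closedin T (cell n x)"
proof -
  have "openin T (carrier G - cell n x)"
    unfolding openin_iff_cell
  proof (intro conjI ballI)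
    show "carrier G - cell n x \<subseteq> carrier G" by auto
    fix y assume y: "y \<in> carrier G - cell n x"
    have "z \<notin> cell n x" if "z \<in> cell n y" for z
      using y that cell_sym[OF that] cell_trans[of z n x y] assms by auto
    then show "\<exists>m. cell m y \<subseteq> carrier G - cell n x" using cell_subset by blast
  qed
  then show ?thesis using cell_subset by (simp add: closedin_def topspace_T)
qed

lemma closedin_K: "closedin T (K n)"
  using closedin_cell[of \<one> n] by (simp add: cell_one)

lemma separate:
  assumes "x \<in> carrier G" "y \<in> carrier G" "x \<noteq> y"
  shows "\<exists>n. y \<notin> cell n x"
  using cell_all_eq assms by metis

lemma Hausdorff_T: "Hausdorff_space T"
  unfolding Hausdorff_space_def
proof (intro allI impI)
  fix x y assume a: "x \<in> topspace T \<and> y \<in> topspace T \<and> x \<noteq> y"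
  then obtain n where n: "y \<notin> cell n x" using separate by (auto simp: topspace_T)
  have "disjnt (cell n x) (cell n y)"
    unfolding disjnt_iff using n a cell_sym cell_trans by (metis topspace_T)
  then show "\<exists>U V. openin T U \<and> openin T V \<and> x \<in> U \<and> y \<in> V \<and> disjnt U V"
    using openin_cell cell_refl a by (metis topspace_T)
qed

section \<open>Borel sets and measurability of the group operations\<close>

lemma space_M: "space M = carrier G"
  using sets_eq_imp_space_eq[OF sets_M]
  by (simp add: borel_of_def topspace_T space_measure_of_conv)

lemma sets_M_open: "sets M = sigma_sets (carrier G) {U. openin T U}"
  unfolding sets_M borel_of_def topspace_T
  by (subst sets_measure_of) (auto simp: openin_iff)

lemma open_sets [intro]: "openin T U \<Longrightarrow> U \<in> sets M"
  by (auto simp: sets_M_open)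

lemma closed_sets: "closedin T U \<Longrightarrow> U \<in> sets M"
  using open_sets[of "carrier G - U"] sets.compl_sets[of "carrier G - U" M]
  by (auto simp: closedin_def topspace_T space_M double_diff)

lemma cell_sets [measurable, intro]: "x \<in> carrier G \<Longrightarrow> cell n x \<in> sets M"
  using openin_cell by blast

lemma K_sets [measurable, intro]: "K n \<in> sets M"
  using openin_K by blast

text \<open>Every cell has a centre in the countable dense set \<open>L\<close>, so there are only
  countably many cells, and an open set is the union of those it contains.\<close>

lemma sets_M_cell: "sets M = sigma_sets (carrier G) (\<Union>n. cell n ` L)"
proof
  have "(\<Union>n. cell n ` L) \<subseteq> sets M" using L_carrier by auto
  then show "sigma_sets (carrier G) (\<Union>n. cell n ` L) \<subseteq> sets M"
    using sets.sigma_sets_subset[of _ M] by (simp add: space_M)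
next
  have "U \<in> sigma_sets (carrier G) (\<Union>n. cell n ` L)" if U: "openin T U" for U
  proof -
    define I where "I = {(n, a). a \<in> L \<and> cell n a \<subseteq> U}"
    have "I \<subseteq> UNIV \<times> L" by (auto simp: I_def)
    then have cI: "countable I" by (rule countable_subset) (simp add: countable_L)
    have "U = (\<Union>(n,a)\<in>I. cell n a)"
    proof
      show "U \<subseteq> (\<Union>(n,a)\<in>I. cell n a)"
      proof
        fix x assume x: "x \<in> U"
        then have xc: "x \<in> carrier G" using U openin_iff by blast
        obtain n where n: "cell n x \<subseteq> U" using U x openin_iff_cell by blast
        obtain l where l: "l \<in> L" "l \<in> cell n x" using dense_cell xc by blast
        then have "cell n l = cell n x" using cell_eq xc by blast
        then show "x \<in> (\<Union>(n,a)\<in>I. cell n a)"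
          using n l cell_refl[OF xc, of n] by (force simp: I_def)
      qed
    qed (auto simp: I_def)
    also have "\<dots> \<in> sigma_sets (carrier G) (\<Union>n. cell n ` L)"
      by (rule sigma_sets_UNION) (use cI in \<open>auto simp: I_def\<close>)
    finally show ?thesis .
  qed
  then show "sets M \<subseteq> sigma_sets (carrier G) (\<Union>n. cell n ` L)"
    unfolding sets_M_open by (intro sigma_sets_mono) auto
qed

lemma measurableI:
  assumes "\<And>w. w \<in> space N \<Longrightarrow> f w \<in> carrier G"
    and "\<And>n a. a \<in> L \<Longrightarrow> {w \<in> space N. f w \<in> cell n a} \<in> sets N"
  shows "f \<in> N \<rightarrow>\<^sub>M M"
proof (rule measurable_sigma_sets[OF sets_M_cell])
  show "f -` A \<inter> space N \<in> sets N" if A: "A \<in> (\<Union>n. cell n ` L)" for A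
  proof -
    obtain n a where "a \<in> L" "A = cell n a" using A by blast
    then show ?thesis using assms(2)[of a n]
      by (auto simp: vimage_def Int_def conj_commute)
  qed
qed (use assms cell_carrier in auto)

lemma measurable_carrier: "f \<in> N \<rightarrow>\<^sub>M M \<Longrightarrow> w \<in> space N \<Longrightarrow> f w \<in> carrier G"
  using measurable_space space_M by metis

lemma measurable_Collect_sets:
  "f \<in> M \<rightarrow>\<^sub>M N \<Longrightarrow> A \<in> sets N \<Longrightarrow> {x \<in> carrier G. f x \<in> A} \<in> sets M"
  using measurable_sets[of f M N A] by (simp add: vimage_def space_M Int_def conj_commute)

text \<open>Modulo \<open>K n\<close> a product depends only on the cells of its factors. Letting a
  run through the countable \<open>L\<close> turns the condition into a countable union of
  rectangles, which makes multiplication measurable.\<close>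

lemma mult_in_cell_iff:
  assumes "x \<in> carrier G" "y \<in> carrier G" "z \<in> carrier G"
  shows "x \<otimes> y \<in> cell n z \<longleftrightarrow> (\<exists>a\<in>L. x \<in> cell n a \<and> y \<in> cell n (inv a \<otimes> z))"
proof
  assume h: "x \<otimes> y \<in> cell n z"
  obtain a where a: "a \<in> L" "x \<in> cell n a" using dense_cell' assms by blast
  have "inv x \<otimes> (x \<otimes> y) \<in> cell n (inv a \<otimes> z)"
    using a h cell_mult[of "inv x" n "inv a" "x \<otimes> y" z] cell_inv L_carrier assms by auto
  then show "\<exists>a\<in>L. x \<in> cell n a \<and> y \<in> cell n (inv a \<otimes> z)"
    using a assms by (auto simp: m_assoc)
next
  assume "\<exists>a\<in>L. x \<in> cell n a \<and> y \<in> cell n (inv a \<otimes> z)"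
  then obtain a where a: "a \<in> L" "x \<in> cell n a" "y \<in> cell n (inv a \<otimes> z)" by blast
  have "a \<otimes> (inv a \<otimes> z) = z" using a L_carrier assms by (simp add: m_assoc)
  then show "x \<otimes> y \<in> cell n z"
    using cell_mult[OF a(2,3)] a L_carrier assms by auto
qed

lemma mult_measurable [measurable (raw)]:
  assumes [measurable]: "f \<in> N \<rightarrow>\<^sub>M M" "g \<in> N \<rightarrow>\<^sub>M M"
  shows "(\<lambda>w. f w \<otimes> g w) \<in> N \<rightarrow>\<^sub>M M"
proof (rule measurableI)
  show "f w \<otimes> g w \<in> carrier G" if "w \<in> space N" for w
    using measurable_carrier[OF assms(1) that] measurable_carrier[OF assms(2) that] by simp
  fix n a assume a: "a \<in> L"
  have "{w \<in> space N. f w \<otimes> g w \<in> cell n a} =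
    (\<Union>b\<in>L. {w \<in> space N. f w \<in> cell n b \<and> g w \<in> cell n (inv b \<otimes> a)})"
    using mult_in_cell_iff[of "f _" "g _" a n] measurable_carrier[OF assms(1)]
      measurable_carrier[OF assms(2)] a L_carrier by auto
  also have "\<dots> \<in> sets N"
  proof (rule sets.countable_UN''[OF countable_L])
    fix b assume b: "b \<in> L"
    have [measurable]: "cell n b \<in> sets M" "cell n (inv b \<otimes> a) \<in> sets M"
      using a b L_carrier by auto
    show "{w \<in> space N. f w \<in> cell n b \<and> g w \<in> cell n (inv b \<otimes> a)} \<in> sets N"
      by measurable
  qed
  finally show "{w \<in> space N. f w \<otimes> g w \<in> cell n a} \<in> sets N" .
qed

lemma inv_measurable [measurable (raw)]:
  assumes [measurable]: "f \<in> N \<rightarrow>\<^sub>M M"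
  shows "(\<lambda>w. inv f w) \<in> N \<rightarrow>\<^sub>M M"
proof (rule measurableI)
  show "inv f w \<in> carrier G" if "w \<in> space N" for w
    using measurable_carrier[OF assms that] by simp
  fix n a assume a: "a \<in> L"
  have [measurable]: "cell n (inv a) \<in> sets M" using a L_carrier by auto
  have "(inv f w \<in> cell n a) = (f w \<in> cell n (inv a))" if "w \<in> space N" for w
    using cell_inv[of "f w" n "inv a"] cell_inv[of "inv f w" n a] a L_carrier
      measurable_carrier[OF assms that] by auto
  then have "{w \<in> space N. inv f w \<in> cell n a} = {w \<in> space N. f w \<in> cell n (inv a)}"
    by auto
  also have "\<dots> \<in> sets N" by measurable
  finally show "{w \<in> space N. inv f w \<in> cell n a} \<in> sets N" .
qed

text \<open>Since the \<open>K n\<close> shrink to the identity, equality is a countable conjunction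
  of conditions at finite level.\<close>

lemma eq_sets:
  assumes [measurable]: "f \<in> N \<rightarrow>\<^sub>M M" "g \<in> N \<rightarrow>\<^sub>M M"
  shows "{w \<in> space N. f w = g w} \<in> sets N"
proof -
  have "(f w = g w) = (\<forall>n. inv f w \<otimes> g w \<in> K n)" if "w \<in> space N" for w
    using cell_all_eq[of "g w" "f w"] measurable_carrier[OF assms(1) that]
      measurable_carrier[OF assms(2) that] by (auto simp: cell_def)
  then have "{w \<in> space N. f w = g w} = {w \<in> space N. \<forall>n. inv f w \<otimes> g w \<in> K n}"
    by auto
  also have "\<dots> \<in> sets N" by measurable
  finally show ?thesis .
qed

lemma singleton_sets: "x \<in> carrier G \<Longrightarrow> {x} \<in> sets M"
  using Hausdorff_T closed_sets by (metis closedin_Hausdorff_singleton topspace_T)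

section \<open>Invariance and positivity of Haar measure\<close>

lemma vimage_left_translation:
  assumes g: "g \<in> carrier G" and A: "A \<subseteq> carrier G"
  shows "{x \<in> carrier G. g \<otimes> x \<in> A} = inv g <# A"
proof safe
  fix x assume x: "x \<in> carrier G" "g \<otimes> x \<in> A"
  have "x = inv g \<otimes> (g \<otimes> x)" using g x by simp
  then show "x \<in> inv g <# A" unfolding l_coset_def using x by blast
next
  fix x assume "x \<in> inv g <# A"
  then show "x \<in> carrier G" "g \<otimes> x \<in> A" using A g by (auto simp: l_coset_def)
qed

lemma left_emeasure:
  assumes "g \<in> carrier G" "A \<in> sets M"
  shows "emeasure M {x \<in> carrier G. g \<otimes> x \<in> A} = emeasure M A"
  using vimage_left_translation[OF assms(1), of A] sets.sets_into_space[OF assms(2)]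
    left_invariant[of "inv g" A] assms by (simp add: space_M)

lemma emeasure_cell: "x \<in> carrier G \<Longrightarrow> emeasure M (cell n x) = emeasure M (K n)"
proof -
  assume x: "x \<in> carrier G"
  have "K n = {y \<in> carrier G. x \<otimes> y \<in> cell n x}"
    using x K_carrier by (auto simp: cell_def m_assoc)
  then show ?thesis using left_emeasure[of x "cell n x"] x by auto
qed

text \<open>Two cells are nested or disjoint; the empty set is adjoined for the disjoint
  case.\<close>

lemma Int_stable_cell: "Int_stable (insert {} (\<Union>n. cell n ` L))"
proof -
  have "cell n x \<inter> cell m y = {} \<or> cell n x \<inter> cell m y = cell m y"
    if "n \<le> m" "x \<in> L" "y \<in> L" for n m x y
  proof (cases "cell n x \<inter> cell m y = {}")
    case False
    then obtain z where z: "z \<in> cell n x" "z \<in> cell m y" by blast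
    then have "cell m y = cell m z" "cell n x = cell n z" using cell_eq L_carrier that by auto
    then show ?thesis using cell_mono[OF that(1)] by blast
  qed auto
  note * = this
  have "cell n x \<inter> cell m y \<in> insert {} (\<Union>n. cell n ` L)" if "x \<in> L" "y \<in> L" for n m x y
  proof (cases "n \<le> m")
    case True then show ?thesis using *[OF True that] that by auto
  next
    case False 
    then have "cell n x \<inter> cell m y = {} \<or> cell n x \<inter> cell m y = cell n x"
      using *[of m n y x] that by auto
    then show ?thesis using that by auto
  qed
  then show ?thesis unfolding Int_stable_def by auto
qed

lemma sets_M_cell': "sets M = sigma_sets (carrier G) (insert {} (\<Union>n. cell n ` L))"
proof
  show "sets M \<subseteq> sigma_sets (carrier G) (insert {} (\<Union>n. cell n ` L))"
    unfolding sets_M_cell by (rule sigma_sets_mono') auto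
  show "sigma_sets (carrier G) (insert {} (\<Union>n. cell n ` L)) \<subseteq> sets M"
    unfolding sets_M_cell
    by (intro sigma_sets_mono insert_subsetI sigma_sets.Empty) (auto intro: sigma_sets.Basic)
qed

lemma Union_cell: "\<Union>(cell n ` L) = carrier G"
  using dense_cell' cell_carrier by blast

lemma measure_eqI_cell:
  assumes "finite_measure N" "sets N = sets M"
    and "\<And>n a. a \<in> L \<Longrightarrow> emeasure N (cell n a) = emeasure M (cell n a)"
  shows "N = M"
proof (rule measure_eqI_generator_eq_countable[OF Int_stable_cell])
  interpret N: finite_measure N by fact
  show "insert {} (\<Union>n. cell n ` L) \<subseteq> Pow (carrier G)" using cell_carrier by auto
  show "sets N = sigma_sets (carrier G) (insert {} (\<Union>n. cell n ` L))"
    "sets M = sigma_sets (carrier G) (insert {} (\<Union>n. cell n ` L))"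
    using assms(2) sets_M_cell' by auto
  show "cell 0 ` L \<subseteq> insert {} (\<Union>n. cell n ` L)" by auto
  show "\<Union>(cell 0 ` L) = carrier G" by (rule Union_cell)
  show "countable (cell 0 ` L)" using countable_L by simp
  show "emeasure N X \<noteq> \<infinity>" for X by simp
  show "emeasure N X = emeasure M X" if "X \<in> insert {} (\<Union>n. cell n ` L)" for X
    using that assms(3) by auto
qed

lemma left_measurable: "g \<in> carrier G \<Longrightarrow> (\<lambda>x. g \<otimes> x) \<in> M \<rightarrow>\<^sub>M M"
  by (rule mult_measurable[OF measurable_const measurable_ident_sets[OF refl]]) (simp add: space_M)

lemma right_measurable: "g \<in> carrier G \<Longrightarrow> (\<lambda>x. x \<otimes> g) \<in> M \<rightarrow>\<^sub>M M"
  by (rule mult_measurable[OF measurable_ident_sets[OF refl] measurable_const]) (simp add: space_M)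

text \<open>A right translate of a cell is a cell of the same level because \<open>K n\<close> is
  normal, and by left invariance all cells of one level have the same measure. As cells generate the
  Borel sets, M is also right invariant.\<close>

lemma distr_right:
  assumes g [simp]: "g \<in> carrier G" shows "distr M M (\<lambda>x. x \<otimes> g) = M"
proof (rule measure_eqI_cell)
  show "finite_measure (distr M M (\<lambda>x. x \<otimes> g))"
    by (rule finite_measure_distr) (rule right_measurable[OF g])
  fix n a assume "a \<in> L"
  then have ac: "a \<in> carrier G" by (rule L_carrier)
  have "x \<otimes> g \<in> cell n a \<longleftrightarrow> x \<in> cell n (a \<otimes> inv g)" if "x \<in> carrier G" for x
    using cell_mult[of "x \<otimes> g" n a "inv g" "inv g"] cell_mult[of x n "a \<otimes> inv g" g g]
      cell_refl ac that by (auto simp: m_assoc)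
  then have "(\<lambda>x. x \<otimes> g) -` cell n a \<inter> space M = cell n (a \<otimes> inv g)"
    using cell_carrier by (auto simp: space_M)
  then show "emeasure (distr M M (\<lambda>x. x \<otimes> g)) (cell n a) = emeasure M (cell n a)"
    using ac right_measurable by (subst emeasure_distr) (auto simp: emeasure_cell)
qed simp

lemma left_translate_sets:
  assumes g: "g \<in> carrier G" and A: "A \<in> sets M" shows "g <# A \<in> sets M"
  using vimage_left_translation[of "inv g" A] sets.sets_into_space[OF A] g
    measurable_Collect_sets[OF left_measurable[of "inv g"] A] by (simp add: space_M)

lemma right_emeasure:
  assumes "g \<in> carrier G" "A \<in> sets M"
  shows "emeasure M {x \<in> carrier G. x \<otimes> g \<in> A} = emeasure M A"
proof -
  have "emeasure M A = emeasure (distr M M (\<lambda>x. x \<otimes> g)) A"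
    using distr_right assms by simp
  also have "\<dots> = emeasure M ((\<lambda>x. x \<otimes> g) -` A \<inter> space M)"
    by (rule emeasure_distr) (use assms right_measurable in auto)
  also have "(\<lambda>x. x \<otimes> g) -` A \<inter> space M = {x \<in> carrier G. x \<otimes> g \<in> A}"
    by (auto simp: space_M)
  finally show ?thesis by simp
qed

lemma emeasure_K_pos: "emeasure M (K n) > 0"
proof (rule ccontr)
  assume "\<not> ?thesis"
  then have 0: "emeasure M (K n) = 0" by simp
  have "(\<Union>l\<in>L. cell n l) \<in> null_sets M"
    by (rule null_sets_UN'[OF countable_L]) (use 0 L_carrier emeasure_cell in auto)
  moreover have "(\<Union>l\<in>L. cell n l) = space M"
    using dense_cell' cell_carrier by (auto simp: space_M)
  ultimately show False using emeasure_space_1 by auto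
qed

lemma open_positive:
  assumes "openin T U" "U \<noteq> {}" shows "emeasure M U > 0"
proof -
  obtain x n where "x \<in> U" "cell n x \<subseteq> U" using assms openin_iff_cell by blast
  then have "emeasure M (cell n x) \<le> emeasure M U"
    using emeasure_mono assms by blast
  then show ?thesis using emeasure_cell emeasure_K_pos assms \<open>x \<in> U\<close> openin_iff
    by (metis order_less_le_trans subsetD)
qed

lemma crossing_sets:
  assumes A: "A \<in> sets M" and f: "f \<in> M \<rightarrow>\<^sub>M M"
  shows "{x \<in> A. f x \<notin> A} \<in> sets M"
proof -
  note [measurable] = A f
  have "{x \<in> A. f x \<notin> A} = {x \<in> space M. x \<in> A \<and> f x \<notin> A}"
    using sets.sets_into_space[OF A] by auto
  also have "\<dots> \<in> sets M" by measurable
  finally show ?thesis .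
qed

subsection \<open>Continuity of translations in measure\<close>

text \<open>The tail of a disjoint family has small measure, so only finitely many members need
  their own continuity; the others are absorbed into the tail, uniformly in t.\<close>

lemma disjoint_translate_continuous:
  fixes A :: "nat \<Rightarrow> 'g set"
  assumes disj: "disjoint_family A" and A: "\<And>i. A i \<in> sets M"
    and meas: "\<And>t. t \<in> carrier G \<Longrightarrow> f t \<in> M \<rightarrow>\<^sub>M M"
    and cont: "\<And>i e. (e::real) > 0 \<Longrightarrow> \<exists>n. \<forall>t\<in>K n. measure M {x \<in> A i. f t x \<notin> A i} < e"
    and e: "(e::real) > 0"
  shows "\<exists>n. \<forall>t\<in>K n. measure M (\<Union>i. {x \<in> A i. f t x \<notin> A i}) < e"
proof -
  define R where "R N = (\<Union>i\<in>{N..}. A i)" for N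
  have R: "R N \<in> sets M" for N unfolding R_def using A by auto
  have "(\<Inter>N. R N) = {}"
  proof (rule ccontr)
    assume "(\<Inter>N. R N) \<noteq> {}"
    then obtain x where x: "\<And>N. x \<in> R N" by blast
    from x[of 0] obtain i where i: "x \<in> A i" by (auto simp: R_def)
    from x[of "Suc i"] obtain j where j: "x \<in> A j" "j \<ge> Suc i" by (auto simp: R_def)
    have "A i \<inter> A j = {}"
      using disj j(2) unfolding disjoint_family_on_def by (metis UNIV_I Suc_n_not_le_n)
    then show False using i j by blast
  qed
  moreover have "(\<lambda>N. measure M (R N)) \<longlonglongrightarrow> measure M (\<Inter>N. R N)"
    by (rule finite_Lim_measure_decseq) (use R in \<open>auto simp: R_def decseq_def intro: le_trans\<close>)
  ultimately have "(\<lambda>N. measure M (R N)) \<longlonglongrightarrow> 0" by simp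
  then obtain N where N: "measure M (R N) < e / 2"
    using e by (metis LIMSEQ_D[of _ 0 "e/2"] half_gt_zero diff_zero order_refl real_norm_def abs_of_nonneg measure_nonneg)
  \<comment> \<open>A budget of e/2 shared among N pieces; the added 1 keeps d positive when N =
    0.\<close>
  define d where "d = e / (2 * (real N + 1))"
  have d: "d > 0" using e by (simp add: d_def)
  have "\<forall>i. \<exists>n. \<forall>t\<in>K n. measure M {x \<in> A i. f t x \<notin> A i} < d" using cont d by blast
  then obtain n where n: "\<And>i t. t \<in> K (n i) \<Longrightarrow> measure M {x \<in> A i. f t x \<notin> A i} < d"
    by metis
  define m where "m = Max (n ` {..N})"
  show ?thesis
  proof (intro exI[of _ m] ballI)
    fix t assume t: "t \<in> K m"
    have D: "{x \<in> A i. f t x \<notin> A i} \<in> sets M" for i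
      by (rule crossing_sets[OF A meas[OF K_carrier[OF t]]])
    have "measure M (\<Union>i. {x \<in> A i. f t x \<notin> A i})
        \<le> measure M ((\<Union>i\<in>{..<N}. {x \<in> A i. f t x \<notin> A i}) \<union> R N)"
    proof (rule finite_measure_mono)
      show "(\<Union>i. {x \<in> A i. f t x \<notin> A i}) \<subseteq> (\<Union>i\<in>{..<N}. {x \<in> A i. f t x \<notin> A i}) \<union> R N"
        unfolding R_def by auto (metis atLeast_iff lessThan_iff not_le)
    qed (use D R in auto)
    also have "\<dots> \<le> measure M (\<Union>i\<in>{..<N}. {x \<in> A i. f t x \<notin> A i}) + measure M (R N)"
      by (rule measure_Un_le) (use D R in auto)
    also have "measure M (\<Union>i\<in>{..<N}. {x \<in> A i. f t x \<notin> A i})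
        \<le> (\<Sum>i\<in>{..<N}. measure M {x \<in> A i. f t x \<notin> A i})"
      by (rule finite_measure_subadditive_finite) (use D in auto)
    also have "\<dots> \<le> (\<Sum>i\<in>{..<N}. d)"
    proof (rule sum_mono)
      fix i assume i: "i \<in> {..<N}"
      have "n i \<le> m" unfolding m_def by (rule Max_ge) (use i in auto)
      then have "t \<in> K (n i)" using t K_mono by blast
      then show "measure M {x \<in> A i. f t x \<notin> A i} \<le> d" using n by (simp add: less_imp_le)
    qed
    also have "\<dots> = real N * d" by simp
    also have "\<dots> \<le> e / 2"
      using e unfolding d_def by (simp add: field_simps)
    finally show "measure M (\<Union>i. {x \<in> A i. f t x \<notin> A i}) < e" using N by linarith
  qed
qed

text \<open>A and its preimage have equal measure and share the points of A that stay in A, so as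
  much mass enters A as leaves it.\<close>

lemma measure_crossing:
  assumes A: "A \<in> sets M" and f: "f \<in> M \<rightarrow>\<^sub>M M"
    and pres: "emeasure M {x \<in> carrier G. f x \<in> A} = emeasure M A"
  shows "measure M {x \<in> space M. x \<notin> A \<and> f x \<in> A} = measure M {x \<in> space M. x \<in> A \<and> f x \<notin> A}"
proof -
  note [measurable] = A f
  have S: "{x \<in> space M. x \<in> A \<and> f x \<in> A} \<in> sets M" "{x \<in> space M. x \<notin> A \<and> f x \<in> A} \<in> sets M"
    "{x \<in> space M. x \<in> A \<and> f x \<notin> A} \<in> sets M"
    by measurable
  have "measure M A = measure M {x \<in> carrier G. f x \<in> A}"
    using pres by (simp add: measure_def)
  also have "{x \<in> carrier G. f x \<in> A} =
      {x \<in> space M. x \<in> A \<and> f x \<in> A} \<union> {x \<in> space M. x \<notin> A \<and> f x \<in> A}"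
    by (auto simp: space_M)
  also have "measure M \<dots> = measure M {x \<in> space M. x \<in> A \<and> f x \<in> A}
      + measure M {x \<in> space M. x \<notin> A \<and> f x \<in> A}"
    by (rule finite_measure_Union) (use S in auto)
  finally have 1: "measure M A = \<dots>" .
  have "A = {x \<in> space M. x \<in> A \<and> f x \<in> A} \<union> {x \<in> space M. x \<in> A \<and> f x \<notin> A}"
    using sets.sets_into_space[OF A] by auto
  then have "measure M A = measure M ({x \<in> space M. x \<in> A \<and> f x \<in> A}
      \<union> {x \<in> space M. x \<in> A \<and> f x \<notin> A})" by simp
  also have "\<dots> = measure M {x \<in> space M. x \<in> A \<and> f x \<in> A}
      + measure M {x \<in> space M. x \<in> A \<and> f x \<notin> A}"
    by (rule finite_measure_Union) (use S in auto)
  finally show ?thesis using 1 by simp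
qed

text \<open>An element of \<open>K n\<close> moves no point out of a cell of level n, so generators
  are trivial. Complements follow from \<open>measure_crossing\<close>, disjoint unions from
  \<open>disjoint_translate_continuous\<close>. The hypotheses on f are those shared by left and
  right translations.\<close>

lemma translate_continuous:
  assumes A: "A \<in> sets M"
    and meas: "\<And>t. t \<in> carrier G \<Longrightarrow> f t \<in> M \<rightarrow>\<^sub>M M"
    and pres: "\<And>t B. t \<in> carrier G \<Longrightarrow> B \<in> sets M \<Longrightarrow>
      emeasure M {x \<in> carrier G. f t x \<in> B} = emeasure M B"
    and cell: "\<And>n t a x. t \<in> K n \<Longrightarrow> a \<in> carrier G \<Longrightarrow> x \<in> cell n a \<Longrightarrow> f t x \<in> cell n a"
    and e: "(e::real) > 0"
  shows "\<exists>n. \<forall>t\<in>K n. measure M {x \<in> A. f t x \<notin> A} < e"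
proof -
  have "insert {} (\<Union>n. cell n ` L) \<subseteq> Pow (carrier G)" using cell_carrier by auto
  with Int_stable_cell
  have "\<forall>e>0::real. \<exists>n. \<forall>t\<in>K n. measure M {x \<in> A. f t x \<notin> A} < e"
    using A[unfolded sets_M_cell']
  proof (induction A rule: sigma_sets_induct_disjoint)
    case (basic A)
    show ?case
    proof (intro allI impI)
      fix e :: real assume e: "e > 0"
      show "\<exists>n. \<forall>t\<in>K n. measure M {x \<in> A. f t x \<notin> A} < e"
      proof (cases "A = {}")
        case False
        then obtain n a where a: "a \<in> L" "A = cell n a" using basic by blast
        then have "{x \<in> A. f t x \<notin> A} = {}" if "t \<in> K n" for t
          using cell[OF that L_carrier[OF a(1)]] by auto
        then have "measure M {x \<in> A. f t x \<notin> A} < e" if "t \<in> K n" for t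
          by (metis that e measure_empty)
        then show ?thesis by blast
      qed (use e in auto)
    qed
  next
    case (compl A)
    then have A: "A \<in> sets M" unfolding sets_M_cell' by simp
    note [measurable] = A
    have eq: "measure M {x \<in> carrier G - A. f t x \<notin> carrier G - A} = measure M {x \<in> A. f t x \<notin> A}"
      if t: "t \<in> carrier G" for t
    proof -
      have As: "A \<subseteq> carrier G" using sets.sets_into_space[OF A] by (simp add: space_M)
      have fc: "f t x \<in> carrier G" if "x \<in> carrier G" for x
        using measurable_carrier[OF meas[OF t]] that by (simp add: space_M)
      have "{x \<in> carrier G - A. f t x \<notin> carrier G - A} = {x \<in> space M. x \<notin> A \<and> f t x \<in> A}"
        using fc by (auto simp: space_M)
      moreover have "{x \<in> A. f t x \<notin> A} = {x \<in> space M. x \<in> A \<and> f t x \<notin> A}"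
        using As by (auto simp: space_M)
      ultimately show ?thesis using measure_crossing[OF A meas[OF t] pres[OF t A]] by simp
    qed
    show ?case
    proof (intro allI impI)
      fix e :: real assume "e > 0"
      then obtain n where n: "\<forall>t\<in>K n. measure M {x \<in> A. f t x \<notin> A} < e"
        using compl.IH by blast
      show "\<exists>n. \<forall>t\<in>K n. measure M {x \<in> carrier G - A. f t x \<notin> carrier G - A} < e"
        by (intro exI[of _ n] ballI, subst eq) (use n K_carrier in auto)
    qed
  next
    case (union A)
    then have A: "A i \<in> sets M" for i unfolding sets_M_cell' by auto
    show ?case
    proof (intro allI impI)
      fix e :: real assume e: "e > 0"
      have "\<exists>n. \<forall>t\<in>K n. measure M (\<Union>i. {x \<in> A i. f t x \<notin> A i}) < e"
      proof (rule disjoint_translate_continuous[OF union(1) A meas _ e])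
        show "\<exists>n. \<forall>t\<in>K n. measure M {x \<in> A i. f t x \<notin> A i} < d" if "d > 0" for i and d :: real
          using union(3)[of i] that by blast
      qed
      then obtain n where n: "\<And>t. t \<in> K n \<Longrightarrow> measure M (\<Union>i. {x \<in> A i. f t x \<notin> A i}) < e"
        by blast
      have "measure M {x \<in> \<Union>(range A). f t x \<notin> \<Union>(range A)}
          \<le> measure M (\<Union>i. {x \<in> A i. f t x \<notin> A i})" if t: "t \<in> K n" for t
      proof (rule finite_measure_mono)
        have "{x \<in> A i. f t x \<notin> A i} \<in> sets M" for i
          by (rule crossing_sets[OF A meas[OF K_carrier[OF t]]])
        then show "(\<Union>i. {x \<in> A i. f t x \<notin> A i}) \<in> sets M" by auto
      qed auto
      then show "\<exists>n. \<forall>t\<in>K n. measure M {x \<in> \<Union>(range A). f t x \<notin> \<Union>(range A)} < e"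
        using n by (meson order_le_less_trans)
    qed
  qed simp
  then show ?thesis using e by blast
qed

lemma right_continuous:
  assumes "A \<in> sets M" "(e::real) > 0"
  shows "\<exists>n. \<forall>t\<in>K n. measure M {x \<in> A. x \<otimes> t \<notin> A} < e"
proof (rule translate_continuous[OF assms(1) _ _ _ assms(2)])
  show "x \<otimes> t \<in> cell n a" if "t \<in> K n" "a \<in> carrier G" "x \<in> cell n a" for n t a x
    using cell_trans[OF that(3) cell_mult_K(1)[OF cell_carrier[OF that(3)] that(1)] that(2)] .
qed (use right_measurable right_emeasure in auto)

lemma left_continuous:
  assumes "A \<in> sets M" "(e::real) > 0"
  shows "\<exists>n. \<forall>t\<in>K n. measure M {x \<in> A. t \<otimes> x \<notin> A} < e"
proof (rule translate_continuous[OF assms(1) _ _ _ assms(2)])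
  show "t \<otimes> x \<in> cell n a" if "t \<in> K n" "a \<in> carrier G" "x \<in> cell n a" for n t a x
    using cell_trans[OF that(3) cell_mult_K(2)[OF cell_carrier[OF that(3)] that(1)] that(2)] .
qed (use left_measurable left_emeasure in auto)

text \<open>The level sets of w form a disjoint family, numbered by \<open>to_nat_on\<close>, and w
  changes under translation by t exactly where a point leaves its level set.\<close>

lemma right_continuous_countable:
  fixes w :: "'g \<Rightarrow> 'c"
  assumes C: "countable C" and wC: "\<And>x. x \<in> carrier G \<Longrightarrow> w x \<in> C"
    and meas: "\<And>c. c \<in> C \<Longrightarrow> {x \<in> carrier G. w x = c} \<in> sets M"
    and e: "(e::real) > 0"
  shows "\<exists>n. \<forall>t\<in>K n. measure M {x \<in> carrier G. w (x \<otimes> t) \<noteq> w x} < e"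
proof -
  define A where "A i = {x \<in> carrier G. to_nat_on C (w x) = i}" for i
  have A: "A i \<in> sets M" for i
  proof (cases "\<exists>c\<in>C. to_nat_on C c = i")
    case True
    then obtain c where c: "c \<in> C" "to_nat_on C c = i" by blast
    then have "A i = {x \<in> carrier G. w x = c}"
      unfolding A_def using wC to_nat_on_inj[OF C] by blast
    then show ?thesis using meas c by simp
  next
    case False
    then have "A i = {}" using wC by (auto simp: A_def)
    then show ?thesis by simp
  qed
  have disj: "disjoint_family A" by (auto simp: A_def disjoint_family_on_def)
  obtain n where n: "\<And>t. t \<in> K n \<Longrightarrow> measure M (\<Union>i. {x \<in> A i. x \<otimes> t \<notin> A i}) < e"
    using disjoint_translate_continuous[OF disj A right_measurable right_continuous[OF A] e] by blast
  have eq: "{x \<in> carrier G. w (x \<otimes> t) \<noteq> w x} = (\<Union>i. {x \<in> A i. x \<otimes> t \<notin> A i})"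
    if "t \<in> K n" for t
  proof -
    have "w (x \<otimes> t) \<noteq> w x \<longleftrightarrow> to_nat_on C (w (x \<otimes> t)) \<noteq> to_nat_on C (w x)"
      if x: "x \<in> carrier G" for x
      using to_nat_on_inj[OF C] wC x K_carrier[OF \<open>t \<in> K n\<close>] by simp
    then show ?thesis using K_carrier[OF that] by (auto simp: A_def)
  qed
  show ?thesis
    by (intro exI[of _ n] ballI) (simp only: eq n)
qed

section \<open>Measures without intermediate values, and strong ergodicity\<close>

lemma atom_of_dichotomy:
  assumes "prob_space N" and sN: "sets N = sets M" and e: "0 < e" "(e::real) < 1/3"
    and dich: "\<And>B. B \<in> sets M \<Longrightarrow> measure N B < e \<or> measure N B > 1 - e"
  shows "\<exists>y\<in>carrier G. measure N {y} \<ge> 1 - e"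
proof -
  interpret N: prob_space N by fact
  have cN: "cell n a \<in> sets N" if "a \<in> L" for n a using that L_carrier sN by auto
  have spN: "space N = carrier G" using sets_eq_imp_space_eq[OF sN] space_M by simp
  have Lne: "L \<noteq> {}" using subgroup.one_closed[OF subgroup_L] by auto
  define l where "l = from_nat_into L"
  have l: "l i \<in> L" for i unfolding l_def by (rule from_nat_into[OF Lne])
  have rl: "range l = L" unfolding l_def by (rule range_from_nat_into[OF Lne countable_L])
  \<comment> \<open>Otherwise add the cells of level n one at a time: a union of measure below e
    grows to less than 2e < 1-e, so by the dichotomy it stays below e, and the cells never exhaust
    the space.\<close>
  have "\<exists>a\<in>L. measure N (cell n a) > 1 - e" for n
  proof (rule ccontr)
    assume "\<not> ?thesis"
    then have small: "measure N (cell n a) < e" if "a \<in> L" for a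
      using that dich[of "cell n a"] L_carrier by force
    define U where "U k = (\<Union>i<k. cell n (l i))" for k
    have U: "U k \<in> sets N" for k unfolding U_def using cN l by auto
    have "measure N (U k) < e" for k
    proof (induction k)
      case (Suc k)
      have "U (Suc k) = U k \<union> cell n (l k)" by (auto simp: U_def less_Suc_eq)
      then have "measure N (U (Suc k)) \<le> measure N (U k) + measure N (cell n (l k))"
        using measure_Un_le[of "U k" N "cell n (l k)"] U cN l by simp
      then have "measure N (U (Suc k)) < 2 * e" using Suc small[OF l[of k]] by linarith
      then show ?case using dich[of "U (Suc k)"] U[of "Suc k"] sN e by auto
    qed (use e in \<open>simp add: U_def\<close>)
    moreover have "(\<lambda>k. measure N (U k)) \<longlonglongrightarrow> measure N (\<Union>k. U k)"
      by (rule N.finite_Lim_measure_incseq) (use U in \<open>auto simp: U_def incseq_def, fastforce\<close>)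
    ultimately have "measure N (\<Union>k. U k) \<le> e"
      by (intro LIMSEQ_le_const2) (auto intro: less_imp_le)
    moreover have "(\<Union>k. U k) = space N"
    proof -
      have "(\<Union>k. U k) = (\<Union>i. cell n (l i))" by (auto simp: U_def)
      also have "\<dots> = \<Union>(cell n ` range l)" by auto
      also have "\<dots> = carrier G" unfolding rl using dense_cell' cell_carrier by blast
      finally show ?thesis using spN by simp
    qed
    ultimately show False using N.prob_space e by simp
  qed
  then obtain a where aL: "\<And>n. a n \<in> L" and a: "\<And>n. measure N (cell n (a n)) > 1 - e" by metis
  define C where "C n = cell n (a n)" for n
  have C: "C n \<in> sets N" for n unfolding C_def using cN aL by auto
  \<comment> \<open>Sets of measure above 1-e > 1/2 meet, and cells that meet are nested. The heavy
    cells therefore decrease to a single point, which inherits their mass.\<close>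
  have dec: "C m \<subseteq> C n" if "n \<le> m" for n m
  proof -
    have "C n \<inter> C m \<noteq> {}"
    proof
      assume "C n \<inter> C m = {}"
      then have "measure N (C n \<union> C m) = measure N (C n) + measure N (C m)"
        using N.finite_measure_Union C by blast
      then show False using a[of n] a[of m] e N.prob_le_1[of "C n \<union> C m"] by (simp add: C_def)
    qed
    then obtain z where z: "z \<in> C n" "z \<in> C m" by blast
    then have "C n = cell n z" "C m = cell m z"
      using cell_eq L_carrier aL by (auto simp: C_def)
    then show ?thesis using cell_mono[OF that] by simp
  qed
  have "(\<lambda>n. measure N (C n)) \<longlonglongrightarrow> measure N (\<Inter>n. C n)"
    by (rule N.finite_Lim_measure_decseq) (use C dec in \<open>auto simp: decseq_def\<close>)
  then have ge: "measure N (\<Inter>n. C n) \<ge> 1 - e"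
    by (rule LIMSEQ_le_const) (use a in \<open>auto simp: C_def intro: less_imp_le\<close>)
  then have "(\<Inter>n. C n) \<noteq> {}" using e by auto
  then obtain y where y: "\<And>n. y \<in> C n" by blast
  then have yc: "y \<in> carrier G" using cell_carrier by (auto simp: C_def)
  have "z = y" if z: "\<And>n. z \<in> C n" for z
  proof (rule cell_all_eq[OF _ yc])
    show "z \<in> cell n y" for n
      using y[of n] z[of n] cell_eq[of y n "a n"] L_carrier[OF aL] by (simp add: C_def)
  qed
  then have "(\<Inter>n. C n) = {y}" using y by blast
  then show ?thesis using ge yc by auto
qed

text \<open>This is strong ergodicity of the translation action of \<open>L\<close>, the form in
  which spectral gap enters the rigidity argument. Measuring only the points that leave
  \<open>A n\<close> is enough: by \<open>measure_crossing\<close> the other half of the symmetric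
  difference is equally large.\<close>

definition gap :: bool where
  "gap \<longleftrightarrow> (\<forall>A :: nat \<Rightarrow> 'g set. \<forall>e::real. e > 0 \<longrightarrow>
     (\<forall>n. A n \<in> sets M \<and> e \<le> measure M (A n) \<and> measure M (A n) \<le> 1 - e) \<longrightarrow>
     \<not> (\<forall>g\<in>L. (\<lambda>n. measure M {x \<in> A n. g \<otimes> x \<notin> A n}) \<longlonglongrightarrow> 0))"

lemma gapD:
  assumes gap and e: "(e::real) > 0"
    and A: "\<And>n::nat. A n \<in> sets M" "\<And>n. e \<le> measure M (A n)" "\<And>n. measure M (A n) \<le> 1 - e"
    and lim: "\<And>g. g \<in> L \<Longrightarrow> (\<lambda>n. measure M {x \<in> A n. g \<otimes> x \<notin> A n}) \<longlonglongrightarrow> 0"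
  shows False
proof -
  have "\<forall>n. A n \<in> sets M \<and> e \<le> measure M (A n) \<and> measure M (A n) \<le> 1 - e" by (simp add: A)
  then have "\<not> (\<forall>g\<in>L. (\<lambda>n. measure M {x \<in> A n. g \<otimes> x \<notin> A n}) \<longlonglongrightarrow> 0)"
    using assms(1) e unfolding gap_def by blast
  then show False using lim by simp
qed

text \<open>Steinhaus argument: for t close to the identity some x and \<open>t \<otimes> x\<close>
  both lie in S, so t is a quotient of two elements of S.\<close>

lemma subgroup_openI:
  assumes S: "subgroup S G" "S \<in> sets M" "emeasure M S > 0"
  shows "openin T S"
proof -
  have pos: "measure M S > 0" using S(3) by (simp add: emeasure_eq_measure)
  obtain n where n: "\<And>t. t \<in> K n \<Longrightarrow> measure M {x \<in> S. t \<otimes> x \<notin> S} < measure M S"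
    using left_continuous[OF S(2) pos] by blast
  have Sc: "S \<subseteq> carrier G" using S(1) by (rule subgroup.subset)
  have KS: "K n \<subseteq> S"
  proof
    fix t assume t: "t \<in> K n"
    have "\<exists>x\<in>S. t \<otimes> x \<in> S"
    proof (rule ccontr)
      assume "\<not> ?thesis"
      then have "{x \<in> S. t \<otimes> x \<notin> S} = S" by blast
      then show False using n[OF t] by simp
    qed
    then obtain x where x: "x \<in> S" "t \<otimes> x \<in> S" by blast
    have "(t \<otimes> x) \<otimes> inv x \<in> S"
      using x S(1) by (simp add: subgroup.m_closed subgroup.m_inv_closed)
    moreover have "x \<in> carrier G" "t \<in> carrier G" using x Sc t K_carrier by auto
    ultimately show "t \<in> S" by (simp add: m_assoc)
  qed
  have "cell n x \<subseteq> S" if x: "x \<in> S" for x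
  proof
    fix y assume y: "y \<in> cell n x"
    then have "inv x \<otimes> y \<in> S" using KS by (auto simp: cell_def)
    then have "x \<otimes> (inv x \<otimes> y) \<in> S" using x S(1) by (simp add: subgroup.m_closed)
    then show "y \<in> S" using x Sc cell_carrier[OF y] by auto
  qed
  then show ?thesis unfolding openin_iff_cell using Sc by blast
qed

subsection \<open>Cosets of open subgroups\<close>

text \<open>Right cosets are used because the statement counts \<^term>\<open>rcosets S\<close>; the inverse makes
  \<open>coset_of S\<close> constant on left cosets, which is what left translations by \<open>L\<close> permute.\<close>

definition coset_of :: "'g set \<Rightarrow> 'g \<Rightarrow> 'g set" where
  "coset_of S x = S #> inv x"

lemma coset_of_rcosets: "subgroup S G \<Longrightarrow> x \<in> carrier G \<Longrightarrow> coset_of S x \<in> rcosets S"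
  unfolding coset_of_def using rcosetsI[OF subgroup.subset] by simp

lemma mem_coset_of:
  assumes "subgroup S G" "d \<in> carrier G" "x \<in> carrier G"
  shows "d \<in> coset_of S x \<longleftrightarrow> d \<otimes> x \<in> S"
proof
  assume "d \<in> coset_of S x"
  then obtain s where s: "s \<in> S" "d = s \<otimes> inv x" by (auto simp: coset_of_def r_coset_def)
  then show "d \<otimes> x \<in> S" using assms subgroup.mem_carrier[OF assms(1) s(1)] by (simp add: m_assoc)
next
  assume "d \<otimes> x \<in> S"
  moreover have "d = (d \<otimes> x) \<otimes> inv x" using assms by (simp add: m_assoc)
  ultimately show "d \<in> coset_of S x" unfolding coset_of_def r_coset_def by blast
qed

lemma rcoset_carrier: "subgroup S G \<Longrightarrow> c \<in> rcosets S \<Longrightarrow> d \<in> c \<Longrightarrow> d \<in> carrier G"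
  using subgroup.mem_carrier[of S G] by (auto simp: RCOSETS_def r_coset_def)

lemma coset_of_eq:
  assumes S: "subgroup S G" and c: "c \<in> rcosets S" "d \<in> c" and x: "x \<in> carrier G"
  shows "coset_of S x = c \<longleftrightarrow> d \<otimes> x \<in> S"
proof -
  have dc: "d \<in> carrier G" by (rule rcoset_carrier[OF S c])
  obtain g where g: "g \<in> carrier G" "c = S #> g" using c(1) by (auto simp: RCOSETS_def)
  have "c = S #> d" using repr_independence[of d S g] g c(2) S by simp
  moreover have "coset_of S x = S #> d" if "d \<in> coset_of S x"
    using repr_independence[of d S "inv x"] that x S by (simp add: coset_of_def)
  ultimately show ?thesis using mem_coset_of[OF S dc x] c(2) by metis
qed

lemma open_subgroup_contains_K:
  assumes "subgroup S G" "openin T S" shows "\<exists>n. K n \<subseteq> S"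
  using assms openin_iff_cell[of S] subgroup.one_closed[OF assms(1)] cell_one by metis

text \<open>Cosets of an open subgroup are open, so the dense set \<open>L\<close> meets each of
  them. Translating by a representative from \<open>L\<close> keeps a point in its orbit, which is
  why \<open>rep\<close> chooses inside \<open>L\<close>.\<close>

lemma rcoset_rep:
  assumes S: "subgroup S G" "openin T S" and c: "c \<in> rcosets S"
  shows "\<exists>a\<in>L. a \<in> c"
proof -
  obtain g where g: "g \<in> carrier G" "c = S #> g" using c by (auto simp: RCOSETS_def)
  obtain n where n: "K n \<subseteq> S" using open_subgroup_contains_K[OF S] by blast
  obtain l where l: "l \<in> L" "l \<in> cell n g" using dense_cell[OF g(1)] by blast
  have "l \<otimes> inv g \<in> K n"
    using cell_mult[OF l(2) cell_refl[of "inv g" n]] g(1) by (simp add: cell_one)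
  then have "l \<otimes> inv g \<in> S" using n by blast
  moreover have "l = (l \<otimes> inv g) \<otimes> g" using g(1) L_carrier[OF l(1)] by (simp add: m_assoc)
  ultimately have "l \<in> c" unfolding g(2) r_coset_def by blast
  then show ?thesis using l(1) by blast
qed

definition rep :: "'g set \<Rightarrow> 'g" where
  "rep c = (SOME a. a \<in> L \<and> a \<in> c)"

lemma rep:
  assumes "subgroup S G" "openin T S" "c \<in> rcosets S"
  shows "rep c \<in> L" "rep c \<in> c" "rep c \<in> carrier G"
proof -
  have "\<exists>a. a \<in> L \<and> a \<in> c" using rcoset_rep[OF assms] by blast
  then have "rep c \<in> L \<and> rep c \<in> c" unfolding rep_def by (rule someI_ex)
  then show "rep c \<in> L" "rep c \<in> c" "rep c \<in> carrier G" using L_carrier by auto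
qed

lemma rep_coset_of:
  assumes "subgroup S G" "openin T S" "x \<in> carrier G"
  shows "rep (coset_of S x) \<otimes> x \<in> S"
  using mem_coset_of[OF assms(1) rep(3)[OF assms(1,2)] assms(3)]
    rep(2)[OF assms(1,2)] coset_of_rcosets[OF assms(1,3)] by metis

lemma countable_rcosets:
  assumes "subgroup S G" "openin T S" shows "countable (rcosets S)"
proof (rule countable_image_inj_on)
  show "inj_on rep (rcosets S)"
  proof (rule inj_onI)
    fix c d assume c: "c \<in> rcosets S" and d: "d \<in> rcosets S" and eq: "rep c = rep d"
    have "rep c \<in> c \<inter> d" using rep(2)[OF assms c] rep(2)[OF assms d] eq by simp
    then show "c = d" using rcos_disjoint[OF assms(1)] c d by (auto simp: pairwise_def disjnt_def)
  qed
  show "countable (rep ` (rcosets S))"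
    by (rule countable_subset[OF _ countable_L]) (use rep(1)[OF assms] in blast)
qed

lemma coset_of_vimage:
  assumes "subgroup S G" "openin T S" "c \<in> rcosets S"
  shows "{x \<in> carrier G. coset_of S x = c} = {x \<in> carrier G. rep c \<otimes> x \<in> S}"
  using coset_of_eq[OF assms(1,3) rep(2)[OF assms]] by blast

lemma coset_of_sets:
  assumes "subgroup S G" "openin T S" "c \<in> rcosets S"
  shows "{x \<in> carrier G. coset_of S x = c} \<in> sets M"
  unfolding coset_of_vimage[OF assms]
  by (rule measurable_Collect_sets[OF left_measurable[OF rep(3)[OF assms]] open_sets[OF assms(2)]])

lemma coset_of_measurable:
  assumes "subgroup S G" "openin T S"
  shows "coset_of S \<in> M \<rightarrow>\<^sub>M count_space (rcosets S)"
  unfolding measurable_count_space_eq_countable[OF countable_rcosets[OF assms]]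
  using coset_of_sets[OF assms] coset_of_rcosets[OF assms(1)]
  by (simp add: vimage_def space_M Int_def conj_commute)

lemma measure_coset_of:
  assumes "subgroup S G" "openin T S" "c \<in> rcosets S"
  shows "measure M {x \<in> carrier G. coset_of S x = c} = measure M S"
  unfolding coset_of_vimage[OF assms]
  using left_emeasure[OF rep(3)[OF assms] open_sets[OF assms(2)]] by (simp add: measure_def)

lemma open_subgroup_positive:
  assumes "subgroup S G" "openin T S"
  shows "measure M S > 0"
  using open_positive[OF assms(2)] subgroup.one_closed[OF assms(1)]
  by (auto simp: emeasure_eq_measure)

text \<open>The fibres of \<open>coset_of S\<close> partition the group into left translates of S,
  all of the same measure. This is what converts equality of indices into equality of measures and
  back.\<close>

lemma index_measure:
  assumes S: "subgroup S G" "openin T S"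
  shows "finite (rcosets S)" and "real (card (rcosets S)) * measure M S = 1"
proof -
  have fin: "real (card F) * measure M S = measure M (\<Union>c\<in>F. {x \<in> carrier G. coset_of S x = c})"
    if "finite F" "F \<subseteq> rcosets S" for F
  proof -
    have "measure M (\<Union>c\<in>F. {x \<in> carrier G. coset_of S x = c}) =
        (\<Sum>c\<in>F. measure M {x \<in> carrier G. coset_of S x = c})"
      by (rule finite_measure_finite_Union[OF that(1)])
        (use coset_of_sets[OF S] that in \<open>auto simp: disjoint_family_on_def\<close>)
    also have "\<dots> = (\<Sum>c\<in>F. measure M S)"
      by (rule sum.cong) (use measure_coset_of[OF S] that in auto)
    finally show ?thesis by simp
  qed
  show fin_r: "finite (rcosets S)"
  proof (rule ccontr)
    assume "infinite (rcosets S)"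
    obtain k :: nat where k: "real k * measure M S > 1"
      using reals_Archimedean3[OF open_subgroup_positive[OF S]] by blast
    obtain F where F: "finite F" "card F = k" "F \<subseteq> rcosets S"
      using infinite_arbitrarily_large[OF \<open>infinite (rcosets S)\<close>] by blast
    show False using fin[OF F(1,3)] k F(2) prob_le_1 by (metis not_le)
  qed
  have "(\<Union>c\<in>rcosets S. {x \<in> carrier G. coset_of S x = c}) = space M"
    using coset_of_rcosets[OF S(1)] by (auto simp: space_M)
  then show "real (card (rcosets S)) * measure M S = 1"
    using fin[OF fin_r] prob_space by simp
qed

lemma emeasure_coset_sum:
  assumes S: "subgroup S G" "openin T S" and E: "E \<in> sets M"
  shows "emeasure M E = (\<Sum>c\<in>rcosets S. emeasure M (E \<inter> {x \<in> carrier G. coset_of S x = c}))"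
proof -
  have "E = (\<Union>c\<in>rcosets S. E \<inter> {x \<in> carrier G. coset_of S x = c})"
    using sets.sets_into_space[OF E] coset_of_rcosets[OF S(1)] by (auto simp: space_M)
  then have "emeasure M E = emeasure M (\<Union>c\<in>rcosets S. E \<inter> {x \<in> carrier G. coset_of S x = c})"
    by simp
  also have "\<dots> = (\<Sum>c\<in>rcosets S. emeasure M (E \<inter> {x \<in> carrier G. coset_of S x = c}))"
    by (rule sum_emeasure[symmetric])
      (use E coset_of_sets[OF S] index_measure(1)[OF S] in \<open>auto simp: disjoint_family_on_def\<close>)
  finally show ?thesis .
qed

section \<open>The orbit relation of \<open>L\<close>, and almost invariant sets as almost invariant
  vectors\<close>

definition same_orbit :: "('g \<times> 'g) set" where
  "same_orbit = {(x, y). x \<in> carrier G \<and> y \<in> carrier G \<and> x \<otimes> inv y \<in> L}"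

lemma same_orbit_translate:
  assumes "a \<in> L" "b \<in> L" "x \<in> carrier G" "y \<in> carrier G"
  shows "(a \<otimes> x, b \<otimes> y) \<in> same_orbit \<longleftrightarrow> (x, y) \<in> same_orbit"
proof -
  note ab = L_carrier[OF assms(1)] L_carrier[OF assms(2)]
  have 1: "(a \<otimes> x) \<otimes> inv (b \<otimes> y) = a \<otimes> (x \<otimes> inv y) \<otimes> inv b"
    using assms ab by (simp add: inv_mult_group m_assoc)
  have "a \<otimes> z \<otimes> inv b \<in> L \<longleftrightarrow> z \<in> L" if z: "z \<in> carrier G" for z
  proof
    assume "a \<otimes> z \<otimes> inv b \<in> L"
    then have "inv a \<otimes> (a \<otimes> z \<otimes> inv b) \<otimes> b \<in> L"
      using assms subgroup_L by (simp add: subgroup.m_closed subgroup.m_inv_closed)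
    then show "z \<in> L" using z ab by (simp add: m_assoc)
  qed (use assms subgroup_L in \<open>simp add: subgroup.m_closed subgroup.m_inv_closed\<close>)
  then show ?thesis using assms ab 1 by (simp add: same_orbit_def)
qed

text \<open>Almost invariant sets A of measure p yield the unit vectors (1_A - p) / sqrt (p (1 -
  p)), orthogonal to the constants. Translation by g displaces such a vector by a squared norm equal
  to the measure of the symmetric difference of A and its translate, divided by p (1 - p).\<close>

lemma gap_if_no_almost_invariant_vectors:
  assumes no: "\<not> (\<exists>\<xi> :: nat \<Rightarrow> 'g \<Rightarrow> complex. (\<forall>n. \<xi> n \<in> L2_mean_zero M \<and> L2_norm M (\<xi> n) = 1) \<and>
    (\<forall>g\<in>L. (\<lambda>n. L2_norm M (\<lambda>x. \<xi> n (g \<otimes> x) - \<xi> n x)) \<longlonglongrightarrow> 0))"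
  shows gap
  unfolding gap_def
proof (intro allI impI notI)
  fix A :: "nat \<Rightarrow> 'g set" and e :: real
  assume e: "e > 0" and A': "\<forall>n. A n \<in> sets M \<and> e \<le> measure M (A n) \<and> measure M (A n) \<le> 1 - e"
    and lim: "\<forall>g\<in>L. (\<lambda>n. measure M {x \<in> A n. g \<otimes> x \<notin> A n}) \<longlonglongrightarrow> 0"
  define p where "p n = measure M (A n)" for n
  define v where "v n = p n * (1 - p n)" for n
  have A: "A n \<in> sets M" and p: "e \<le> p n" "p n \<le> 1 - e" for n using A' by (auto simp: p_def)
  \<comment> \<open>Both p and 1 - p are at least e. This uniform lower bound is what lets small
    crossing measures force small displacements.\<close>
  have v: "v n \<ge> e * e" for n unfolding v_def by (rule mult_mono) (use p[of n] e in auto)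
  have vpos: "v n > 0" for n using v[of n] e by (metis less_le_trans mult_pos_pos)
  define h where "h n x = (indicator (A n) x - p n) / sqrt (v n)" for n x
  define \<xi> where "\<xi> n x = complex_of_real (h n x)" for n x
  have hm [measurable]: "h n \<in> borel_measurable M" for n unfolding h_def using A[of n] by measurable
  have h2: "(h n x)\<^sup>2 = (indicator (A n) x * (1 - 2 * p n) + (p n)\<^sup>2) / v n" for n x
    using vpos[of n] by (auto simp: h_def power_divide power2_diff indicator_def algebra_simps power2_eq_square)
  have iA: "integrable M (indicator (A n) :: _ \<Rightarrow> real)" for n
    using A[of n] by (simp add: less_top[symmetric])
  have intA: "(\<integral>x. indicator (A n) x \<partial>M) = p n" for n
    using A[of n] sets.sets_into_space[OF A[of n]] by (simp add: p_def Int_absorb2)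
  have int_h2: "integrable M (\<lambda>x. (h n x)\<^sup>2)" for n unfolding h2 using iA[of n] by simp
  have "(\<integral>x. h n x \<partial>M) = 0" for n
    unfolding h_def using iA[of n] intA[of n] prob_space by simp
  then have zero: "(\<integral>x. \<xi> n x \<partial>M) = 0" for n
    unfolding \<xi>_def by (simp add: integral_complex_of_real)
  have "(\<integral>x. (h n x)\<^sup>2 \<partial>M) = 1" for n
  proof -
    have "(\<integral>x. (h n x)\<^sup>2 \<partial>M) = (p n * (1 - 2 * p n) + (p n)\<^sup>2) / v n"
      unfolding h2 using iA[of n] intA[of n] prob_space by simp
    also have "p n * (1 - 2 * p n) + (p n)\<^sup>2 = v n" by (simp add: v_def algebra_simps power2_eq_square)
    finally show ?thesis using vpos[of n] by simp
  qed
  then have "L2_norm M (\<xi> n) = 1" for n by (simp add: L2_norm_def \<xi>_def)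
  moreover have "\<xi> n \<in> L2_mean_zero M" for n
  proof -
    have "\<xi> n \<in> borel_measurable M" unfolding \<xi>_def by measurable
    moreover have "integrable M (\<lambda>x. (cmod (\<xi> n x))\<^sup>2)" using int_h2[of n] by (simp add: \<xi>_def)
    ultimately show ?thesis using zero[of n] by (simp add: L2_mean_zero_def)
  qed
  moreover have "(\<lambda>n. L2_norm M (\<lambda>x. \<xi> n (g \<otimes> x) - \<xi> n x)) \<longlonglongrightarrow> 0" if g: "g \<in> L" for g
  proof -
    note gm = left_measurable[OF L_carrier[OF g]]
    define D where "D n = {x \<in> A n. g \<otimes> x \<notin> A n}" for n
    define D' where "D' n = {x \<in> space M. x \<notin> A n \<and> g \<otimes> x \<in> A n}" for n
    have As: "A n \<subseteq> space M" for n by (rule sets.sets_into_space[OF A])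
    have D_alt: "D n = {x \<in> space M. x \<in> A n \<and> g \<otimes> x \<notin> A n}" for n using As by (auto simp: D_def)
    have D: "D n \<in> sets M" "D' n \<in> sets M" for n
    proof -
      note [measurable] = A[of n] gm
      show "D n \<in> sets M" "D' n \<in> sets M" unfolding D_alt D'_def by measurable
    qed
    have eq: "measure M (D' n) = measure M (D n)" for n
      unfolding D_alt D'_def
      by (rule measure_crossing[OF A gm left_emeasure[OF L_carrier[OF g] A]])
    have "(\<integral>x. (cmod (\<xi> n (g \<otimes> x) - \<xi> n x))\<^sup>2 \<partial>M) = 2 * measure M (D n) / v n" for n
    proof -
      have "(\<integral>x. (cmod (\<xi> n (g \<otimes> x) - \<xi> n x))\<^sup>2 \<partial>M) =
          (\<integral>x. (indicator (D n) x + indicator (D' n) x) / v n \<partial>M)"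
      proof (rule Bochner_Integration.integral_cong[OF refl])
        fix x assume x: "x \<in> space M"
        have "cmod (\<xi> n (g \<otimes> x) - \<xi> n x) = \<bar>h n (g \<otimes> x) - h n x\<bar>"
          unfolding \<xi>_def of_real_diff[symmetric] norm_of_real by simp
        also have "h n (g \<otimes> x) - h n x = (indicator (A n) (g \<otimes> x) - indicator (A n) x) / sqrt (v n)"
          by (simp add: h_def diff_divide_distrib)
        finally have "(cmod (\<xi> n (g \<otimes> x) - \<xi> n x))\<^sup>2 =
            (indicator (A n) (g \<otimes> x) - indicator (A n) x)\<^sup>2 / v n"
          using vpos[of n] by (simp add: power_divide)
        then show "(cmod (\<xi> n (g \<otimes> x) - \<xi> n x))\<^sup>2 = (indicator (D n) x + indicator (D' n) x) / v n"
          using x by (auto simp: D_def D'_def indicator_def)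
      qed
      also have "\<dots> = (measure M (D n) + measure M (D' n)) / v n"
        using D[of n] sets.sets_into_space[OF D(1)[of n]] sets.sets_into_space[OF D(2)[of n]]
        by (simp add: Int_absorb2 less_top[symmetric])
      finally show ?thesis unfolding eq by simp
    qed
    then have L2: "L2_norm M (\<lambda>x. \<xi> n (g \<otimes> x) - \<xi> n x) = sqrt (2 * measure M (D n) / v n)" for n
      by (simp add: L2_norm_def)
    have "(\<lambda>n. sqrt (2 * measure M (D n) / (e * e))) \<longlonglongrightarrow> sqrt (2 * 0 / (e * e))"
      by (intro tendsto_intros) (use lim g e in \<open>auto simp: D_def\<close>)
    then have lim0: "(\<lambda>n. sqrt (2 * measure M (D n) / (e * e))) \<longlonglongrightarrow> 0" by simp
    show ?thesis unfolding L2
    proof (rule tendsto_sandwich[OF _ _ tendsto_const lim0])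
      show "\<forall>\<^sub>F n in sequentially. 0 \<le> sqrt (2 * measure M (D n) / v n)"
        using vpos by (intro always_eventually allI) (simp add: less_imp_le)
      show "\<forall>\<^sub>F n in sequentially. sqrt (2 * measure M (D n) / v n) \<le> sqrt (2 * measure M (D n) / (e * e))"
        using v vpos e by (intro always_eventually allI real_sqrt_le_mono divide_left_mono) auto
    qed
  qed
  ultimately show False using no by blast
qed

end

section \<open>From orbit maps to local homomorphisms\<close>

locale haar_group_pair =
  G: haar_group G M K T L + H: haar_group H N K' T' L'
  for G :: "('g, 'e) monoid_scheme" (structure) and M K T L
    and H :: "('h, 'f) monoid_scheme" and N K' T' L'
begin

abbreviation isos :: "'g set \<Rightarrow> 'h set \<Rightarrow> ('g \<Rightarrow> 'h) set" where
  "isos G0 H0 \<equiv> topological_group_iso (G\<lparr>carrier := G0\<rparr>) (subtopology T G0)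
    (H\<lparr>carrier := H0\<rparr>) (subtopology T' H0)"

text \<open>A representative of a germ of continuous homomorphisms: the last clause is continuity at
  the identity. Nothing is imposed outside \<open>K n\<close>, so passing to a smaller
  \<open>K m\<close> keeps the same function.\<close>

definition local_hom :: "nat \<Rightarrow> ('g \<Rightarrow> 'h) \<Rightarrow> bool" where
  "local_hom n \<delta> \<longleftrightarrow> (\<forall>t\<in>K n. \<delta> t \<in> carrier H) \<and> (\<forall>s\<in>K n. \<forall>t\<in>K n. \<delta> (s \<otimes> t) = \<delta> s \<otimes>\<^bsub>H\<^esub> \<delta> t) \<and>
    (\<forall>k. \<exists>m\<ge>n. \<forall>t\<in>K m. \<delta> t \<in> K' k)"

lemma local_hom_carrier: "local_hom n \<delta> \<Longrightarrow> t \<in> K n \<Longrightarrow> \<delta> t \<in> carrier H"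
  by (simp add: local_hom_def)

lemma local_hom_mult: "local_hom n \<delta> \<Longrightarrow> s \<in> K n \<Longrightarrow> t \<in> K n \<Longrightarrow> \<delta> (s \<otimes> t) = \<delta> s \<otimes>\<^bsub>H\<^esub> \<delta> t"
  by (simp add: local_hom_def)

lemma local_hom_cont: "local_hom n \<delta> \<Longrightarrow> \<exists>m\<ge>n. \<forall>t\<in>K m. \<delta> t \<in> K' k"
  by (simp add: local_hom_def)

lemma local_hom_mono:
  assumes "local_hom n \<delta>" "n \<le> m" shows "local_hom m \<delta>"
  unfolding local_hom_def
proof (intro conjI ballI allI)
  have K: "t \<in> K n" if "t \<in> K m" for t using G.K_mono[OF assms(2) that] .
  show "\<delta> t \<in> carrier H" if "t \<in> K m" for t using local_hom_carrier[OF assms(1) K[OF that]] .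
  show "\<delta> (s \<otimes> t) = \<delta> s \<otimes>\<^bsub>H\<^esub> \<delta> t" if "s \<in> K m" "t \<in> K m" for s t
    using local_hom_mult[OF assms(1) K[OF that(1)] K[OF that(2)]] .
  fix k
  obtain l where "l \<ge> n" "\<forall>t\<in>K l. \<delta> t \<in> K' k" using local_hom_cont[OF assms(1)] by blast
  then show "\<exists>l\<ge>m. \<forall>t\<in>K l. \<delta> t \<in> K' k"
    using G.K_mono[of l "max l m"] by (intro exI[of _ "max l m"]) auto
qed

lemma local_hom_one:
  assumes "local_hom n \<delta>" shows "\<delta> \<one> = \<one>\<^bsub>H\<^esub>"
proof -
  have "\<delta> \<one> \<otimes>\<^bsub>H\<^esub> \<delta> \<one> = \<delta> \<one>" using local_hom_mult[OF assms, of "\<one>" "\<one>"] by simp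
  then show ?thesis using local_hom_carrier[OF assms, of "\<one>"] by simp
qed

lemma local_hom_inv:
  assumes "local_hom n \<delta>" "t \<in> K n" shows "\<delta> (inv t) = inv\<^bsub>H\<^esub> (\<delta> t)"
proof -
  note t = G.K_inv[OF assms(2)]
  have "\<delta> (inv t) \<otimes>\<^bsub>H\<^esub> \<delta> t = \<one>\<^bsub>H\<^esub>"
    using local_hom_mult[OF assms(1) t assms(2)] G.K_carrier[OF assms(2)] local_hom_one[OF assms(1)]
    by simp
  then show ?thesis
    using H.inv_equality[of "\<delta> (inv t)" "\<delta> t"] local_hom_carrier[OF assms(1)] t assms(2) by simp
qed

lemma local_hom_continuous:
  assumes "local_hom n \<delta>"
  shows "continuous_map (subtopology T (K n)) T' \<delta>"
  unfolding continuous_map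
proof (intro conjI allI impI)
  have top: "topspace (subtopology T (K n)) = K n"
    using G.K_carrier by (auto simp: G.topspace_T)
  then show "\<delta> ` topspace (subtopology T (K n)) \<subseteq> topspace T'"
    using local_hom_carrier[OF assms] by (auto simp: H.topspace_T)
  fix U assume U: "openin T' U"
  have "openin T {x \<in> K n. \<delta> x \<in> U}"
    unfolding G.openin_iff_cell
  proof (intro conjI ballI)
    show "{x \<in> K n. \<delta> x \<in> U} \<subseteq> carrier G" using G.K_carrier by blast
    fix x assume "x \<in> {x \<in> K n. \<delta> x \<in> U}"
    then have x: "x \<in> K n" "\<delta> x \<in> U" by auto
    obtain k where k: "H.cell k (\<delta> x) \<subseteq> U" using U x(2) H.openin_iff_cell by blast
    obtain m where m: "m \<ge> n" "\<And>t. t \<in> K m \<Longrightarrow> \<delta> t \<in> K' k" using local_hom_cont[OF assms] by blast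
    have "G.cell m x \<subseteq> {x \<in> K n. \<delta> x \<in> U}"
    proof
      fix y assume y: "y \<in> G.cell m x"
      define t where "t = inv x \<otimes> y"
      have t: "t \<in> K m" using y by (simp add: t_def G.cell_def)
      have xc: "x \<in> carrier G" by (rule G.K_carrier[OF x(1)])
      have yt: "y = x \<otimes> t" using xc G.cell_carrier[OF y] by (simp add: t_def)
      have tn: "t \<in> K n" using G.K_mono[OF m(1) t] .
      have "\<delta> y = \<delta> x \<otimes>\<^bsub>H\<^esub> \<delta> t" unfolding yt by (rule local_hom_mult[OF assms x(1) tn])
      also have "\<dots> \<in> H.cell k (\<delta> x)"
        using m(2)[OF t] local_hom_carrier[OF assms] x tn by (simp add: H.cell_def)
      finally show "y \<in> {x \<in> K n. \<delta> x \<in> U}" using k G.K_mult[OF x(1) tn] yt by auto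
    qed
    then show "\<exists>m. G.cell m x \<subseteq> {x \<in> K n. \<delta> x \<in> U}" by blast
  qed
  then show "openin (subtopology T (K n)) {x \<in> topspace (subtopology T (K n)). \<delta> x \<in> U}"
    unfolding top by (simp add: openin_open_subtopology[OF G.openin_K] subset_iff)
qed

text \<open>Measurability on M calls for a total function; outside \<open>G0\<close> the value is
  constant, so the complement contributes all or nothing to a preimage.\<close>

lemma continuous_extension_measurable:
  assumes G0: "openin T G0" and f: "continuous_map (subtopology T G0) T' f"
  shows "(\<lambda>x. if x \<in> G0 then f x else \<one>\<^bsub>H\<^esub>) \<in> M \<rightarrow>\<^sub>M N"
proof (rule H.measurableI)
  have sub: "G0 \<subseteq> carrier G" using openin_subset[OF G0] by (simp add: G.topspace_T)
  then have top: "topspace (subtopology T G0) = G0" by (auto simp: G.topspace_T)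
  have fc: "f x \<in> carrier H" if "x \<in> G0" for x
    using continuous_map_image_subset_topspace[OF f] that unfolding top H.topspace_T by blast
  then show "(if x \<in> G0 then f x else \<one>\<^bsub>H\<^esub>) \<in> carrier H" if "x \<in> space M" for x by simp
  fix k a assume a: "a \<in> L'"
  have "openin (subtopology T G0) {x \<in> topspace (subtopology T G0). f x \<in> H.cell k a}"
    using f H.openin_cell[OF H.L_carrier[OF a], of k] by (rule openin_continuous_map_preimage)
  then have "openin T {x \<in> G0. f x \<in> H.cell k a}"
    unfolding top openin_open_subtopology[OF G0] by blast
  then have 1: "{x \<in> G0. f x \<in> H.cell k a} \<in> sets M" by (rule G.open_sets)
  have 2: "space M - G0 \<in> sets M" using G.open_sets[OF G0] by (rule sets.compl_sets)
  have "{x \<in> space M. (if x \<in> G0 then f x else \<one>\<^bsub>H\<^esub>) \<in> H.cell k a} =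
    {x \<in> G0. f x \<in> H.cell k a} \<union> (if \<one>\<^bsub>H\<^esub> \<in> H.cell k a then space M - G0 else {})"
    using sub by (auto simp: G.space_M)
  also have "\<dots> \<in> sets M" using 1 2 by simp
  finally show "{x \<in> space M. (if x \<in> G0 then f x else \<one>\<^bsub>H\<^esub>) \<in> H.cell k a} \<in> sets M" .
qed

lemma local_hom_injective:
  assumes \<delta>: "local_hom n \<delta>" and L: "\<And>r. r \<in> K n \<Longrightarrow> \<delta> r = \<one>\<^bsub>H\<^esub> \<Longrightarrow> r \<in> L"
  shows "\<exists>m\<ge>n. inj_on \<delta> (K m)"
proof -
  define D where "D = {r \<in> K n. \<delta> r = \<one>\<^bsub>H\<^esub>}"
  have cD: "countable D" 
    by (rule countable_subset[OF _ G.countable_L]) (use L in \<open>auto simp: D_def\<close>)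
  have Dc: "D \<subseteq> carrier G" using G.K_carrier by (auto simp: D_def)
  have top: "topspace (subtopology T (K n)) = K n"
    using G.K_carrier by (auto simp: G.topspace_T)
  have "closedin T' {\<one>\<^bsub>H\<^esub>}" using H.Hausdorff_T by (simp add: closedin_Hausdorff_singleton H.topspace_T)
  then have "closedin (subtopology T (K n)) {x \<in> topspace (subtopology T (K n)). \<delta> x \<in> {\<one>\<^bsub>H\<^esub>}}"
    by (rule closedin_continuous_map_preimage[OF local_hom_continuous[OF \<delta>]])
  then have "closedin T D"
    unfolding top closedin_closed_subtopology[OF G.closedin_K] by (simp add: D_def)
  define X where "X = subtopology T D"
  have tX: "topspace X = D" using Dc by (auto simp: X_def G.topspace_T)
  have comp: "compact_space X"
    unfolding X_def using closedin_compact_space[OF G.compact_T \<open>closedin T D\<close>]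
    by (rule compact_space_subtopology)
  have Haus: "Hausdorff_space X" unfolding X_def by (rule Hausdorff_space_subtopology[OF G.Hausdorff_T])
  have loc: "locally_compact_space X" using comp by (rule compact_imp_locally_compact_space)
  have reg: "regular_space X" using comp Haus by (rule compact_Hausdorff_imp_regular_space)
  have oneD: "\<one> \<in> D" using local_hom_one[OF \<delta>] by (simp add: D_def)
  \<comment> \<open>The kernel is compact and countable, so by Baire it has an isolated point.\<close>
  have "\<exists>d\<in>D. X interior_of {d} \<noteq> {}"
  proof (rule ccontr)
    assume "\<not> ?thesis"
    then have "\<And>S. S \<in> (\<lambda>d. {d}) ` D \<Longrightarrow> closedin X S \<and> X interior_of S = {}"
      using closedin_Hausdorff_singleton[OF Haus] by (auto simp: tX)
    then have "X interior_of \<Union> ((\<lambda>d. {d}) ` D) = {}"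
      using loc reg cD by (intro Baire_category_alt) auto
    then have "X interior_of D = {}" by simp
    then show False using oneD interior_of_topspace[of X] by (auto simp: tX)
  qed
  then obtain d where d: "d \<in> D" "X interior_of {d} \<noteq> {}" by blast
  have "openin X {d}"
    using d openin_interior_of[of X "{d}"] interior_of_subset[of X "{d}"] by (metis subset_singletonD)
  then obtain U where U: "openin T U" "{d} = U \<inter> D"
    unfolding X_def openin_subtopology by blast
  obtain m0 where m0: "G.cell m0 d \<subseteq> U" using U G.openin_iff_cell by blast
  define m where "m = max m0 n"
  have m: "n \<le> m" "G.cell m d \<subseteq> U" using m0 G.cell_mono[of m0 m d] by (auto simp: m_def)
  have dn: "d \<in> K n" "\<delta> d = \<one>\<^bsub>H\<^esub>" using d by (auto simp: D_def)
  \<comment> \<open>One isolated kernel element d suffices: if r is in the kernel and in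
    \<open>K m\<close>, then \<open>d \<otimes> r\<close> is a kernel element in the neighbourhood
    of d that contains no other, so r is trivial.\<close>
  have ker: "r = \<one>" if r: "r \<in> K m" "\<delta> r = \<one>\<^bsub>H\<^esub>" for r
  proof -
    have rn: "r \<in> K n" using G.K_mono[OF m(1) r(1)] .
    have "\<delta> (d \<otimes> r) = \<one>\<^bsub>H\<^esub>" using local_hom_mult[OF \<delta> dn(1) rn] dn r by simp
    then have "d \<otimes> r \<in> D" using G.K_mult[OF dn(1) rn] by (simp add: D_def)
    moreover have "d \<otimes> r \<in> U"
      using m(2) G.cell_mult_K(1)[OF G.K_carrier[OF dn(1)] r(1)] by blast
    ultimately have "d \<otimes> r = d" using U(2) by blast
    then show ?thesis using G.K_carrier[OF dn(1)] G.K_carrier[OF rn] by simp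
  qed
  have "inj_on \<delta> (K m)"
  proof (rule inj_onI)
    fix s t assume s: "s \<in> K m" and t: "t \<in> K m" and eq: "\<delta> s = \<delta> t"
    note \<delta>m = local_hom_mono[OF \<delta> m(1)]
    have "\<delta> (inv s \<otimes> t) = inv\<^bsub>H\<^esub> (\<delta> s) \<otimes>\<^bsub>H\<^esub> \<delta> t"
      using local_hom_mult[OF \<delta>m G.K_inv[OF s] t] local_hom_inv[OF \<delta>m s] by simp
    also have "\<dots> = \<one>\<^bsub>H\<^esub>" using eq local_hom_carrier[OF \<delta>m t] by simp
    finally have "inv s \<otimes> t = \<one>" using ker[OF G.K_mult[OF G.K_inv[OF s] t]] by simp
    then have "s \<otimes> (inv s \<otimes> t) = s" using G.K_carrier[OF s] by simp
    then show "s = t" using G.K_carrier[OF s] G.K_carrier[OF t] by simp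
  qed
  then show ?thesis using m(1) by blast
qed

text \<open>\<open>K n\<close> is compact and H is Hausdorff, so a continuous injection is a
  homeomorphism onto a closed image. Openness of the image is a separate question, decided by
  measure.\<close>

lemma local_hom_iso:
  assumes \<delta>: "local_hom n \<delta>" and inj: "inj_on \<delta> (K n)"
    and L: "\<And>r. r \<in> K n \<Longrightarrow> r \<in> L \<longleftrightarrow> \<delta> r \<in> L'"
  shows "\<delta> \<in> isos (K n) (\<delta> ` K n)"
    and "subgroup (\<delta> ` K n) H" and "closedin T' (\<delta> ` K n)"
    and "\<delta> ` (L \<inter> K n) = L' \<inter> \<delta> ` K n"
proof -
  have top: "topspace (subtopology T (K n)) = K n"
    using G.K_carrier by (auto simp: G.topspace_T)
  have sub: "\<delta> ` K n \<subseteq> carrier H" using local_hom_carrier[OF \<delta>] by blast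
  have "compactin T (K n)" using closedin_compact_space[OF G.compact_T G.closedin_K] .
  then have comp: "compact_space (subtopology T (K n))" by (rule compact_space_subtopology)
  have cont: "continuous_map (subtopology T (K n)) T' \<delta>" by (rule local_hom_continuous[OF \<delta>])
  have "compactin T' (\<delta> ` K n)"
    using image_compactin[OF comp[unfolded compact_space_def] cont] unfolding top .
  then show "closedin T' (\<delta> ` K n)" by (rule compactin_imp_closedin[OF H.Hausdorff_T])
  have "homeomorphic_map (subtopology T (K n)) (subtopology T' (\<delta> ` K n)) \<delta>"
  proof (rule continuous_imp_homeomorphic_map[OF _ comp])
    show "continuous_map (subtopology T (K n)) (subtopology T' (\<delta> ` K n)) \<delta>"
      using cont by (simp add: continuous_map_in_subtopology top)
    show "Hausdorff_space (subtopology T' (\<delta> ` K n))"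
      by (rule Hausdorff_space_subtopology[OF H.Hausdorff_T])
  qed (use sub inj in \<open>auto simp: top[unfolded topspace_subtopology] H.topspace_T\<close>)
  moreover have "\<delta> \<in> iso (G\<lparr>carrier := K n\<rparr>) (H\<lparr>carrier := \<delta> ` K n\<rparr>)"
    using inj local_hom_mult[OF \<delta>] by (auto simp: iso_def hom_def bij_betw_def)
  ultimately show "\<delta> \<in> isos (K n) (\<delta> ` K n)"
    by (simp add: topological_group_iso_def)
  show "subgroup (\<delta> ` K n) H"
  proof (rule H.subgroupI)
    show "\<delta> ` K n \<noteq> {}" using G.one_K by blast
    fix a assume "a \<in> \<delta> ` K n"
    then obtain s where s: "s \<in> K n" "a = \<delta> s" by blast
    show "inv\<^bsub>H\<^esub> a \<in> \<delta> ` K n"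
      using local_hom_inv[OF \<delta> s(1)] G.K_inv[OF s(1)] s(2) by (metis imageI)
    fix b assume "b \<in> \<delta> ` K n"
    then obtain t where t: "t \<in> K n" "b = \<delta> t" by blast
    show "a \<otimes>\<^bsub>H\<^esub> b \<in> \<delta> ` K n"
      using local_hom_mult[OF \<delta> s(1) t(1)] G.K_mult[OF s(1) t(1)] s(2) t(2) by (metis imageI)
  qed (rule sub)
  show "\<delta> ` (L \<inter> K n) = L' \<inter> \<delta> ` K n" using L by blast
qed

end

section \<open>Rigidity of maps that send orbits into orbits\<close>

locale orbit_map = haar_group_pair G M K T L H N K' T' L'
  for G :: "('g, 'e) monoid_scheme" (structure) and M K T L
    and H :: "('h, 'f) monoid_scheme" and N K' T' L' +
  fixes \<theta> :: "'g \<Rightarrow> 'h"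
  assumes \<theta>_measurable: "\<theta> \<in> M \<rightarrow>\<^sub>M N"
    and \<theta>_orbit: "g \<in> L \<Longrightarrow> x \<in> carrier G \<Longrightarrow> \<theta> (g \<otimes> x) \<otimes>\<^bsub>H\<^esub> inv\<^bsub>H\<^esub> (\<theta> x) \<in> L'"
    and gap: "G.gap"
begin

lemma \<theta>_carrier: "x \<in> carrier G \<Longrightarrow> \<theta> x \<in> carrier H"
  using H.measurable_carrier[OF \<theta>_measurable] by (simp add: G.space_M)

lemma measurable_right: "t \<in> carrier G \<Longrightarrow> (\<lambda>x. \<theta> (x \<otimes> t)) \<in> M \<rightarrow>\<^sub>M N"
  using measurable_compose[OF G.right_measurable \<theta>_measurable] .

lemma measurable_left: "g \<in> carrier G \<Longrightarrow> (\<lambda>x. \<theta> (g \<otimes> x)) \<in> M \<rightarrow>\<^sub>M N"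
  using measurable_compose[OF G.left_measurable \<theta>_measurable] .

lemma agree_sets:
  assumes "t \<in> carrier G" "y \<in> carrier H"
  shows "{x \<in> carrier G. \<theta> (x \<otimes> t) = \<theta> x \<otimes>\<^bsub>H\<^esub> y} \<in> sets M"
proof -
  have "(\<lambda>x. \<theta> x \<otimes>\<^bsub>H\<^esub> y) \<in> M \<rightarrow>\<^sub>M N"
    by (rule H.mult_measurable[OF \<theta>_measurable measurable_const]) (simp add: H.space_M assms)
  from H.eq_sets[OF measurable_right[OF assms(1)] this] show ?thesis
    by (simp add: G.space_M)
qed

text \<open>The cocycle takes values in the countable \<open>L'\<close>, so its level sets form a
  countable partition that small right translations nearly preserve.\<close>

lemma local_cocycle_continuous:
  assumes g: "g \<in> L" and e: "(e::real) > 0"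
  shows "\<exists>n. \<forall>t\<in>K n. measure M {x \<in> carrier G.
      \<theta> (g \<otimes> (x \<otimes> t)) \<otimes>\<^bsub>H\<^esub> inv\<^bsub>H\<^esub> (\<theta> (x \<otimes> t)) \<noteq> \<theta> (g \<otimes> x) \<otimes>\<^bsub>H\<^esub> inv\<^bsub>H\<^esub> (\<theta> x)} < e"
proof (rule G.right_continuous_countable[OF H.countable_L _ _ e])
  show "\<theta> (g \<otimes> x) \<otimes>\<^bsub>H\<^esub> inv\<^bsub>H\<^esub> (\<theta> x) \<in> L'" if "x \<in> carrier G" for x
    using \<theta>_orbit g that by blast
  fix c assume c: "c \<in> L'"
  have "(\<lambda>x. \<theta> (g \<otimes> x) \<otimes>\<^bsub>H\<^esub> inv\<^bsub>H\<^esub> (\<theta> x)) \<in> M \<rightarrow>\<^sub>M N"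
    by (intro H.mult_measurable H.inv_measurable measurable_left \<theta>_measurable G.L_carrier g)
  from G.measurable_Collect_sets[OF this H.singleton_sets[OF H.L_carrier[OF c]]]
  show "{x \<in> carrier G. \<theta> (g \<otimes> x) \<otimes>\<^bsub>H\<^esub> inv\<^bsub>H\<^esub> (\<theta> x) = c} \<in> sets M" by simp
qed

text \<open>Failure gives t n in \<open>K n\<close> for which the law of F n has no atom of mass
  1-e. By \<open>atom_of_dichotomy\<close> some B n then has a preimage of measure in [e, 1-e], and
  these preimages contradict \<open>gap\<close>.\<close>

lemma concentration:
  assumes e: "0 < e" "(e::real) < 1/3"
  shows "\<exists>n. \<forall>t\<in>K n. \<exists>y\<in>carrier H. measure M {x \<in> carrier G. \<theta> (x \<otimes> t) = \<theta> x \<otimes>\<^bsub>H\<^esub> y} \<ge> 1 - e"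
proof (rule ccontr)
  assume "\<not> ?thesis"
  then have "\<forall>n. \<exists>t. t \<in> K n \<and> (\<forall>y\<in>carrier H. measure M {x \<in> carrier G. \<theta> (x \<otimes> t) = \<theta> x \<otimes>\<^bsub>H\<^esub> y} < 1 - e)"
    by (meson not_le)
  then obtain t where t: "\<forall>n. t n \<in> K n \<and>
      (\<forall>y\<in>carrier H. measure M {x \<in> carrier G. \<theta> (x \<otimes> t n) = \<theta> x \<otimes>\<^bsub>H\<^esub> y} < 1 - e)"
    by (rule exE[OF choice])
  then have tK: "t n \<in> K n" and small: "y \<in> carrier H \<Longrightarrow>
      measure M {x \<in> carrier G. \<theta> (x \<otimes> t n) = \<theta> x \<otimes>\<^bsub>H\<^esub> y} < 1 - e" for n y
    by blast+
  have tc: "t n \<in> carrier G" for n by (rule G.K_carrier[OF tK])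
  \<comment> \<open>Right translation commutes with the left action, so \<open>F n\<close> fails to be \<open>L\<close>-invariant only where
    the cocycle \<open>\<theta> (g \<otimes> x) \<otimes> inv (\<theta> x)\<close> changes between \<open>x\<close> and \<open>x \<otimes> t n\<close>.\<close>
  define F where "F n x = inv\<^bsub>H\<^esub> (\<theta> x) \<otimes>\<^bsub>H\<^esub> \<theta> (x \<otimes> t n)" for n x
  have F: "F n \<in> M \<rightarrow>\<^sub>M N" for n
    unfolding F_def by (intro H.mult_measurable H.inv_measurable \<theta>_measurable measurable_right tc)
  have "\<exists>B\<in>sets N. e \<le> measure M (F n -` B \<inter> space M) \<and> measure M (F n -` B \<inter> space M) \<le> 1 - e" for n
  proof (rule ccontr)
    assume "\<not> ?thesis"
    then have dich: "measure (distr M N (F n)) B < e \<or> measure (distr M N (F n)) B > 1 - e"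
      if "B \<in> sets N" for B
      using that F by (auto simp: measure_distr not_le)
    obtain y where y: "y \<in> carrier H" "measure (distr M N (F n)) {y} \<ge> 1 - e"
      using H.atom_of_dichotomy[OF G.prob_space_distr[OF F] _ e dich] by auto
    have "F n -` {y} \<inter> space M = {x \<in> carrier G. \<theta> (x \<otimes> t n) = \<theta> x \<otimes>\<^bsub>H\<^esub> y}"
    proof -
      have "inv\<^bsub>H\<^esub> (\<theta> x) \<otimes>\<^bsub>H\<^esub> \<theta> (x \<otimes> t n) = y \<longleftrightarrow> \<theta> (x \<otimes> t n) = \<theta> x \<otimes>\<^bsub>H\<^esub> y" if "x \<in> carrier G" for x
        using \<theta>_carrier that tc y by auto
      then have "{x \<in> carrier G. F n x = y} = {x \<in> carrier G. \<theta> (x \<otimes> t n) = \<theta> x \<otimes>\<^bsub>H\<^esub> y}"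
        unfolding F_def by (intro Collect_cong conj_cong refl)
      then show ?thesis by (simp add: vimage_def G.space_M Int_def conj_commute)
    qed
    then have "measure (distr M N (F n)) {y} = measure M {x \<in> carrier G. \<theta> (x \<otimes> t n) = \<theta> x \<otimes>\<^bsub>H\<^esub> y}"
      using measure_distr[OF F H.singleton_sets[OF y(1)]] by simp
    then show False using small[OF y(1), of n] y(2) by simp
  qed
  then obtain B where B: "\<And>n. B n \<in> sets N" and
    Be: "\<And>n. e \<le> measure M (F n -` B n \<inter> space M)" "\<And>n. measure M (F n -` B n \<inter> space M) \<le> 1 - e"
    by metis
  define A where "A n = F n -` B n \<inter> space M" for n
  have A: "A n \<in> sets M" for n unfolding A_def using F B by (rule measurable_sets)
  have "(\<lambda>n. measure M {x \<in> A n. g \<otimes> x \<notin> A n}) \<longlonglongrightarrow> 0" if g: "g \<in> L" for g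
  proof (rule LIMSEQ_I)
    fix r :: real assume r: "r > 0"
    have gc: "g \<in> carrier G" using g by (rule G.L_carrier)
    obtain n where n: "\<And>t. t \<in> K n \<Longrightarrow> measure M {x \<in> carrier G.
      \<theta> (g \<otimes> (x \<otimes> t)) \<otimes>\<^bsub>H\<^esub> inv\<^bsub>H\<^esub> (\<theta> (x \<otimes> t)) \<noteq> \<theta> (g \<otimes> x) \<otimes>\<^bsub>H\<^esub> inv\<^bsub>H\<^esub> (\<theta> x)} < r"
      using local_cocycle_continuous[OF g r] by blast
    show "\<exists>no. \<forall>m\<ge>no. norm (measure M {x \<in> A m. g \<otimes> x \<notin> A m} - 0) < r"
    proof (intro exI[of _ n] allI impI)
      fix m assume m: "n \<le> m"
      let ?W = "{x \<in> carrier G. \<theta> (g \<otimes> (x \<otimes> t m)) \<otimes>\<^bsub>H\<^esub> inv\<^bsub>H\<^esub> (\<theta> (x \<otimes> t m)) \<noteq> \<theta> (g \<otimes> x) \<otimes>\<^bsub>H\<^esub> inv\<^bsub>H\<^esub> (\<theta> x)}"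
      have "measure M {x \<in> A m. g \<otimes> x \<notin> A m} \<le> measure M ?W"
      proof (rule G.finite_measure_mono)
        show "{x \<in> A m. g \<otimes> x \<notin> A m} \<subseteq> ?W"
        proof
          fix x assume "x \<in> {x \<in> A m. g \<otimes> x \<notin> A m}"
          then have x: "x \<in> carrier G" "F m x \<in> B m" "g \<otimes> x \<notin> A m"
            by (auto simp: A_def G.space_M)
          have nB: "F m (g \<otimes> x) \<notin> B m" using x gc by (auto simp: A_def G.space_M)
          show "x \<in> ?W"
          proof (rule ccontr)
            assume "x \<notin> ?W"
            then have w: "\<theta> (g \<otimes> (x \<otimes> t m)) \<otimes>\<^bsub>H\<^esub> inv\<^bsub>H\<^esub> (\<theta> (x \<otimes> t m)) = \<theta> (g \<otimes> x) \<otimes>\<^bsub>H\<^esub> inv\<^bsub>H\<^esub> (\<theta> x)"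
              using x by simp
            \<comment> \<open>Equal cocycle values, a over b and c over d, rearrange to equality of
              inv c times a and inv d times b: F takes the same value at
              \<open>g \<otimes> x\<close> and at x.\<close>
            define a b c d where "a = \<theta> (g \<otimes> (x \<otimes> t m))" and "b = \<theta> (x \<otimes> t m)"
              and "c = \<theta> (g \<otimes> x)" and "d = \<theta> x"
            have car: "a \<in> carrier H" "b \<in> carrier H" "c \<in> carrier H" "d \<in> carrier H"
              unfolding a_def b_def c_def d_def using x gc tc by (auto intro!: \<theta>_carrier)
            have "a = (a \<otimes>\<^bsub>H\<^esub> inv\<^bsub>H\<^esub> b) \<otimes>\<^bsub>H\<^esub> b" using car by (simp add: H.m_assoc)
            also have "a \<otimes>\<^bsub>H\<^esub> inv\<^bsub>H\<^esub> b = c \<otimes>\<^bsub>H\<^esub> inv\<^bsub>H\<^esub> d" using w unfolding a_def b_def c_def d_def .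
            finally have "inv\<^bsub>H\<^esub> c \<otimes>\<^bsub>H\<^esub> a = inv\<^bsub>H\<^esub> d \<otimes>\<^bsub>H\<^esub> b" using car by (simp add: H.m_assoc)
            then have "F m (g \<otimes> x) = F m x"
              unfolding F_def a_def b_def c_def d_def using x gc tc by (simp add: G.m_assoc)
            then show False using nB x by simp
          qed
        qed
        have "(\<lambda>x. \<theta> (g \<otimes> (x \<otimes> t m))) \<in> M \<rightarrow>\<^sub>M N"
          by (rule measurable_compose[OF G.right_measurable measurable_left]) (use tc gc in auto)
        then have 1: "(\<lambda>x. \<theta> (g \<otimes> (x \<otimes> t m)) \<otimes>\<^bsub>H\<^esub> inv\<^bsub>H\<^esub> (\<theta> (x \<otimes> t m))) \<in> M \<rightarrow>\<^sub>M N"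
          by (intro H.mult_measurable H.inv_measurable measurable_right tc)
        have 2: "(\<lambda>x. \<theta> (g \<otimes> x) \<otimes>\<^bsub>H\<^esub> inv\<^bsub>H\<^esub> (\<theta> x)) \<in> M \<rightarrow>\<^sub>M N"
          by (intro H.mult_measurable H.inv_measurable measurable_left \<theta>_measurable gc)
        have "?W = space M - {x \<in> space M. \<theta> (g \<otimes> (x \<otimes> t m)) \<otimes>\<^bsub>H\<^esub> inv\<^bsub>H\<^esub> (\<theta> (x \<otimes> t m)) = \<theta> (g \<otimes> x) \<otimes>\<^bsub>H\<^esub> inv\<^bsub>H\<^esub> (\<theta> x)}"
          by (auto simp: G.space_M)
        then show "?W \<in> sets M" using H.eq_sets[OF 1 2] by simp
      qed
      also have "\<dots> < r" by (rule n[OF G.K_mono[OF m tK]])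
      finally show "norm (measure M {x \<in> A m. g \<otimes> x \<notin> A m} - 0) < r" by simp
    qed
  qed
  with A Be[folded A_def] show False by (rule G.gapD[OF gap e(1)])
qed

text \<open>Three agreements, for s at x, for t at \<open>x \<otimes> s\<close> and for
  \<open>s \<otimes> t\<close> at x, each fail on measure at most e. As 3e < 1, some x satisfies all
  of them; computing \<open>\<theta> (x \<otimes> s \<otimes> t)\<close> in two ways and cancelling
  \<open>\<theta> x\<close> gives exact multiplicativity.\<close>

lemma approximate_hom:
  assumes e: "0 < e" "(e::real) < 1/3"
  shows "\<exists>n \<delta>. local_hom n \<delta> \<and>
    (\<forall>t\<in>K n. measure M {x \<in> carrier G. \<theta> (x \<otimes> t) = \<theta> x \<otimes>\<^bsub>H\<^esub> \<delta> t} \<ge> 1 - e)"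
proof -
  obtain n where "\<forall>t\<in>K n. \<exists>y. y \<in> carrier H \<and> measure M {x \<in> carrier G. \<theta> (x \<otimes> t) = \<theta> x \<otimes>\<^bsub>H\<^esub> y} \<ge> 1 - e"
    using concentration[OF e] by blast
  then obtain \<delta> where *: "\<forall>t\<in>K n. \<delta> t \<in> carrier H \<and>
      measure M {x \<in> carrier G. \<theta> (x \<otimes> t) = \<theta> x \<otimes>\<^bsub>H\<^esub> \<delta> t} \<ge> 1 - e"
    by (rule exE[OF bchoice])
  then have \<delta>: "t \<in> K n \<Longrightarrow> \<delta> t \<in> carrier H"
    "t \<in> K n \<Longrightarrow> measure M {x \<in> carrier G. \<theta> (x \<otimes> t) = \<theta> x \<otimes>\<^bsub>H\<^esub> \<delta> t} \<ge> 1 - e" for t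
    by blast+
  define A where "A t = {x \<in> carrier G. \<theta> (x \<otimes> t) = \<theta> x \<otimes>\<^bsub>H\<^esub> \<delta> t}" for t
  have A: "A t \<in> sets M" if "t \<in> K n" for t
    unfolding A_def by (rule agree_sets[OF G.K_carrier[OF that] \<delta>(1)[OF that]])
  have As: "A t \<subseteq> carrier G" for t by (auto simp: A_def)
  have meet: "X \<inter> Y \<noteq> {}" if "X \<in> sets M" "Y \<in> sets M" "measure M X + measure M Y > 1" for X Y
  proof
    assume "X \<inter> Y = {}"
    then have "measure M (X \<union> Y) = measure M X + measure M Y"
      by (rule G.finite_measure_Union[OF that(1,2)])
    then show False using that(3) G.prob_le_1[of "X \<union> Y"] by simp
  qed
  have hom: "\<delta> (s \<otimes> t) = \<delta> s \<otimes>\<^bsub>H\<^esub> \<delta> t" if s: "s \<in> K n" and t: "t \<in> K n" for s t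
  proof -
    note st = G.K_mult[OF s t] and sc = G.K_carrier[OF s] and tc = G.K_carrier[OF t]
    let ?S = "{x \<in> carrier G. x \<otimes> s \<in> A t}"
    have S: "?S \<in> sets M" by (rule G.measurable_Collect_sets[OF G.right_measurable[OF sc] A[OF t]])
    have mS: "measure M ?S \<ge> 1 - e"
      using G.right_emeasure[OF sc A[OF t]] \<delta>(2)[OF t] by (simp add: measure_def A_def)
    have "measure M (A s \<inter> ?S) \<ge> 1 - 2 * e"
    proof -
      have "measure M (A s \<union> ?S) = measure M (A s) + measure M ?S - measure M (A s \<inter> ?S)"
        by (rule measure_Un3) (use A[OF s] S in \<open>simp_all add: G.fmeasurable_eq_sets\<close>)
      then show ?thesis using G.prob_le_1[of "A s \<union> ?S"] mS \<delta>(2)[OF s] by (simp add: A_def)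
    qed
    then have "(A s \<inter> ?S) \<inter> A (s \<otimes> t) \<noteq> {}"
      using A[OF s] A[OF st] S e \<delta>(2)[OF st] by (intro meet) (auto simp: A_def)
    then obtain x where x: "x \<in> A s" "x \<otimes> s \<in> A t" "x \<in> A (s \<otimes> t)" by blast
    then have xc: "x \<in> carrier G" by (simp add: A_def)
    have "\<theta> x \<otimes>\<^bsub>H\<^esub> \<delta> (s \<otimes> t) = \<theta> (x \<otimes> (s \<otimes> t))" using x by (simp add: A_def)
    also have "\<dots> = \<theta> ((x \<otimes> s) \<otimes> t)" using xc sc tc by (simp add: G.m_assoc)
    also have "\<dots> = \<theta> (x \<otimes> s) \<otimes>\<^bsub>H\<^esub> \<delta> t" using x by (simp add: A_def)
    also have "\<dots> = (\<theta> x \<otimes>\<^bsub>H\<^esub> \<delta> s) \<otimes>\<^bsub>H\<^esub> \<delta> t" using x by (simp add: A_def)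
    also have "\<dots> = \<theta> x \<otimes>\<^bsub>H\<^esub> (\<delta> s \<otimes>\<^bsub>H\<^esub> \<delta> t)"
      using \<theta>_carrier[OF xc] \<delta>(1) s t by (simp add: H.m_assoc)
    finally show ?thesis
      using \<theta>_carrier[OF xc] \<delta>(1) s t st by simp
  qed
  \<comment> \<open>The cell of level k containing \<open>\<theta> x\<close> takes countably many
    values, so for small t it is the same at x and \<open>x \<otimes> t\<close> on a set of measure
    above e. That set meets \<open>A t\<close>, and at a common point \<open>\<delta> t\<close> lies
    in \<open>K' k\<close>.\<close>
  have cont: "\<exists>m\<ge>n. \<forall>t\<in>K m. \<delta> t \<in> K' k" for k
  proof -
    have "\<exists>m. \<forall>t\<in>K m. measure M {x \<in> carrier G. H.cell k (\<theta> (x \<otimes> t)) \<noteq> H.cell k (\<theta> x)} < 1 - e"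
    proof (rule G.right_continuous_countable)
      show "countable (H.cell k ` L')" using H.countable_L by simp
      show "H.cell k (\<theta> x) \<in> H.cell k ` L'" if "x \<in> carrier G" for x
        using H.dense_cell[OF \<theta>_carrier[OF that], of k] H.cell_eq[OF _ \<theta>_carrier[OF that]] by blast
      fix c assume "c \<in> H.cell k ` L'"
      then obtain a where a: "a \<in> L'" "c = H.cell k a" by blast
      have ac: "a \<in> carrier H" by (rule H.L_carrier[OF a(1)])
      have "H.cell k (\<theta> x) = c \<longleftrightarrow> \<theta> x \<in> H.cell k a" if "x \<in> carrier G" for x
        using H.cell_eq[OF _ ac, of "\<theta> x" k] H.cell_refl[OF \<theta>_carrier[OF that], of k] a(2) by auto
      then have "{x \<in> carrier G. H.cell k (\<theta> x) = c} = \<theta> -` H.cell k a \<inter> space M"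
        by (auto simp: G.space_M)
      also have "\<dots> \<in> sets M" by (rule measurable_sets[OF \<theta>_measurable H.cell_sets[OF ac]])
      finally show "{x \<in> carrier G. H.cell k (\<theta> x) = c} \<in> sets M" .
    qed (use e in simp)
    then obtain m where m: "\<And>t. t \<in> K m \<Longrightarrow>
        measure M {x \<in> carrier G. H.cell k (\<theta> (x \<otimes> t)) \<noteq> H.cell k (\<theta> x)} < 1 - e" by blast
    have "\<delta> t \<in> K' k" if t: "t \<in> K (max m n)" for t
    proof (rule ccontr)
      assume nK: "\<delta> t \<notin> K' k"
      have tn: "t \<in> K n" and tm: "t \<in> K m" using G.K_mono[OF _ t] by auto
      have "A t \<subseteq> {x \<in> carrier G. H.cell k (\<theta> (x \<otimes> t)) \<noteq> H.cell k (\<theta> x)}"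
      proof
        fix x assume x: "x \<in> A t"
        then have xc: "x \<in> carrier G" by (simp add: A_def)
        have "H.cell k (\<theta> (x \<otimes> t)) \<noteq> H.cell k (\<theta> x)"
        proof
          assume "H.cell k (\<theta> (x \<otimes> t)) = H.cell k (\<theta> x)"
          moreover have "\<theta> (x \<otimes> t) = \<theta> x \<otimes>\<^bsub>H\<^esub> \<delta> t" using x by (simp add: A_def)
          ultimately have "\<theta> x \<otimes>\<^bsub>H\<^esub> \<delta> t \<in> H.cell k (\<theta> x)"
            using H.cell_refl[of "\<theta> x \<otimes>\<^bsub>H\<^esub> \<delta> t" k] \<theta>_carrier[OF xc] \<delta>(1)[OF tn] by auto
          then have "inv\<^bsub>H\<^esub> (\<theta> x) \<otimes>\<^bsub>H\<^esub> (\<theta> x \<otimes>\<^bsub>H\<^esub> \<delta> t) \<in> K' k" by (simp add: H.cell_def)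
          then show False using nK \<theta>_carrier[OF xc] \<delta>(1)[OF tn] by simp
        qed
        then show "x \<in> {x \<in> carrier G. H.cell k (\<theta> (x \<otimes> t)) \<noteq> H.cell k (\<theta> x)}" using xc by simp
      qed
      moreover have "{x \<in> carrier G. H.cell k (\<theta> (x \<otimes> t)) \<noteq> H.cell k (\<theta> x)} \<in> sets M"
      proof -
        have E: "\<theta> -` H.cell k a \<inter> space M \<in> sets M" "(\<lambda>x. \<theta> (x \<otimes> t)) -` H.cell k a \<inter> space M \<in> sets M"
          if "a \<in> L'" for a
          using measurable_sets[OF \<theta>_measurable H.cell_sets[OF H.L_carrier[OF that]]]
            measurable_sets[OF measurable_right[OF G.K_carrier[OF t]] H.cell_sets[OF H.L_carrier[OF that]]]
          by auto
        have "{x \<in> carrier G. H.cell k (\<theta> (x \<otimes> t)) \<noteq> H.cell k (\<theta> x)} =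
          (\<Union>a\<in>L'. (\<theta> -` H.cell k a \<inter> space M) - ((\<lambda>x. \<theta> (x \<otimes> t)) -` H.cell k a \<inter> space M))"
          (is "?P = ?Q")
        proof (rule equalityI; rule subsetI)
          fix x assume x: "x \<in> ?P"
          then have xc: "x \<in> carrier G" by simp
          obtain a where a: "a \<in> L'" "\<theta> x \<in> H.cell k a" using H.dense_cell'[OF \<theta>_carrier[OF xc]] by blast
          have "H.cell k (\<theta> x) = H.cell k a" by (rule H.cell_eq[OF a(2) H.L_carrier[OF a(1)]])
          moreover have "H.cell k (\<theta> (x \<otimes> t)) = H.cell k a" if "\<theta> (x \<otimes> t) \<in> H.cell k a"
            by (rule H.cell_eq[OF that H.L_carrier[OF a(1)]])
          ultimately show "x \<in> ?Q" using x a by (auto simp: G.space_M)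
        next
          fix x assume "x \<in> ?Q"
          then obtain a where a: "a \<in> L'" "x \<in> carrier G" "\<theta> x \<in> H.cell k a" "\<theta> (x \<otimes> t) \<notin> H.cell k a"
            by (auto simp: G.space_M)
          have "H.cell k (\<theta> x) = H.cell k a" by (rule H.cell_eq[OF a(3) H.L_carrier[OF a(1)]])
          moreover have "\<theta> (x \<otimes> t) \<in> H.cell k (\<theta> (x \<otimes> t))"
            by (rule H.cell_refl[OF \<theta>_carrier]) (use a G.K_carrier[OF t] in auto)
          ultimately show "x \<in> ?P" using a by auto
        qed
        also have "\<dots> \<in> sets M"
          by (rule sets.countable_UN''[OF H.countable_L]) (use E in auto)
        finally show ?thesis .
      qed
      ultimately have "measure M (A t) < 1 - e"
        by (rule le_less_trans[OF G.finite_measure_mono m[OF tm]])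
      then show False using \<delta>(2)[OF tn] by (simp add: A_def)
    qed
    then show ?thesis by (intro exI[of _ "max m n"]) auto
  qed
  have "local_hom n \<delta>" unfolding local_hom_def using \<delta>(1) hom cont by blast
  then show ?thesis using \<delta>(2) by blast
qed

lemma local_form:
  assumes A0: "A0 \<in> sets M" "emeasure M A0 > 0"
  shows "\<exists>n \<delta> A. local_hom n \<delta> \<and> A \<in> sets M \<and> A \<subseteq> A0 \<and> emeasure M A > 0 \<and>
    (\<forall>r\<in>K n. \<forall>y\<in>A. r \<otimes> y \<in> A \<longrightarrow> \<theta> (r \<otimes> y) = \<delta> r \<otimes>\<^bsub>H\<^esub> \<theta> y)"
proof -
  \<comment> \<open>The 1/4 satisfies the bound of \<open>approximate_hom\<close>. The other bound
    ensures that, for each t in \<open>K n\<close>, the x that agree and have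
    \<open>x \<otimes> t\<close> in A0 have measure at least m(A0) - e, hence at least e.\<close>
  define e where "e = min (1/4) (measure M A0 / 2)"
  have A0pos: "measure M A0 > 0" using A0(2) by (simp add: G.emeasure_eq_measure)
  then have e: "0 < e" "e < 1/3" "2 * e \<le> measure M A0" by (auto simp: e_def)
  obtain n \<delta> where \<delta>: "local_hom n \<delta>"
    and agree: "\<And>t. t \<in> K n \<Longrightarrow> measure M {x \<in> carrier G. \<theta> (x \<otimes> t) = \<theta> x \<otimes>\<^bsub>H\<^esub> \<delta> t} \<ge> 1 - e"
    using approximate_hom[OF e(1,2)] by blast
  define \<delta>' where "\<delta>' t = (if t \<in> K n then \<delta> t else \<one>\<^bsub>H\<^esub>)" for t
  have \<delta>': "\<delta>' \<in> M \<rightarrow>\<^sub>M N"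
    unfolding \<delta>'_def by (rule continuous_extension_measurable[OF G.openin_K local_hom_continuous[OF \<delta>]])
  \<comment> \<open>By Fubini some fibre \<open>{t. (p, t) \<in> S}\<close> has positive measure; fix such a \<open>p\<close> and conjugate \<open>\<delta>\<close>.\<close>
  define S where "S = {w \<in> space (M \<Otimes>\<^sub>M M). fst w \<otimes> snd w \<in> A0 \<and> snd w \<in> K n \<and>
      \<theta> (fst w \<otimes> snd w) = \<theta> (fst w) \<otimes>\<^bsub>H\<^esub> \<delta>' (snd w)}"
  have m1: "(\<lambda>w. fst w \<otimes> snd w) \<in> (M \<Otimes>\<^sub>M M) \<rightarrow>\<^sub>M M"
    by (rule G.mult_measurable[OF measurable_fst measurable_snd])
  have m2: "(\<lambda>w. \<theta> (fst w \<otimes> snd w)) \<in> (M \<Otimes>\<^sub>M M) \<rightarrow>\<^sub>M N"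
    by (rule measurable_compose[OF m1 \<theta>_measurable])
  have m3: "(\<lambda>w. \<theta> (fst w) \<otimes>\<^bsub>H\<^esub> \<delta>' (snd w)) \<in> (M \<Otimes>\<^sub>M M) \<rightarrow>\<^sub>M N"
    by (intro H.mult_measurable measurable_compose[OF measurable_fst \<theta>_measurable]
        measurable_compose[OF measurable_snd \<delta>'])
  have S: "S \<in> sets (M \<Otimes>\<^sub>M M)"
  proof -
    have "S = ((\<lambda>w. fst w \<otimes> snd w) -` A0 \<inter> space (M \<Otimes>\<^sub>M M)) \<inter> (snd -` K n \<inter> space (M \<Otimes>\<^sub>M M)) \<inter>
      {w \<in> space (M \<Otimes>\<^sub>M M). \<theta> (fst w \<otimes> snd w) = \<theta> (fst w) \<otimes>\<^bsub>H\<^esub> \<delta>' (snd w)}"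
      by (auto simp: S_def)
    also have "\<dots> \<in> sets (M \<Otimes>\<^sub>M M)"
      by (intro sets.Int measurable_sets[OF m1 A0(1)] measurable_sets[OF measurable_snd G.K_sets]
          H.eq_sets[OF m2 m3])
    finally show ?thesis .
  qed
  interpret P: pair_sigma_finite M M ..
  have slice: "ennreal e * indicator (K n) t \<le> emeasure M ((\<lambda>x. (x, t)) -` S)" for t
  proof (cases "t \<in> K n")
    case True
    note tc = G.K_carrier[OF True]
    let ?B = "{x \<in> carrier G. x \<otimes> t \<in> A0}" and ?C = "{x \<in> carrier G. \<theta> (x \<otimes> t) = \<theta> x \<otimes>\<^bsub>H\<^esub> \<delta> t}"
    have B: "?B \<in> sets M" by (rule G.measurable_Collect_sets[OF G.right_measurable[OF tc] A0(1)])
    have C: "?C \<in> sets M" by (rule agree_sets[OF tc local_hom_carrier[OF \<delta> True]])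
    have mB: "measure M ?B = measure M A0" using G.right_emeasure[OF tc A0(1)] by (simp add: measure_def)
    have "(\<lambda>x. (x, t)) -` S = ?B \<inter> ?C"
      using True tc by (auto simp: S_def space_pair_measure G.space_M \<delta>'_def)
    moreover have "measure M (?B \<union> ?C) = measure M ?B + measure M ?C - measure M (?B \<inter> ?C)"
      by (rule measure_Un3) (use B C in \<open>simp_all add: G.fmeasurable_eq_sets\<close>)
    then have "measure M (?B \<inter> ?C) \<ge> e"
      using G.prob_le_1[of "?B \<union> ?C"] agree[OF True] mB e by linarith
    ultimately show ?thesis using True by (simp add: G.emeasure_eq_measure ennreal_leI)
  qed simp
  have "0 < ennreal e * emeasure M (K n)"
    using e G.emeasure_K_pos by (simp add: ennreal_zero_less_mult_iff)
  also have "\<dots> = (\<integral>\<^sup>+t. ennreal e * indicator (K n) t \<partial>M)"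
    by (rule nn_integral_cmult_indicator[symmetric]) (rule G.K_sets)
  also have "\<dots> \<le> (\<integral>\<^sup>+t. emeasure M ((\<lambda>x. (x, t)) -` S) \<partial>M)" by (rule nn_integral_mono) (rule slice)
  also have "\<dots> = emeasure (M \<Otimes>\<^sub>M M) S" by (rule P.emeasure_pair_measure_alt2[OF S, symmetric])
  also have "\<dots> = (\<integral>\<^sup>+x. emeasure M (Pair x -` S) \<partial>M)" by (rule G.emeasure_pair_measure_alt[OF S])
  finally have "(\<integral>\<^sup>+x. emeasure M (Pair x -` S) \<partial>M) \<noteq> 0" by simp
  then have "\<exists>x\<in>space M. emeasure M (Pair x -` S) > 0"
    by (rule contrapos_np) (simp add: nn_integral_cong[where v = "\<lambda>_. 0"] not_gr_zero)
  then obtain p where p: "p \<in> carrier G" "emeasure M (Pair p -` S) > 0" by (auto simp: G.space_M)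
  define h where "h = \<theta> p"
  have hc: "h \<in> carrier H" unfolding h_def by (rule \<theta>_carrier[OF p(1)])
  \<comment> \<open>The good fibre over p, translated by p so that it becomes a subset of A0; at its
    points y the value of \<open>\<theta>\<close> is h times
    \<open>\<delta> (inv p \<otimes> y)\<close>.\<close>
  define A where "A = {y \<in> carrier G. inv p \<otimes> y \<in> Pair p -` S}"
  have pS: "Pair p -` S \<in> sets M" using S by (rule sets_Pair1)
  have A: "A \<in> sets M"
    unfolding A_def
    by (rule G.measurable_Collect_sets[OF G.left_measurable[OF G.inv_closed[OF p(1)]] pS])
  have Apos: "emeasure M A > 0"
    using G.left_emeasure[OF G.inv_closed[OF p(1)] pS] p(2) by (simp add: A_def)
  have A_in: "y \<in> carrier G \<and> y \<in> A0 \<and> inv p \<otimes> y \<in> K n \<and> \<theta> y = h \<otimes>\<^bsub>H\<^esub> \<delta> (inv p \<otimes> y)"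
    if "y \<in> A" for y
    using that p(1) by (auto simp: A_def S_def h_def \<delta>'_def)
  \<comment> \<open>Left multiplication of y by r multiplies \<open>inv p \<otimes> y\<close> on the
    left by \<open>inv p \<otimes> r \<otimes> p\<close>; conjugating by h then moves the resulting
    factor in front of h.\<close>
  define d where "d r = h \<otimes>\<^bsub>H\<^esub> \<delta> (inv p \<otimes> r \<otimes> p) \<otimes>\<^bsub>H\<^esub> inv\<^bsub>H\<^esub> h" for r
  have conj: "inv p \<otimes> r \<otimes> p \<in> K m" if "r \<in> K m" for r m by (rule G.K_conj'[OF that p(1)])
  have d: "local_hom n d"
    unfolding local_hom_def
  proof (intro conjI ballI allI)
    show "d t \<in> carrier H" if "t \<in> K n" for t
      using local_hom_carrier[OF \<delta> conj[OF that]] hc by (simp add: d_def)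
    fix s t assume s: "s \<in> K n" and t: "t \<in> K n"
    have "inv p \<otimes> (s \<otimes> t) \<otimes> p = (inv p \<otimes> s \<otimes> p) \<otimes> (inv p \<otimes> t \<otimes> p)"
      using p(1) G.K_carrier[OF s] G.K_carrier[OF t] by (simp add: G.m_assoc)
    then show "d (s \<otimes> t) = d s \<otimes>\<^bsub>H\<^esub> d t"
      using local_hom_mult[OF \<delta> conj[OF s] conj[OF t]] local_hom_carrier[OF \<delta> conj[OF s]]
        local_hom_carrier[OF \<delta> conj[OF t]] hc by (simp add: d_def H.m_assoc)
  next
    fix k
    obtain m where "m \<ge> n" "\<And>t. t \<in> K m \<Longrightarrow> \<delta> t \<in> K' k" using local_hom_cont[OF \<delta>] by blast
    then show "\<exists>m\<ge>n. \<forall>t\<in>K m. d t \<in> K' k"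
      using H.K_conj[OF _ hc] conj unfolding d_def by blast
  qed
  have "\<theta> (r \<otimes> y) = d r \<otimes>\<^bsub>H\<^esub> \<theta> y" if r: "r \<in> K n" and y: "y \<in> A" "r \<otimes> y \<in> A" for r y
  proof -
    have yc: "y \<in> carrier G" using A_in[OF y(1)] by simp
    have "inv p \<otimes> (r \<otimes> y) = (inv p \<otimes> r \<otimes> p) \<otimes> (inv p \<otimes> y)"
      using p(1) G.K_carrier[OF r] yc by (simp add: G.m_assoc)
    then have "\<theta> (r \<otimes> y) = h \<otimes>\<^bsub>H\<^esub> (\<delta> (inv p \<otimes> r \<otimes> p) \<otimes>\<^bsub>H\<^esub> \<delta> (inv p \<otimes> y))"
      using A_in[OF y(2)] A_in[OF y(1)] local_hom_mult[OF \<delta> conj[OF r]] by simp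
    then show ?thesis
      using A_in[OF y(1)] local_hom_carrier[OF \<delta>] conj[OF r] hc by (simp add: d_def H.m_assoc)
  qed
  then show ?thesis using d A Apos A_in by blast
qed

text \<open>For small r some y has both y and \<open>r \<otimes> y\<close> in A. Then r and
  \<open>\<delta> r\<close> are the quotients of these two points and of their images, and
  \<open>iff\<close> compares their membership in \<open>L\<close> and \<open>L'\<close>. In
  particular the kernel lies in the countable \<open>L\<close>, as
  \<open>local_hom_injective\<close> requires.\<close>

lemma local_isomorphism:
  assumes A0: "A0 \<in> sets M" "emeasure M A0 > 0"
    and iff: "\<And>x y. x \<in> A0 \<Longrightarrow> y \<in> A0 \<Longrightarrow> x \<otimes> inv y \<in> L \<longleftrightarrow> \<theta> x \<otimes>\<^bsub>H\<^esub> inv\<^bsub>H\<^esub> (\<theta> y) \<in> L'"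
  shows "\<exists>n \<delta> A. local_hom n \<delta> \<and> inj_on \<delta> (K n) \<and> (\<forall>r\<in>K n. r \<in> L \<longleftrightarrow> \<delta> r \<in> L') \<and>
    A \<in> sets M \<and> A \<subseteq> A0 \<and> emeasure M A > 0 \<and>
    (\<forall>r\<in>K n. \<forall>y\<in>A. r \<otimes> y \<in> A \<longrightarrow> \<theta> (r \<otimes> y) = \<delta> r \<otimes>\<^bsub>H\<^esub> \<theta> y)"
proof -
  obtain n \<delta> A where \<delta>: "local_hom n \<delta>" and A: "A \<in> sets M" "A \<subseteq> A0" "emeasure M A > 0"
    and eq: "\<And>r y. r \<in> K n \<Longrightarrow> y \<in> A \<Longrightarrow> r \<otimes> y \<in> A \<Longrightarrow> \<theta> (r \<otimes> y) = \<delta> r \<otimes>\<^bsub>H\<^esub> \<theta> y"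
    using local_form[OF A0] by blast
  have "measure M A > 0" using A(3) by (simp add: G.emeasure_eq_measure)
  then obtain m0 where m0: "\<And>t. t \<in> K m0 \<Longrightarrow> measure M {x \<in> A. t \<otimes> x \<notin> A} < measure M A"
    using G.left_continuous[OF A(1)] by blast
  define m where "m = max m0 n"
  have nm: "n \<le> m" "m0 \<le> m" by (auto simp: m_def)
  have L: "r \<in> L \<longleftrightarrow> \<delta> r \<in> L'" if r: "r \<in> K m" for r
  proof -
    have rn: "r \<in> K n" and rm0: "r \<in> K m0" using G.K_mono[OF _ r] nm by auto
    have "\<exists>y\<in>A. r \<otimes> y \<in> A"
    proof (rule ccontr)
      assume "\<not> ?thesis"
      then have "{x \<in> A. r \<otimes> x \<notin> A} = A" by blast
      then show False using m0[OF rm0] by simp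
    qed
    then obtain y where y: "y \<in> A" "r \<otimes> y \<in> A" by blast
    have yc: "y \<in> carrier G" using sets.sets_into_space[OF A(1)] y(1) by (auto simp: G.space_M)
    have "r = (r \<otimes> y) \<otimes> inv y" using yc G.K_carrier[OF r] by (simp add: G.m_assoc)
    moreover have "\<delta> r = \<theta> (r \<otimes> y) \<otimes>\<^bsub>H\<^esub> inv\<^bsub>H\<^esub> (\<theta> y)"
      using eq[OF rn y] local_hom_carrier[OF \<delta> rn] \<theta>_carrier[OF yc] by (simp add: H.m_assoc)
    ultimately show ?thesis using iff[of "r \<otimes> y" y] y A(2) by auto
  qed
  have "r \<in> L" if "r \<in> K m" "\<delta> r = \<one>\<^bsub>H\<^esub>" for r
    using L[OF that(1)] that(2) subgroup.one_closed[OF H.subgroup_L] by simp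
  then obtain l where l: "l \<ge> m" "inj_on \<delta> (K l)"
    using local_hom_injective[OF local_hom_mono[OF \<delta> nm(1)]] by blast
  have Kl: "r \<in> K m" if "r \<in> K l" for r using G.K_mono[OF l(1) that] .
  show ?thesis
  proof (intro exI conjI)
    show "local_hom l \<delta>" by (rule local_hom_mono[OF \<delta>]) (use l nm in simp)
    show "inj_on \<delta> (K l)" by (rule l(2))
    show "\<forall>r\<in>K l. r \<in> L \<longleftrightarrow> \<delta> r \<in> L'" using L Kl by blast
    show "\<forall>r\<in>K l. \<forall>y\<in>A. r \<otimes> y \<in> A \<longrightarrow> \<theta> (r \<otimes> y) = \<delta> r \<otimes>\<^bsub>H\<^esub> \<theta> y"
      using eq G.K_mono[OF nm(1) Kl] by blast
  qed (use A in auto)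
qed

end

section \<open>Orbit equivalence and Borel reducibility\<close>

text \<open>The weights \<open>a\<close> and \<open>b\<close> are the normalizing constants of restricted measures; keeping them on both
  sides avoids division in \<^typ>\<open>ennreal\<close>.\<close>

definition scaled_iso ::
    "ennreal \<Rightarrow> ennreal \<Rightarrow> 'x measure \<Rightarrow> 'x set \<Rightarrow> 'y measure \<Rightarrow> 'y set \<Rightarrow> ('x \<Rightarrow> 'y) \<Rightarrow> bool" where
  "scaled_iso a b M X N Y f \<longleftrightarrow> bij_betw f X Y \<and>
     (\<forall>F\<in>sets N. F \<subseteq> Y \<longrightarrow> f -` F \<inter> X \<in> sets M) \<and>
     (\<forall>E\<in>sets M. E \<subseteq> X \<longrightarrow> f ` E \<in> sets N \<and> b * emeasure N (f ` E) = a * emeasure M E)"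

lemma the_inv_into_vimage:
  assumes bij: "bij_betw f X Y" and E: "E \<subseteq> X"
  shows "the_inv_into X f -` E \<inter> Y = f ` E"
proof (rule equalityI; rule subsetI)
  fix y assume y: "y \<in> the_inv_into X f -` E \<inter> Y"
  then have "f (the_inv_into X f y) = y" using f_the_inv_into_f_bij_betw[OF bij] by blast
  then show "y \<in> f ` E" using y by force
next
  fix y assume "y \<in> f ` E"
  then obtain x where x: "x \<in> E" "y = f x" by blast
  then have "the_inv_into X f y = x"
    using the_inv_into_f_f[OF bij_betw_imp_inj_on[OF bij]] E by blast
  then show "y \<in> the_inv_into X f -` E \<inter> Y" using x E bij_betwE[OF bij] by auto
qed

text \<open>Measurability of the inverse becomes measurability of images, and the pushforward
  identity, tested on images, becomes the weighted equality of measures.\<close>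

lemma measure_space_iso_iff_scaled_iso:
  assumes X: "X \<in> sets M" and Y: "Y \<in> sets N"
    and sM: "sets M' = sets (restrict_space M X)" and sN: "sets N' = sets (restrict_space N Y)"
    and eM: "\<And>E. E \<in> sets M \<Longrightarrow> E \<subseteq> X \<Longrightarrow> emeasure M' E = a * emeasure M E"
    and eN: "\<And>F. F \<in> sets N \<Longrightarrow> F \<subseteq> Y \<Longrightarrow> emeasure N' F = b * emeasure N F"
  shows "measure_space_iso M' N' f \<longleftrightarrow> scaled_iso a b M X N Y f"
proof -
  have Xs: "X \<inter> space M = X" and Ys: "Y \<inter> space N = Y"
    using sets.sets_into_space[OF X] sets.sets_into_space[OF Y] by auto
  have spM: "space M' = X" and spN: "space N' = Y"
    using sets_eq_imp_space_eq[OF sM] sets_eq_imp_space_eq[OF sN] Xs Ys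
    by (auto simp: space_restrict_space)
  have iM: "E \<in> sets M' \<longleftrightarrow> E \<in> sets M \<and> E \<subseteq> X" for E
    unfolding sM using sets_restrict_space_iff[of X M E] X Xs by auto
  have iN: "F \<in> sets N' \<longleftrightarrow> F \<in> sets N \<and> F \<subseteq> Y" for F
    unfolding sN using sets_restrict_space_iff[of Y N F] Y Ys by auto
  show ?thesis
  proof
    assume "measure_space_iso M' N' f"
    then have f: "f \<in> M' \<rightarrow>\<^sub>M N'" and bij: "bij_betw f X Y"
      and g: "the_inv_into X f \<in> N' \<rightarrow>\<^sub>M M'" and d: "distr M' N' f = N'"
      by (simp_all add: measure_space_iso_def spM spN)
    show "scaled_iso a b M X N Y f"
      unfolding scaled_iso_def
    proof (intro conjI ballI impI)
      show "f -` F \<inter> X \<in> sets M" if "F \<in> sets N" "F \<subseteq> Y" for F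
        using measurable_sets[OF f, of F] that iN iM by (simp add: spM)
      fix E assume E: "E \<in> sets M" "E \<subseteq> X"
      have "the_inv_into X f -` E \<inter> Y = f ` E"
        by (rule the_inv_into_vimage[OF bij E(2)])
      then have fE: "f ` E \<in> sets N'" using measurable_sets[OF g, of E] E iM by (simp add: spN)
      then show "f ` E \<in> sets N" using iN by blast
      have "f -` (f ` E) \<inter> X = E" using bij_betw_imp_inj_on[OF bij] E by (auto simp: inj_on_def)
      then have "emeasure N' (f ` E) = emeasure M' E"
        using emeasure_distr[OF f fE] d by (simp add: spM)
      then show "b * emeasure N (f ` E) = a * emeasure M E"
        using eM[OF E] eN[of "f ` E"] fE iN by simp
    qed (rule bij)
  next
    assume "scaled_iso a b M X N Y f"
    then have bij: "bij_betw f X Y"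
      and vim: "\<And>F. F \<in> sets N \<Longrightarrow> F \<subseteq> Y \<Longrightarrow> f -` F \<inter> X \<in> sets M"
      and img: "\<And>E. E \<in> sets M \<Longrightarrow> E \<subseteq> X \<Longrightarrow> f ` E \<in> sets N"
        "\<And>E. E \<in> sets M \<Longrightarrow> E \<subseteq> X \<Longrightarrow> b * emeasure N (f ` E) = a * emeasure M E"
      by (auto simp: scaled_iso_def)
    have f: "f \<in> M' \<rightarrow>\<^sub>M N'"
      by (rule measurableI) (use vim iM iN bij_betwE[OF bij] in \<open>auto simp: spM spN\<close>)
    have g: "the_inv_into X f \<in> N' \<rightarrow>\<^sub>M M'"
    proof (rule measurableI)
      show "the_inv_into X f y \<in> space M'" if "y \<in> space N'" for y
        using bij_betwE[OF bij_betw_the_inv_into[OF bij]] that by (simp add: spM spN)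
      fix E assume "E \<in> sets M'"
      then have E: "E \<in> sets M" "E \<subseteq> X" using iM by auto
      have "the_inv_into X f -` E \<inter> Y = f ` E"
        by (rule the_inv_into_vimage[OF bij E(2)])
      then show "the_inv_into X f -` E \<inter> space N' \<in> sets N'"
        using img(1)[OF E] E bij_betwE[OF bij] by (auto simp: spN iN)
    qed
    have "distr M' N' f = N'"
    proof (rule measure_eqI)
      fix F assume "F \<in> sets (distr M' N' f)"
      then have F: "F \<in> sets N" "F \<subseteq> Y" and F': "F \<in> sets N'" using iN by auto
      have E: "f -` F \<inter> X \<in> sets M" "f -` F \<inter> X \<subseteq> X" using vim[OF F] by auto
      have "f ` (f -` F \<inter> X) = F" using F(2) bij_betw_imp_surj_on[OF bij] by auto
      then show "emeasure (distr M' N' f) F = emeasure N' F"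
        using emeasure_distr[OF f F'] eM[OF E] eN[OF F] img(2)[OF E] by (simp add: spM)
    qed simp
    then show "measure_space_iso M' N' f"
      using f g bij by (simp add: measure_space_iso_def spM spN)
  qed
qed

lemma map_prod_image_eq_iff:
  assumes "bij_betw f X Y"
  shows "map_prod f f ` (R \<inter> X \<times> X) = S \<inter> Y \<times> Y \<longleftrightarrow>
    (\<forall>x\<in>X. \<forall>y\<in>X. (x, y) \<in> R \<longleftrightarrow> (f x, f y) \<in> S)"
proof
  assume eq: "map_prod f f ` (R \<inter> X \<times> X) = S \<inter> Y \<times> Y"
  show "\<forall>x\<in>X. \<forall>y\<in>X. (x, y) \<in> R \<longleftrightarrow> (f x, f y) \<in> S"
  proof (intro ballI iffI)
    fix x y assume x: "x \<in> X" and y: "y \<in> X"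
    { assume "(x, y) \<in> R"
      then have "map_prod f f (x, y) \<in> map_prod f f ` (R \<inter> X \<times> X)" using x y by blast
      then show "(f x, f y) \<in> S" unfolding eq by simp }
    { assume "(f x, f y) \<in> S"
      then have "(f x, f y) \<in> map_prod f f ` (R \<inter> X \<times> X)"
        unfolding eq using x y bij_betwE[OF assms] by blast
      then obtain x' y' where "(x', y') \<in> R" "x' \<in> X" "y' \<in> X" "f x = f x'" "f y = f y'" by auto
      then show "(x, y) \<in> R"
        using x y bij_betw_imp_inj_on[OF assms] by (metis inj_on_eq_iff) }
  qed
next
  assume iff: "\<forall>x\<in>X. \<forall>y\<in>X. (x, y) \<in> R \<longleftrightarrow> (f x, f y) \<in> S"
  show "map_prod f f ` (R \<inter> X \<times> X) = S \<inter> Y \<times> Y"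
  proof (rule equalityI; rule subsetI)
    fix p assume "p \<in> map_prod f f ` (R \<inter> X \<times> X)"
    then show "p \<in> S \<inter> Y \<times> Y" using iff bij_betwE[OF assms] by auto
  next
    fix p assume p: "p \<in> S \<inter> Y \<times> Y"
    then obtain u v where uv: "p = (u, v)" "u \<in> f ` X" "v \<in> f ` X"
      using bij_betw_imp_surj_on[OF assms] by blast
    then obtain x y where "x \<in> X" "y \<in> X" "p = (f x, f y)" by blast
    moreover from this p iff have "(x, y) \<in> R" by blast
    ultimately show "p \<in> map_prod f f ` (R \<inter> X \<times> X)" by force
  qed
qed

lemma orbit_equivalent_iff_scaled_iso:
  "orbit_equivalent M R N S \<longleftrightarrow>
    (\<exists>X\<in>sets M. \<exists>Y\<in>sets N. \<exists>f. (AE x in M. x \<in> X) \<and> (AE y in N. y \<in> Y) \<and>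
      scaled_iso 1 1 M X N Y f \<and> (\<forall>x\<in>X. \<forall>y\<in>X. (x, y) \<in> R \<longleftrightarrow> (f x, f y) \<in> S))"
proof -
  have "measure_space_iso (restrict_space M X) (restrict_space N Y) f \<and>
      map_prod f f ` (R \<inter> X \<times> X) = S \<inter> Y \<times> Y \<longleftrightarrow>
      scaled_iso 1 1 M X N Y f \<and> (\<forall>x\<in>X. \<forall>y\<in>X. (x, y) \<in> R \<longleftrightarrow> (f x, f y) \<in> S)"
    if X: "X \<in> sets M" and Y: "Y \<in> sets N" for X Y f
  proof -
    have "emeasure (restrict_space M X) E = 1 * emeasure M E" if "E \<subseteq> X" for E
      using emeasure_restrict_space[of X M E] X that by (simp add: sets.Int_space_eq2)
    moreover have "emeasure (restrict_space N Y) F = 1 * emeasure N F" if "F \<subseteq> Y" for F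
      using emeasure_restrict_space[of Y N F] Y that by (simp add: sets.Int_space_eq2)
    ultimately have "measure_space_iso (restrict_space M X) (restrict_space N Y) f
        \<longleftrightarrow> scaled_iso 1 1 M X N Y f"
      by (intro measure_space_iso_iff_scaled_iso[OF X Y refl refl]) auto
    moreover have "bij_betw f X Y" if "scaled_iso 1 1 M X N Y f"
      using that by (simp add: scaled_iso_def)
    ultimately show ?thesis using map_prod_image_eq_iff[of f X Y R S] by blast
  qed
  note * = this
  show ?thesis unfolding orbit_equivalent_def
    by (intro bex_cong ex_cong1 refl conj_cong[OF refl] *)
qed

lemma normalized_restriction_sets:
  assumes A: "A \<in> sets M"
  shows "E \<in> sets (normalized_restriction M A) \<longleftrightarrow> E \<in> sets M \<and> E \<subseteq> A"
    and "space (normalized_restriction M A) = A"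
    and "E \<subseteq> A \<Longrightarrow> emeasure (normalized_restriction M A) E = 1 / emeasure M A * emeasure M E"
proof -
  have As: "A \<inter> space M \<in> sets M" "A \<inter> space M = A" using A sets.sets_into_space[OF A] by auto
  show "E \<in> sets (normalized_restriction M A) \<longleftrightarrow> E \<in> sets M \<and> E \<subseteq> A"
    unfolding normalized_restriction_def using sets_restrict_space_iff[OF As(1)] by auto
  show "space (normalized_restriction M A) = A"
    unfolding normalized_restriction_def space_scale_measure space_restrict_space by (rule As(2))
  show "emeasure (normalized_restriction M A) E = 1 / emeasure M A * emeasure M E" if "E \<subseteq> A"
    unfolding normalized_restriction_def using emeasure_restrict_space[OF As(1) that] by simp
qed

text \<open>Moves the normalization into the weights, so that the rest of the argument speaks only
  of the two Haar measures.\<close>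

lemma scaled_iso_normalized_restriction:
  assumes A: "A \<in> sets M" "X \<subseteq> A" and B: "B \<in> sets N" "Y \<subseteq> B"
  shows "scaled_iso 1 1 (normalized_restriction M A) X (normalized_restriction N B) Y f \<longleftrightarrow>
    scaled_iso (1 / emeasure M A) (1 / emeasure N B) M X N Y f"
proof -
  have 1: "f -` F \<inter> X \<subseteq> A" for F using A by blast
  have 2: "f ` E \<subseteq> B" if "bij_betw f X Y" "E \<subseteq> X" for E
    using B bij_betw_imp_surj_on[OF that(1)] that(2) by blast
  have 3: "E \<subseteq> A" if "E \<subseteq> X" for E using A that by blast
  have 4: "F \<subseteq> B" if "F \<subseteq> Y" for F using B that by blast
  have e1: "emeasure (normalized_restriction M A) E = 1 / emeasure M A * emeasure M E" if "E \<subseteq> X" for E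
    using normalized_restriction_sets(3)[OF A(1) 3[OF that]] .
  have e2: "emeasure (normalized_restriction N B) (f ` E) = 1 / emeasure N B * emeasure N (f ` E)"
    if "bij_betw f X Y" "E \<subseteq> X" for E
    using normalized_restriction_sets(3)[OF B(1) 2[OF that]] .
  show ?thesis
    unfolding scaled_iso_def Ball_def
    using 1 2 3 4 e1 e2
    by (auto simp: normalized_restriction_sets(1)[OF A(1)] normalized_restriction_sets(1)[OF B(1)])
qed

section \<open>Isomorphisms between subgroups: orbits, measures, and passage to and from orbit
  maps\<close>

context haar_group_pair begin

text \<open>On each of the countably many cosets the map is f between two fixed left translations.
  The representative moves x into S, so the default value of the extension \<open>f'\<close> does
  not occur.\<close>

lemma transport_measurable:
  assumes S: "subgroup S G" "openin T S" and f: "continuous_map (subtopology T S) T' f"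
    and b: "\<And>c. c \<in> rcosets S \<Longrightarrow> b c \<in> carrier H"
  shows "(\<lambda>x. b (G.coset_of S x) \<otimes>\<^bsub>H\<^esub> f (G.rep (G.coset_of S x) \<otimes> x)) \<in> M \<rightarrow>\<^sub>M N"
proof -
  define f' where "f' x = (if x \<in> S then f x else \<one>\<^bsub>H\<^esub>)" for x
  have f': "f' \<in> M \<rightarrow>\<^sub>M N" unfolding f'_def by (rule continuous_extension_measurable[OF S(2) f])
  have "(\<lambda>x. b (G.coset_of S x) \<otimes>\<^bsub>H\<^esub> f' (G.rep (G.coset_of S x) \<otimes> x)) \<in> M \<rightarrow>\<^sub>M N"
  proof (rule measurable_compose_countable'[OF _ G.coset_of_measurable[OF S] G.countable_rcosets[OF S]])
    fix c assume c: "c \<in> rcosets S"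
    show "(\<lambda>x. b c \<otimes>\<^bsub>H\<^esub> f' (G.rep c \<otimes> x)) \<in> M \<rightarrow>\<^sub>M N"
      by (intro H.mult_measurable measurable_const
          measurable_compose[OF G.left_measurable[OF G.rep(3)[OF S c]] f'])
        (simp add: H.space_M b[OF c])
  qed
  then show ?thesis
    by (rule measurable_cong[THEN iffD1, rotated])
      (use G.rep_coset_of[OF S] in \<open>simp add: f'_def G.space_M\<close>)
qed

lemma iso_memD:
  assumes \<delta>: "\<delta> \<in> isos G0 H0"
    and G0: "G0 \<subseteq> carrier G" and H0: "H0 \<subseteq> carrier H"
  shows "bij_betw \<delta> G0 H0" "x \<in> G0 \<Longrightarrow> y \<in> G0 \<Longrightarrow> \<delta> (x \<otimes> y) = \<delta> x \<otimes>\<^bsub>H\<^esub> \<delta> y"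
    "continuous_map (subtopology T G0) T' \<delta>"
    "continuous_map (subtopology T' H0) T (the_inv_into G0 \<delta>)"
proof -
  have top: "topspace (subtopology T G0) = G0" "topspace (subtopology T' H0) = H0"
    using G0 H0 by (auto simp: G.topspace_T H.topspace_T)
  have iso: "\<delta> \<in> iso (G\<lparr>carrier := G0\<rparr>) (H\<lparr>carrier := H0\<rparr>)"
    and hm: "homeomorphic_map (subtopology T G0) (subtopology T' H0) \<delta>"
    using \<delta> by (auto simp: topological_group_iso_def)
  show bij: "bij_betw \<delta> G0 H0" using iso by (simp add: iso_def)
  show "x \<in> G0 \<Longrightarrow> y \<in> G0 \<Longrightarrow> \<delta> (x \<otimes> y) = \<delta> x \<otimes>\<^bsub>H\<^esub> \<delta> y"
    using iso by (simp add: iso_def hom_def)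
  have "continuous_map (subtopology T G0) (subtopology T' H0) \<delta>"
    using hm by (rule homeomorphic_imp_continuous_map)
  then show "continuous_map (subtopology T G0) T' \<delta>"
    by (simp add: continuous_map_in_subtopology)
  obtain g where g: "homeomorphic_maps (subtopology T G0) (subtopology T' H0) \<delta> g"
    using hm by (auto simp: homeomorphic_map_maps)
  have "the_inv_into G0 \<delta> y = g y" if "y \<in> H0" for y
  proof -
    have "\<delta> (g y) = y" "g y \<in> G0"
      using g that continuous_map_image_subset_topspace[of "subtopology T' H0" "subtopology T G0" g]
      unfolding homeomorphic_maps_def top by auto
    then show ?thesis using the_inv_into_f_f[of \<delta> G0 "g y"] bij by (simp add: bij_betw_def)
  qed
  moreover have "continuous_map (subtopology T' H0) T g"
    using g by (simp add: homeomorphic_maps_def continuous_map_in_subtopology)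
  ultimately show "continuous_map (subtopology T' H0) T (the_inv_into G0 \<delta>)"
    by (metis continuous_map_eq top(2))
qed

lemma flip: "haar_group_pair H N K' T' L' G M K T L" ..

text \<open>In other words, \<open>\<delta>\<close> carries the normalized Haar measure of
  \<open>G0\<close> to that of \<open>H0\<close>; the cross-multiplied form avoids quotients of
  extended reals.\<close>

lemma open_iso_measure:
  assumes G0: "subgroup G0 G" "openin T G0" and H0: "subgroup H0 H" "openin T' H0"
    and \<delta>: "\<delta> \<in> isos G0 H0"
    and E: "E \<in> sets M" "E \<subseteq> G0"
  shows "\<delta> ` E \<in> sets N" and "emeasure N (\<delta> ` E) * emeasure M G0 = emeasure M E * emeasure N H0"
proof -
  interpret flip: haar_group_pair H N K' T' L' G M K T L by (rule flip)
  note Gs = subgroup.subset[OF G0(1)] and Hs = subgroup.subset[OF H0(1)]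
  note iso = iso_memD[OF \<delta> Gs Hs]
  define \<gamma> where "\<gamma> z = (if z \<in> H0 then the_inv_into G0 \<delta> z else \<one>)" for z
  have \<gamma>: "\<gamma> \<in> N \<rightarrow>\<^sub>M M"
    unfolding \<gamma>_def by (rule flip.continuous_extension_measurable[OF H0(2) iso(4)])
  have \<gamma>_in: "\<gamma> z \<in> G0" and \<delta>\<gamma>: "\<delta> (\<gamma> z) = z" if "z \<in> H0" for z
    using that bij_betwE[OF bij_betw_the_inv_into[OF iso(1)]] f_the_inv_into_f_bij_betw[OF iso(1)]
    by (auto simp: \<gamma>_def)
  have inj: "x = y" if "x \<in> G0" "y \<in> G0" "\<delta> x = \<delta> y" for x y
    using bij_betw_imp_inj_on[OF iso(1)] that by (simp add: inj_on_def)
  have \<delta>_in: "\<delta> x \<in> H0" if "x \<in> G0" for x using bij_betwE[OF iso(1)] that by blast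
  have \<gamma>\<delta>: "\<gamma> (\<delta> x) = x" if "x \<in> G0" for x
    using inj[OF \<gamma>_in[OF \<delta>_in] that] \<delta>\<gamma>[OF \<delta>_in] that by blast
  have mem_image: "z \<in> \<delta> ` E \<longleftrightarrow> z \<in> H0 \<and> \<gamma> z \<in> E" for z
    using \<delta>\<gamma> \<gamma>\<delta> \<delta>_in E(2) by (metis image_iff subsetD)
  have "\<delta> ` E = (\<gamma> -` E \<inter> space N) \<inter> H0"
    using mem_image Hs by (auto simp: H.space_M)
  then show Eset: "\<delta> ` E \<in> sets N" using measurable_sets[OF \<gamma> E(1)] H.open_sets[OF H0(2)] by simp
  \<comment> \<open>Uniqueness of Haar measure: compute the measure of \<open>S\<close> by slicing in both directions.\<close>
  define S where "S = {w \<in> space (M \<Otimes>\<^sub>M N). fst w \<in> G0 \<and> snd w \<in> H0 \<and> fst w \<otimes> \<gamma> (snd w) \<in> E}"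
  have m: "(\<lambda>w. fst w \<otimes> \<gamma> (snd w)) \<in> (M \<Otimes>\<^sub>M N) \<rightarrow>\<^sub>M M"
    by (intro G.mult_measurable measurable_fst measurable_compose[OF measurable_snd \<gamma>])
  have S: "S \<in> sets (M \<Otimes>\<^sub>M N)"
  proof -
    have "S = (fst -` G0 \<inter> space (M \<Otimes>\<^sub>M N)) \<inter> (snd -` H0 \<inter> space (M \<Otimes>\<^sub>M N)) \<inter>
        ((\<lambda>w. fst w \<otimes> \<gamma> (snd w)) -` E \<inter> space (M \<Otimes>\<^sub>M N))" by (auto simp: S_def)
    also have "\<dots> \<in> sets (M \<Otimes>\<^sub>M N)"
      by (intro sets.Int measurable_sets[OF m E(1)] measurable_sets[OF measurable_fst]
          measurable_sets[OF measurable_snd] G.open_sets[OF G0(2)] H.open_sets[OF H0(2)])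
    finally show ?thesis .
  qed
  interpret P: pair_sigma_finite M N ..
  \<comment> \<open>For fixed z in \<open>H0\<close> the slice is a right translate of E, so right
    invariance of M applies.\<close>
  have right: "emeasure M ((\<lambda>x. (x, z)) -` S) = emeasure M E * indicator H0 z" for z
  proof (cases "z \<in> H0")
    case True
    note gc = subsetD[OF Gs \<gamma>_in[OF True]]
    have "x \<in> G0" if "x \<in> carrier G" "x \<otimes> \<gamma> z \<in> E" for x
    proof -
      have "(x \<otimes> \<gamma> z) \<otimes> inv (\<gamma> z) \<in> G0"
        using that E(2) \<gamma>_in[OF True] G0(1) by (blast intro: subgroup.m_closed subgroup.m_inv_closed)
      then show ?thesis using that gc by (simp add: G.m_assoc)
    qed
    then have "(\<lambda>x. (x, z)) -` S = {x \<in> carrier G. x \<otimes> \<gamma> z \<in> E}"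
      using True Gs Hs by (auto simp: S_def space_pair_measure G.space_M H.space_M)
    then show ?thesis using True G.right_emeasure[OF gc E(1)] by simp
  qed (simp add: S_def)
  \<comment> \<open>For fixed x in \<open>G0\<close>, multiplicativity of \<open>\<delta>\<close>
    identifies the slice with a left translate of the image of E.\<close>
  have left: "emeasure N (Pair x -` S) = emeasure N (\<delta> ` E) * indicator G0 x" for x
  proof (cases "x \<in> G0")
    case True
    note dc = subsetD[OF Hs \<delta>_in[OF True]]
    have "(z \<in> H0 \<and> x \<otimes> \<gamma> z \<in> E) \<longleftrightarrow> \<delta> x \<otimes>\<^bsub>H\<^esub> z \<in> \<delta> ` E" if z: "z \<in> carrier H" for z
    proof
      assume a: "z \<in> H0 \<and> x \<otimes> \<gamma> z \<in> E"
      then have "\<delta> (x \<otimes> \<gamma> z) = \<delta> x \<otimes>\<^bsub>H\<^esub> z" using iso(2)[OF True \<gamma>_in] \<delta>\<gamma> by simp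
      then show "\<delta> x \<otimes>\<^bsub>H\<^esub> z \<in> \<delta> ` E" using a by (metis imageI)
    next
      assume a: "\<delta> x \<otimes>\<^bsub>H\<^esub> z \<in> \<delta> ` E"
      then have "\<delta> x \<otimes>\<^bsub>H\<^esub> z \<in> H0" using mem_image by blast
      then have "inv\<^bsub>H\<^esub> (\<delta> x) \<otimes>\<^bsub>H\<^esub> (\<delta> x \<otimes>\<^bsub>H\<^esub> z) \<in> H0"
        using \<delta>_in[OF True] H0(1) by (blast intro: subgroup.m_closed subgroup.m_inv_closed)
      then have zH: "z \<in> H0" using dc z by simp
      have "\<delta> (x \<otimes> \<gamma> z) = \<delta> x \<otimes>\<^bsub>H\<^esub> z" using iso(2)[OF True \<gamma>_in[OF zH]] \<delta>\<gamma>[OF zH] by simp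
      moreover have "x \<otimes> \<gamma> z \<in> G0" using True \<gamma>_in[OF zH] G0(1) by (blast intro: subgroup.m_closed)
      ultimately have "\<gamma> (\<delta> x \<otimes>\<^bsub>H\<^esub> z) = x \<otimes> \<gamma> z" using \<gamma>\<delta> by metis
      then show "z \<in> H0 \<and> x \<otimes> \<gamma> z \<in> E" using zH a mem_image by auto
    qed
    then have "Pair x -` S = {z \<in> carrier H. \<delta> x \<otimes>\<^bsub>H\<^esub> z \<in> \<delta> ` E}"
      using True Gs Hs by (auto simp: S_def space_pair_measure G.space_M H.space_M)
    then show ?thesis using True H.left_emeasure[OF dc Eset] by simp
  qed (simp add: S_def)
  have "emeasure N (\<delta> ` E) * emeasure M G0 = (\<integral>\<^sup>+x. emeasure N (Pair x -` S) \<partial>M)"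
    unfolding left by (rule nn_integral_cmult_indicator[symmetric]) (rule G.open_sets[OF G0(2)])
  also have "\<dots> = emeasure (M \<Otimes>\<^sub>M N) S" by (rule H.emeasure_pair_measure_alt[OF S, symmetric])
  also have "\<dots> = (\<integral>\<^sup>+z. emeasure M ((\<lambda>x. (x, z)) -` S) \<partial>N)" by (rule P.emeasure_pair_measure_alt2[OF S])
  also have "\<dots> = emeasure M E * emeasure N H0"
    unfolding right by (rule nn_integral_cmult_indicator) (rule H.open_sets[OF H0(2)])
  finally show "emeasure N (\<delta> ` E) * emeasure M G0 = emeasure M E * emeasure N H0" .
qed

lemma iso_same_orbit:
  assumes G0: "subgroup G0 G" and H0: "subgroup H0 H"
    and \<delta>: "\<delta> \<in> isos G0 H0"
    and L: "\<delta> ` (L \<inter> G0) = L' \<inter> H0"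
    and x: "x \<in> G0" and y: "y \<in> G0"
  shows "(\<delta> x, \<delta> y) \<in> H.same_orbit \<longleftrightarrow> (x, y) \<in> G.same_orbit"
proof -
  note Gs = subgroup.subset[OF G0(1)] and Hs = subgroup.subset[OF H0(1)]
  note iso = iso_memD[OF \<delta> Gs Hs]
  have \<delta>_in: "\<delta> x \<in> H0" if "x \<in> G0" for x using bij_betwE[OF iso(1)] that by blast
  define z where "z = x \<otimes> inv y"
  have z: "z \<in> G0" unfolding z_def using x y G0 by (blast intro: subgroup.m_closed subgroup.m_inv_closed)
  have xc: "x \<in> carrier G" "y \<in> carrier G" and dc: "\<delta> x \<in> carrier H" "\<delta> y \<in> carrier H" "\<delta> z \<in> carrier H"
    using x y z Gs Hs \<delta>_in by auto
  have "x = z \<otimes> y" using xc by (simp add: z_def G.m_assoc)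
  then have "\<delta> x = \<delta> z \<otimes>\<^bsub>H\<^esub> \<delta> y" using iso(2)[OF z y] by simp
  then have "\<delta> x \<otimes>\<^bsub>H\<^esub> inv\<^bsub>H\<^esub> (\<delta> y) = \<delta> z" using dc by (simp add: H.m_assoc)
  moreover have "z \<in> L \<longleftrightarrow> \<delta> z \<in> L'"
  proof
    assume "z \<in> L" then show "\<delta> z \<in> L'" using L z by blast
  next
    assume "\<delta> z \<in> L'"
    then have "\<delta> z \<in> \<delta> ` (L \<inter> G0)" unfolding L using \<delta>_in[OF z] by blast
    then show "z \<in> L" using bij_betw_imp_inj_on[OF iso(1)] z by (auto simp: inj_on_def)
  qed
  ultimately show ?thesis using xc dc by (simp add: G.same_orbit_def H.same_orbit_def z_def)
qed

text \<open>Representatives lie in \<open>L\<close>, so moving a point into \<open>G0\<close> first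
  does not change its orbit; inside \<open>G0\<close> the map \<open>\<delta>\<close> itself
  compares orbits.\<close>

lemma borel_reduction_of_iso:
  assumes G0: "subgroup G0 G" "openin T G0" and H0: "subgroup H0 H"
    and \<delta>: "\<delta> \<in> isos G0 H0"
    and L: "\<delta> ` (L \<inter> G0) = L' \<inter> H0"
  shows "\<exists>f\<in>M \<rightarrow>\<^sub>M N. \<forall>x\<in>carrier G. \<forall>y\<in>carrier G.
    (x, y) \<in> G.same_orbit \<longleftrightarrow> (f x, f y) \<in> H.same_orbit"
proof -
  note Gs = subgroup.subset[OF G0(1)] and Hs = subgroup.subset[OF H0(1)]
  note iso = iso_memD[OF \<delta> Gs Hs]
  have \<delta>_in: "\<delta> x \<in> carrier H" if "x \<in> G0" for x using bij_betwE[OF iso(1)] that Hs by blast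
  define r where "r x = G.rep (G.coset_of G0 x) \<otimes> x" for x
  have r: "r x \<in> G0" if "x \<in> carrier G" for x unfolding r_def by (rule G.rep_coset_of[OF G0 that])
  have "(\<lambda>x. \<one>\<^bsub>H\<^esub> \<otimes>\<^bsub>H\<^esub> \<delta> (r x)) \<in> M \<rightarrow>\<^sub>M N"
    unfolding r_def by (rule transport_measurable[OF G0 iso(3)]) simp
  then have meas: "(\<lambda>x. \<delta> (r x)) \<in> M \<rightarrow>\<^sub>M N"
    by (rule measurable_cong[THEN iffD1, rotated]) (use \<delta>_in r in \<open>simp add: G.space_M\<close>)
  have orb: "(x, y) \<in> G.same_orbit \<longleftrightarrow> (\<delta> (r x), \<delta> (r y)) \<in> H.same_orbit"
    if x: "x \<in> carrier G" and y: "y \<in> carrier G" for x y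
    unfolding iso_same_orbit[OF G0(1) H0 \<delta> L r[OF x] r[OF y]] unfolding r_def
    by (rule G.same_orbit_translate[symmetric])
      (use x y G.rep(1)[OF G0 G.coset_of_rcosets[OF G0(1)]] in auto)
  show ?thesis by (intro bexI[OF _ meas] ballI orb)
qed

text \<open>On a piece of X the map f is \<open>\<delta>\<close> up to translations, so
  \<open>\<delta>\<close> inherits the scaling of f there, and uniqueness of Haar measure spreads it
  to \<open>K n\<close>. The resulting last identity, with both weights 1, is the source of the
  index condition for orbit equivalence.\<close>

lemma local_iso_of_scaled_iso:
  assumes gap: "G.gap" and X: "X \<in> sets M" "emeasure M X > 0" and Y: "Y \<in> sets N"
    and f: "scaled_iso a b M X N Y f" and a: "a \<noteq> 0"
    and orb: "\<And>x y. x \<in> X \<Longrightarrow> y \<in> X \<Longrightarrow> (x, y) \<in> G.same_orbit \<longleftrightarrow> (f x, f y) \<in> H.same_orbit"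
  shows "\<exists>n \<delta>. \<delta> \<in> isos (K n) (\<delta> ` K n) \<and>
    subgroup (\<delta> ` K n) H \<and> openin T' (\<delta> ` K n) \<and> \<delta> ` (L \<inter> K n) = L' \<inter> \<delta> ` K n \<and>
    b * emeasure N (\<delta> ` K n) = a * emeasure M (K n)"
proof -
  have Xc: "X \<subseteq> carrier G" and Yc: "Y \<subseteq> carrier H"
    using sets.sets_into_space[OF X(1)] sets.sets_into_space[OF Y] by (auto simp: G.space_M H.space_M)
  have bij: "bij_betw f X Y"
    and vim: "\<And>F. F \<in> sets N \<Longrightarrow> F \<subseteq> Y \<Longrightarrow> f -` F \<inter> X \<in> sets M"
    and img: "\<And>E. E \<in> sets M \<Longrightarrow> E \<subseteq> X \<Longrightarrow> f ` E \<in> sets N"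
      "\<And>E. E \<in> sets M \<Longrightarrow> E \<subseteq> X \<Longrightarrow> b * emeasure N (f ` E) = a * emeasure M E"
    using f by (auto simp: scaled_iso_def)
  have fY: "f x \<in> Y" if "x \<in> X" for x using bij_betwE[OF bij] that by blast
  define f' where "f' x = (if x \<in> X then f x else \<one>\<^bsub>H\<^esub>)" for x
  have f': "f' \<in> M \<rightarrow>\<^sub>M N"
  proof (rule H.measurableI)
    show "f' x \<in> carrier H" if "x \<in> space M" for x using fY Yc by (auto simp: f'_def)
    fix k c assume c: "c \<in> L'"
    have "f -` (H.cell k c \<inter> Y) \<inter> X \<in> sets M"
      by (rule vim) (use H.cell_sets[OF H.L_carrier[OF c]] Y in auto)
    moreover have "{x \<in> space M. f' x \<in> H.cell k c} = (f -` (H.cell k c \<inter> Y) \<inter> X) \<union>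
      (if \<one>\<^bsub>H\<^esub> \<in> H.cell k c then space M - X else {})"
      using Xc fY by (auto simp: f'_def G.space_M)
    ultimately show "{x \<in> space M. f' x \<in> H.cell k c} \<in> sets M" using X(1) by simp
  qed
  have Lne: "L \<noteq> {}" using subgroup.one_closed[OF G.subgroup_L] by auto
  define l where "l = from_nat_into L"
  have l: "l i \<in> L" for i unfolding l_def by (rule from_nat_into[OF Lne])
  have rl: "range l = L" unfolding l_def by (rule range_from_nat_into[OF Lne G.countable_L])
  \<comment> \<open>Extend \<open>f\<close> from \<open>X\<close> to \<open>L \<otimes> X\<close> along orbits; off this invariant set a constant map will do.\<close>
  define k where "k x = (LEAST i. l i \<otimes> x \<in> X)" for x
  \<comment> \<open>Points of X stay fixed, so that \<open>\<theta>\<close> extends f. If no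
    translate of x lies in X, the value of \<open>LEAST\<close> is arbitrary, but \<open>r x\<close>
    is still a translate of x, hence outside X, where \<open>f'\<close> is constant.\<close>
  define r where "r x = (if x \<in> X then x else l (k x) \<otimes> x)" for x
  have lm: "(\<lambda>x. l i \<otimes> x) \<in> M \<rightarrow>\<^sub>M M" for i by (rule G.left_measurable[OF G.L_carrier[OF l]])
  have k: "k \<in> M \<rightarrow>\<^sub>M count_space UNIV"
    unfolding k_def
  proof (rule measurable_Least)
    show "(\<lambda>x. l i \<otimes> x \<in> X) \<in> M \<rightarrow>\<^sub>M count_space UNIV" for i
      using measurable_sets[OF lm X(1), of i]
      by (simp add: pred_def vimage_def Int_def conj_commute)
  qed
  have r: "r \<in> M \<rightarrow>\<^sub>M M"
    unfolding r_def
  proof (rule measurable_If)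
    show "(\<lambda>x. l (k x) \<otimes> x) \<in> M \<rightarrow>\<^sub>M M" by (rule measurable_compose_countable[OF lm k])
    show "{x \<in> space M. x \<in> X} \<in> sets M"
      using X(1) Xc by (simp add: G.space_M Collect_conj_eq Int_absorb1)
  qed simp
  have r_translate: "\<exists>c\<in>L. r x = c \<otimes> x" if x: "x \<in> carrier G" for x
    using l x subgroup.one_closed[OF G.subgroup_L] by (cases "x \<in> X") (auto simp: r_def intro: bexI[of _ "\<one>"])
  have r_in: "r x \<in> X" if cL: "c \<in> L" and cX: "c \<otimes> x \<in> X" for c x
  proof (cases "x \<in> X")
    case False
    obtain i where "c = l i" using cL rl by blast
    then have "l (k x) \<otimes> x \<in> X" unfolding k_def using cX by (intro LeastI[of "\<lambda>i. l i \<otimes> x \<in> X" i]) simp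
    then show ?thesis using False by (simp add: r_def)
  qed (simp add: r_def)
  define \<theta> where "\<theta> x = f' (r x)" for x
  have \<theta>_X: "\<theta> x = f x" if "x \<in> X" for x using that by (simp add: \<theta>_def f'_def r_def)
  interpret orbit_map G M K T L H N K' T' L' \<theta>
  proof
    show "\<theta> \<in> M \<rightarrow>\<^sub>M N" unfolding \<theta>_def by (rule measurable_compose[OF r f'])
    show "G.gap" by (rule gap)
    fix g x assume g: "g \<in> L" and x: "x \<in> carrier G"
    note gc = G.L_carrier[OF g]
    obtain c where c: "c \<in> L" "r x = c \<otimes> x" using r_translate[OF x] by blast
    obtain d where d: "d \<in> L" "r (g \<otimes> x) = d \<otimes> (g \<otimes> x)" using r_translate[of "g \<otimes> x"] x gc by auto
    have dg: "d \<otimes> g \<in> L" using d(1) g G.subgroup_L by (simp add: subgroup.m_closed)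
    have rgx: "r (g \<otimes> x) = (d \<otimes> g) \<otimes> x"
      using d x gc G.L_carrier[OF d(1)] by (simp add: G.m_assoc)
    \<comment> \<open>Whether \<open>r x\<close> lies in X depends only on the orbit of x. If it
      does, f compares the two points; if not, both values of \<open>\<theta>\<close> are the
      identity.\<close>
    show "\<theta> (g \<otimes> x) \<otimes>\<^bsub>H\<^esub> inv\<^bsub>H\<^esub> (\<theta> x) \<in> L'"
    proof (cases "r x \<in> X")
      case True
      have cg: "c \<otimes> inv g \<in> L"
        using c(1) g G.subgroup_L by (simp add: subgroup.m_closed subgroup.m_inv_closed)
      have "(c \<otimes> inv g) \<otimes> (g \<otimes> x) = c \<otimes> x"
        using x gc G.L_carrier[OF c(1)] by (simp add: G.m_assoc)
      then have rX: "r (g \<otimes> x) \<in> X" using r_in[OF cg, of "g \<otimes> x"] True c(2) by simp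
      have "(x, x) \<in> G.same_orbit"
        using x subgroup.one_closed[OF G.subgroup_L] by (simp add: G.same_orbit_def)
      then have "(r (g \<otimes> x), r x) \<in> G.same_orbit"
        unfolding rgx c(2) using G.same_orbit_translate[OF dg c(1) x x] by simp
      then have "(f (r (g \<otimes> x)), f (r x)) \<in> H.same_orbit" using orb[OF rX True] by simp
      then show ?thesis using True rX by (simp add: \<theta>_def f'_def H.same_orbit_def)
    next
      case False
      have "r (g \<otimes> x) \<notin> X" using r_in[OF dg, of x] False unfolding rgx by blast
      then show ?thesis using False subgroup.one_closed[OF H.subgroup_L] by (simp add: \<theta>_def f'_def)
    qed
  qed
  have iff: "x \<otimes> inv y \<in> L \<longleftrightarrow> \<theta> x \<otimes>\<^bsub>H\<^esub> inv\<^bsub>H\<^esub> (\<theta> y) \<in> L'" if "x \<in> X" "y \<in> X" for x y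
  proof -
    have "x \<in> carrier G" "y \<in> carrier G" "f x \<in> carrier H" "f y \<in> carrier H"
      using that Xc Yc fY by auto
    then show ?thesis
      using orb[OF that] \<theta>_X that by (simp add: G.same_orbit_def H.same_orbit_def)
  qed
  obtain n \<delta> A where \<delta>: "local_hom n \<delta>" and inj: "inj_on \<delta> (K n)"
    and L: "\<And>r. r \<in> K n \<Longrightarrow> r \<in> L \<longleftrightarrow> \<delta> r \<in> L'"
    and A: "A \<in> sets M" "A \<subseteq> X" "emeasure M A > 0"
    and eq: "\<And>r y. r \<in> K n \<Longrightarrow> y \<in> A \<Longrightarrow> r \<otimes> y \<in> A \<Longrightarrow> \<theta> (r \<otimes> y) = \<delta> r \<otimes>\<^bsub>H\<^esub> \<theta> y"
    using local_isomorphism[OF X iff] by blast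
  note iso = local_hom_iso[OF \<delta> inj L]
  \<comment> \<open>The formula for \<open>\<theta>\<close> on A only concerns quotients in
    \<open>K n\<close>, so A is cut down to a single cell of level n; countably many of these cover
    it.\<close>
  have "\<exists>c\<in>L. emeasure M (A \<inter> G.cell n c) > 0"
  proof (rule ccontr)
    assume no: "\<not> ?thesis"
    have "(\<Union>c\<in>L. A \<inter> G.cell n c) \<in> null_sets M"
    proof (rule null_sets_UN'[OF G.countable_L])
      fix c assume c: "c \<in> L"
      have "emeasure M (A \<inter> G.cell n c) = 0" using no c by (auto simp: not_gr_zero)
      then show "A \<inter> G.cell n c \<in> null_sets M"
        using A(1) G.cell_sets[OF G.L_carrier[OF c]] by auto
    qed
    moreover have "(\<Union>c\<in>L. A \<inter> G.cell n c) = A"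
      using G.dense_cell'[OF subsetD[OF Xc subsetD[OF A(2)]], of _ n] by auto
    ultimately show False using A(3) by auto
  qed
  then obtain c where c: "c \<in> L" "emeasure M (A \<inter> G.cell n c) > 0" by blast
  define C where "C = A \<inter> G.cell n c"
  have C: "C \<in> sets M" "C \<subseteq> X" unfolding C_def using A G.cell_sets[OF G.L_carrier[OF c(1)]] by auto
  have "C \<noteq> {}" using c(2) by (auto simp: C_def)
  then obtain y where y: "y \<in> C" by blast
  have yc: "y \<in> carrier G" and yX: "y \<in> X" using y C(2) Xc by auto
  have fyc: "f y \<in> carrier H" using fY[OF yX] Yc by blast
  \<comment> \<open>E is C divided on the right by y: it lies in \<open>K n\<close> and has the
    measure of C, and its image under \<open>\<delta>\<close> is the f-image of C divided by f
    y.\<close>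
  define E where "E = {x \<in> carrier G. x \<otimes> y \<in> C}"
  have E: "E \<in> sets M"
    unfolding E_def by (rule G.measurable_Collect_sets[OF G.right_measurable[OF yc] C(1)])
  have mE: "emeasure M E = emeasure M C" unfolding E_def by (rule G.right_emeasure[OF yc C(1)])
  have cell_y: "G.cell n y = G.cell n c"
    by (rule G.cell_eq[OF _ G.L_carrier[OF c(1)]]) (use y in \<open>simp add: C_def\<close>)
  have EK: "E \<subseteq> K n"
  proof
    fix x assume x: "x \<in> E"
    then have xc: "x \<in> carrier G" and "x \<otimes> y \<in> G.cell n y" unfolding cell_y by (auto simp: E_def C_def)
    then have "(x \<otimes> y) \<otimes> inv y \<in> G.cell n (y \<otimes> inv y)"
      using yc by (intro G.cell_mult G.cell_refl) auto
    then show "x \<in> K n" using xc yc by (simp add: G.m_assoc G.cell_one)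
  qed
  have fE: "f (x \<otimes> y) = \<delta> x \<otimes>\<^bsub>H\<^esub> f y" if "x \<in> E" for x
    using eq[of x y] that EK y \<theta>_X C(2) by (auto simp: E_def C_def subset_iff)
  have \<delta>E: "\<delta> ` E = {z \<in> carrier H. z \<otimes>\<^bsub>H\<^esub> f y \<in> f ` C}"
  proof (rule equalityI; rule subsetI)
    fix z assume "z \<in> \<delta> ` E"
    then obtain x where x: "x \<in> E" "z = \<delta> x" by blast
    have "f (x \<otimes> y) \<in> f ` C" using x(1) by (simp add: E_def)
    then have "z \<otimes>\<^bsub>H\<^esub> f y \<in> f ` C" unfolding fE[OF x(1)] x(2) .
    then show "z \<in> {z \<in> carrier H. z \<otimes>\<^bsub>H\<^esub> f y \<in> f ` C}"
      using x EK local_hom_carrier[OF \<delta>] by auto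
  next
    fix z assume "z \<in> {z \<in> carrier H. z \<otimes>\<^bsub>H\<^esub> f y \<in> f ` C}"
    then obtain v where v: "v \<in> C" "z \<otimes>\<^bsub>H\<^esub> f y = f v" and zc: "z \<in> carrier H" by auto
    have vc: "v \<in> carrier G" using v C(2) Xc by blast
    have vE: "v \<otimes> inv y \<in> E" using v(1) vc yc by (simp add: E_def G.m_assoc)
    have "f v = \<delta> (v \<otimes> inv y) \<otimes>\<^bsub>H\<^esub> f y" using fE[OF vE] vc yc by (simp add: G.m_assoc)
    then have "z = \<delta> (v \<otimes> inv y)"
      using v(2) zc fyc local_hom_carrier[OF \<delta> subsetD[OF EK vE]] by simp
    then show "z \<in> \<delta> ` E" using vE by blast
  qed
  have m\<delta>E: "b * emeasure N (\<delta> ` E) = a * emeasure M E"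
    unfolding \<delta>E H.right_emeasure[OF fyc img(1)[OF C]] mE by (rule img(2)[OF C])
  have mEpos: "emeasure M E > 0" using c(2) by (simp add: mE C_def)
  have Hset: "\<delta> ` K n \<in> sets N" by (rule H.closed_sets[OF iso(3)])
  \<comment> \<open>As a is nonzero, the image of E, and so that of \<open>K n\<close>, has positive
    measure; a closed subgroup of positive measure is open.\<close>
  have "emeasure N (\<delta> ` E) \<noteq> 0" using m\<delta>E a mEpos by auto
  moreover have "emeasure N (\<delta> ` E) \<le> emeasure N (\<delta> ` K n)"
    by (rule emeasure_mono) (use EK Hset in auto)
  ultimately have "emeasure N (\<delta> ` K n) > 0" by (metis le_zero_eq not_gr_zero)
  then have op: "openin T' (\<delta> ` K n)" using H.subgroup_openI[OF iso(2) Hset] by simp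
  have sc: "emeasure N (\<delta> ` E) * emeasure M (K n) = emeasure M E * emeasure N (\<delta> ` K n)"
    by (rule open_iso_measure(2)[OF G.K_subgroup G.openin_K iso(2) op iso(1) E EK])
  \<comment> \<open>The scaling by a and b is known on E; \<open>sc\<close> transfers it to
    \<open>K n\<close> after cancelling the positive finite measure of E.\<close>
  have "emeasure M E * (b * emeasure N (\<delta> ` K n)) = b * (emeasure N (\<delta> ` E) * emeasure M (K n))"
    unfolding sc by (simp add: mult_ac)
  also have "\<dots> = emeasure M E * (a * emeasure M (K n))"
    using m\<delta>E by (simp add: mult.assoc[symmetric]) (simp add: mult_ac)
  finally have "b * emeasure N (\<delta> ` K n) = a * emeasure M (K n)"
    using mEpos G.emeasure_finite[of E] by (auto simp: ennreal_mult_cancel_left)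
  then show ?thesis using iso op by blast
qed

text \<open>A reduction is defined everywhere, so it is an orbit map as it stands and the starting
  set is the whole group. It need not respect measure, which is why the image is only shown to be
  closed.\<close>

lemma local_iso_of_borel_reduction:
  assumes gap: "G.gap" and f: "f \<in> M \<rightarrow>\<^sub>M N"
    and orb: "\<And>x y. x \<in> carrier G \<Longrightarrow> y \<in> carrier G \<Longrightarrow> (x, y) \<in> G.same_orbit \<longleftrightarrow> (f x, f y) \<in> H.same_orbit"
  shows "\<exists>n \<delta>. \<delta> \<in> isos (K n) (\<delta> ` K n) \<and>
    subgroup (\<delta> ` K n) H \<and> closedin T' (\<delta> ` K n) \<and> \<delta> ` (L \<inter> K n) = L' \<inter> \<delta> ` K n"
proof -
  have fc: "f x \<in> carrier H" if "x \<in> carrier G" for x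
    using H.measurable_carrier[OF f] that by (simp add: G.space_M)
  have iff: "x \<otimes> inv y \<in> L \<longleftrightarrow> f x \<otimes>\<^bsub>H\<^esub> inv\<^bsub>H\<^esub> (f y) \<in> L'" if "x \<in> carrier G" "y \<in> carrier G" for x y
    using orb[OF that] fc that by (simp add: G.same_orbit_def H.same_orbit_def)
  interpret orbit_map G M K T L H N K' T' L' f
  proof
    fix g x assume g: "g \<in> L" and x: "x \<in> carrier G"
    note gc = G.L_carrier[OF g]
    have "(g \<otimes> x) \<otimes> inv x \<in> L" using g gc x by (simp add: G.m_assoc)
    then show "f (g \<otimes> x) \<otimes>\<^bsub>H\<^esub> inv\<^bsub>H\<^esub> (f x) \<in> L'" using iff[of "g \<otimes> x" x] gc x by simp
  qed (use f gap in auto)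
  have 1: "carrier G \<in> sets M" "emeasure M (carrier G) > 0"
    using sets.top[of M] G.emeasure_space_1 by (auto simp: G.space_M)
  obtain n \<delta> where \<delta>: "local_hom n \<delta>" "inj_on \<delta> (K n)" and L: "\<And>r. r \<in> K n \<Longrightarrow> r \<in> L \<longleftrightarrow> \<delta> r \<in> L'"
    using local_isomorphism[OF 1 iff] by blast
  show ?thesis
    by (rule exI[of _ n], rule exI[of _ \<delta>]) (intro conjI local_hom_iso[OF \<delta> L])
qed

lemma scaled_iso_of_iso:
  assumes G0: "subgroup G0 G" "openin T G0" and H0: "subgroup H0 H" "openin T' H0"
    and \<delta>: "\<delta> \<in> isos G0 H0"
  shows "scaled_iso (1 / emeasure M G0) (1 / emeasure N H0) M G0 N H0 \<delta>"
proof -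
  note Gs = subgroup.subset[OF G0(1)] and Hs = subgroup.subset[OF H0(1)]
  note iso = iso_memD[OF \<delta> Gs Hs]
  have pos: "emeasure M G0 \<noteq> 0" "emeasure N H0 \<noteq> 0"
    using G.open_subgroup_positive[OF G0] H.open_subgroup_positive[OF H0]
    by (auto simp: G.emeasure_eq_measure H.emeasure_eq_measure)
  show ?thesis
    unfolding scaled_iso_def
  proof (intro conjI ballI impI)
    show "bij_betw \<delta> G0 H0" by (rule iso(1))
    fix F assume F: "F \<in> sets N" "F \<subseteq> H0"
    have "\<delta> -` F \<inter> G0 = ((\<lambda>x. if x \<in> G0 then \<delta> x else \<one>\<^bsub>H\<^esub>) -` F \<inter> space M) \<inter> G0"
      using Gs by (auto simp: G.space_M)
    also have "\<dots> \<in> sets M"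
      using measurable_sets[OF continuous_extension_measurable[OF G0(2) iso(3)] F(1)] G.open_sets[OF G0(2)]
      by blast
    finally show "\<delta> -` F \<inter> G0 \<in> sets M" .
  next
    fix E assume E: "E \<in> sets M" "E \<subseteq> G0"
    show "\<delta> ` E \<in> sets N" by (rule open_iso_measure(1)[OF G0 H0 \<delta> E])
    have "emeasure N (\<delta> ` E) * emeasure M G0 = emeasure M E * emeasure N H0"
      by (rule open_iso_measure(2)[OF G0 H0 \<delta> E])
    then have "measure N (\<delta> ` E) * measure M G0 = measure M E * measure N H0"
      by (simp add: G.emeasure_eq_measure H.emeasure_eq_measure ennreal_mult[symmetric])
    then have "measure N (\<delta> ` E) / measure N H0 = measure M E / measure M G0"
      using pos by (simp add: G.emeasure_eq_measure H.emeasure_eq_measure field_simps)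
    then show "1 / emeasure N H0 * emeasure N (\<delta> ` E) = 1 / emeasure M G0 * emeasure M E"
      using G.open_subgroup_positive[OF G0] H.open_subgroup_positive[OF H0]
      by (simp add: G.emeasure_eq_measure H.emeasure_eq_measure divide_ennreal ennreal_mult[symmetric]
          ennreal_1[symmetric] del: ennreal_1)
  qed
qed

text \<open>Move x into \<open>G0\<close> by the representative of its coset, apply
  \<open>\<delta>\<close>, and move on to the coset chosen by \<open>\<beta>\<close> with an inverse
  representative. The representatives come from \<open>L\<close> and \<open>L'\<close>, so orbits
  are respected.\<close>

definition transport :: "('g set \<Rightarrow> 'h set) \<Rightarrow> ('g \<Rightarrow> 'h) \<Rightarrow> 'g set \<Rightarrow> 'g \<Rightarrow> 'h" where
  "transport \<beta> \<delta> G0 x =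
     inv\<^bsub>H\<^esub> (H.rep (\<beta> (G.coset_of G0 x))) \<otimes>\<^bsub>H\<^esub> \<delta> (G.rep (G.coset_of G0 x) \<otimes> x)"

lemma transport_props:
  assumes G0: "subgroup G0 G" "openin T G0" and H0: "subgroup H0 H" "openin T' H0"
    and \<delta>: "\<delta> \<in> isos G0 H0"
    and \<beta>: "bij_betw \<beta> (rcosets G0) (rcosets\<^bsub>H\<^esub> H0)"
  shows "transport \<beta> \<delta> G0 \<in> M \<rightarrow>\<^sub>M N"
    and "x \<in> carrier G \<Longrightarrow> transport \<beta> \<delta> G0 x \<in> carrier H"
    and "x \<in> carrier G \<Longrightarrow> H.coset_of H0 (transport \<beta> \<delta> G0 x) = \<beta> (G.coset_of G0 x)"
    and "x \<in> carrier G \<Longrightarrow> H.rep (\<beta> (G.coset_of G0 x)) \<otimes>\<^bsub>H\<^esub> transport \<beta> \<delta> G0 x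
      = \<delta> (G.rep (G.coset_of G0 x) \<otimes> x)"
proof -
  note Gs = subgroup.subset[OF G0(1)] and Hs = subgroup.subset[OF H0(1)]
  note iso = iso_memD[OF \<delta> Gs Hs]
  have \<beta>c: "\<beta> c \<in> rcosets\<^bsub>H\<^esub> H0" if "c \<in> rcosets G0" for c using bij_betwE[OF \<beta>] that by blast
  show "transport \<beta> \<delta> G0 \<in> M \<rightarrow>\<^sub>M N"
    unfolding transport_def by (rule transport_measurable[OF G0 iso(3)]) (use H.rep(3)[OF H0 \<beta>c] in simp)
  assume x: "x \<in> carrier G"
  note cx = G.coset_of_rcosets[OF G0(1) x]
  note r = H.rep(3)[OF H0 \<beta>c[OF cx]]
  have dH: "\<delta> (G.rep (G.coset_of G0 x) \<otimes> x) \<in> H0"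
    using bij_betwE[OF iso(1)] G.rep_coset_of[OF G0 x] by blast
  then have d: "\<delta> (G.rep (G.coset_of G0 x) \<otimes> x) \<in> carrier H" using Hs by blast
  show 1: "transport \<beta> \<delta> G0 x \<in> carrier H" using r d by (simp add: transport_def)
  show 2: "H.rep (\<beta> (G.coset_of G0 x)) \<otimes>\<^bsub>H\<^esub> transport \<beta> \<delta> G0 x = \<delta> (G.rep (G.coset_of G0 x) \<otimes> x)"
    using r d by (simp add: transport_def)
  show "H.coset_of H0 (transport \<beta> \<delta> G0 x) = \<beta> (G.coset_of G0 x)"
    using H.coset_of_eq[OF H0(1) \<beta>c[OF cx] H.rep(2)[OF H0 \<beta>c[OF cx]] 1] 2 dH by simp
qed

text \<open>The coset of x is recovered from that of its image by inverting \<open>\<beta>\<close>;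
  then the same representatives are used on the way back and everything cancels.\<close>

lemma transport_inverse:
  assumes G0: "subgroup G0 G" "openin T G0" and H0: "subgroup H0 H" "openin T' H0"
    and \<delta>: "\<delta> \<in> isos G0 H0"
    and \<beta>: "bij_betw \<beta> (rcosets G0) (rcosets\<^bsub>H\<^esub> H0)"
    and x: "x \<in> carrier G"
  shows "haar_group_pair.transport H L' G L (the_inv_into (rcosets G0) \<beta>) (the_inv_into G0 \<delta>) H0
    (transport \<beta> \<delta> G0 x) = x"
proof -
  interpret flip: haar_group_pair H N K' T' L' G M K T L by (rule flip)
  note Gs = subgroup.subset[OF G0(1)] and Hs = subgroup.subset[OF H0(1)]
  note iso = iso_memD[OF \<delta> Gs Hs]
  note t = transport_props[OF G0 H0 \<delta> \<beta>]
  note cx = G.coset_of_rcosets[OF G0(1) x]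
  have "the_inv_into (rcosets G0) \<beta> (H.coset_of H0 (transport \<beta> \<delta> G0 x)) = G.coset_of G0 x"
    unfolding t(3)[OF x] by (rule the_inv_into_f_f[OF bij_betw_imp_inj_on[OF \<beta>] cx])
  moreover have "the_inv_into G0 \<delta> (H.rep (H.coset_of H0 (transport \<beta> \<delta> G0 x)) \<otimes>\<^bsub>H\<^esub> transport \<beta> \<delta> G0 x)
      = G.rep (G.coset_of G0 x) \<otimes> x"
    unfolding t(3)[OF x] t(4)[OF x]
    by (rule the_inv_into_f_f[OF bij_betw_imp_inj_on[OF iso(1)] G.rep_coset_of[OF G0 x]])
  ultimately show ?thesis
    using G.rep(3)[OF G0 cx] x by (simp add: flip.transport_def)
qed

lemma topological_group_iso_inverse:
  assumes G0: "subgroup G0 G" and H0: "subgroup H0 H"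
    and \<delta>: "\<delta> \<in> isos G0 H0"
  shows "the_inv_into G0 \<delta> \<in> haar_group_pair.isos H T' G T H0 G0"
proof -
  note Gs = subgroup.subset[OF G0] and Hs = subgroup.subset[OF H0]
  note iso = iso_memD[OF \<delta> Gs Hs]
  have top: "topspace (subtopology T G0) = G0" "topspace (subtopology T' H0) = H0"
    using Gs Hs by (auto simp: G.topspace_T H.topspace_T)
  let ?g = "the_inv_into G0 \<delta>"
  have bij: "bij_betw ?g H0 G0" by (rule bij_betw_the_inv_into[OF iso(1)])
  have g_in: "?g y \<in> G0" if "y \<in> H0" for y using bij_betwE[OF bij] that by blast
  have gf: "?g (\<delta> x) = x" if "x \<in> G0" for x
    by (rule the_inv_into_f_f[OF bij_betw_imp_inj_on[OF iso(1)] that])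
  have fg: "\<delta> (?g y) = y" if "y \<in> H0" for y
    by (rule f_the_inv_into_f_bij_betw[OF iso(1)]) (use that in simp)
  have "?g (x \<otimes>\<^bsub>H\<^esub> y) = ?g x \<otimes> ?g y" if x: "x \<in> H0" and y: "y \<in> H0" for x y
  proof -
    have "\<delta> (?g x \<otimes> ?g y) = x \<otimes>\<^bsub>H\<^esub> y" using iso(2)[OF g_in[OF x] g_in[OF y]] fg x y by simp
    then show ?thesis using gf[OF subgroup.m_closed[OF G0 g_in[OF x] g_in[OF y]]] by simp
  qed
  then have "?g \<in> Group.iso (H\<lparr>carrier := H0\<rparr>) (G\<lparr>carrier := G0\<rparr>)"
    using bij g_in by (simp add: iso_def hom_def)
  moreover have "homeomorphic_maps (subtopology T' H0) (subtopology T G0) ?g \<delta>"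
    unfolding homeomorphic_maps_def top
  proof (intro conjI ballI)
    show "continuous_map (subtopology T' H0) (subtopology T G0) ?g"
      using iso(4) g_in by (simp add: continuous_map_in_subtopology top image_subset_iff Pi_iff)
    show "continuous_map (subtopology T G0) (subtopology T' H0) \<delta>"
      using iso(3) bij_betwE[OF iso(1)] by (simp add: continuous_map_in_subtopology top image_subset_iff Pi_iff)
  qed (use gf fg in auto)
  ultimately show ?thesis
    by (auto simp: topological_group_iso_def homeomorphic_map_maps)
qed

text \<open>Equal indices give a bijection \<open>\<beta>\<close> of the finite coset spaces and, by
  \<open>index_measure\<close>, equal measures of \<open>G0\<close> and \<open>H0\<close>. Transport
  along \<open>\<beta>\<close> then preserves measure coset by coset.\<close>

lemma scaled_iso_of_iso_equal_index:
  assumes G0: "subgroup G0 G" "openin T G0" and H0: "subgroup H0 H" "openin T' H0"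
    and \<delta>: "\<delta> \<in> isos G0 H0"
    and L: "\<delta> ` (L \<inter> G0) = L' \<inter> H0"
    and card: "card (rcosets G0) = card (rcosets\<^bsub>H\<^esub> H0)"
  shows "\<exists>f. scaled_iso 1 1 M (carrier G) N (carrier H) f \<and>
    (\<forall>x\<in>carrier G. \<forall>y\<in>carrier G. (x, y) \<in> G.same_orbit \<longleftrightarrow> (f x, f y) \<in> H.same_orbit)"
proof -
  interpret flip: haar_group_pair H N K' T' L' G M K T L by (rule flip)
  note Gs = subgroup.subset[OF G0(1)] and Hs = subgroup.subset[OF H0(1)]
  note iso = iso_memD[OF \<delta> Gs Hs]
  obtain \<beta> where \<beta>: "bij_betw \<beta> (rcosets G0) (rcosets\<^bsub>H\<^esub> H0)"
    using finite_same_card_bij[OF G.index_measure(1)[OF G0] H.index_measure(1)[OF H0] card] by blast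
  have \<beta>c: "\<beta> c \<in> rcosets\<^bsub>H\<^esub> H0" if "c \<in> rcosets G0" for c using bij_betwE[OF \<beta>] that by blast
  define f where "f = transport \<beta> \<delta> G0"
  define \<beta>' where "\<beta>' = the_inv_into (rcosets G0) \<beta>"
  define \<delta>' where "\<delta>' = the_inv_into G0 \<delta>"
  define g where "g = flip.transport \<beta>' \<delta>' H0"
  have \<beta>': "bij_betw \<beta>' (rcosets\<^bsub>H\<^esub> H0) (rcosets G0)"
    unfolding \<beta>'_def by (rule bij_betw_the_inv_into[OF \<beta>])
  have \<delta>': "\<delta>' \<in> flip.isos H0 G0"
    unfolding \<delta>'_def by (rule topological_group_iso_inverse[OF G0(1) H0(1) \<delta>])
  note f = transport_props[OF G0 H0 \<delta> \<beta>, folded f_def]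
  note g = flip.transport_props[OF H0 G0 \<delta>' \<beta>', folded g_def]
  have gf: "g (f x) = x" if "x \<in> carrier G" for x
    using transport_inverse[OF G0 H0 \<delta> \<beta> that]
    by (simp add: g_def f_def \<beta>'_def \<delta>'_def)
  have inj: "inj_on f (carrier G)" by (rule inj_on_inverseI[of _ g]) (rule gf)
  have surj: "f ` carrier G = carrier H"
  proof
    show "carrier H \<subseteq> f ` carrier G"
    proof
      fix y assume y: "y \<in> carrier H"
      \<comment> \<open>Exchanging the two groups in \<open>transport_inverse\<close> gives a left
        inverse of g built from doubly inverted data, not literally f. Injectivity of g is enough: g
        (f (g y)) = g y yields f (g y) = y.\<close>
      have ginj: "inj_on g (carrier H)"
      proof (rule inj_on_inverseI)
        fix y assume "y \<in> carrier H"
        from flip.transport_inverse[OF H0 G0 \<delta>' \<beta>' this]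
        show "transport (the_inv_into (rcosets\<^bsub>H\<^esub> H0) \<beta>') (the_inv_into H0 \<delta>') G0 (g y) = y"
          by (simp add: g_def)
      qed
      have "g (f (g y)) = g y" by (rule gf[OF g(2)[OF y]])
      then have "f (g y) = y" using ginj y f(2)[OF g(2)[OF y]] by (simp add: inj_on_def)
      then show "y \<in> f ` carrier G" using g(2)[OF y] by force
    qed
  qed (use f(2) in blast)
  have fE: "f ` E = g -` E \<inter> space N" if "E \<subseteq> carrier G" for E
  proof (rule equalityI; rule subsetI)
    fix y assume "y \<in> f ` E" then show "y \<in> g -` E \<inter> space N"
      using gf f(2) that by (auto simp: H.space_M subset_iff)
  next
    fix y assume y: "y \<in> g -` E \<inter> space N"
    then obtain x where "x \<in> carrier G" "y = f x" using surj by (auto simp: H.space_M)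
    then show "y \<in> f ` E" using y gf by auto
  qed
  have eqM: "emeasure M G0 = emeasure N H0"
  proof -
    have "real (card (rcosets G0)) * measure M G0 = real (card (rcosets G0)) * measure N H0"
      using G.index_measure(2)[OF G0] H.index_measure(2)[OF H0] card by simp
    moreover have "card (rcosets G0) \<noteq> 0" 
      using G.index_measure(2)[OF G0] by (metis mult_zero_left of_nat_0 zero_neq_one)
    ultimately show ?thesis by (simp add: G.emeasure_eq_measure H.emeasure_eq_measure)
  qed
  have G0pos: "emeasure M G0 \<noteq> 0" using G.open_subgroup_positive[OF G0] by (auto simp: G.emeasure_eq_measure)
  have fset: "f ` E \<in> sets N" if E: "E \<in> sets M" for E
    unfolding fE[OF sets.sets_into_space[OF E, unfolded G.space_M]] by (rule measurable_sets[OF g(1) E])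
  \<comment> \<open>On one coset f is \<open>\<delta>\<close> between two left translations, and
    \<open>\<delta>\<close> preserves measure because \<open>G0\<close> and \<open>H0\<close> have
    equal measure.\<close>
  have piece: "emeasure N (f ` E \<inter> {y \<in> carrier H. H.coset_of H0 y = \<beta> c}) =
      emeasure M (E \<inter> {x \<in> carrier G. G.coset_of G0 x = c})"
    if E: "E \<in> sets M" and c: "c \<in> rcosets G0" for E c
  proof -
    define P where "P = E \<inter> {x \<in> carrier G. G.coset_of G0 x = c}"
    have P: "P \<in> sets M" unfolding P_def using E G.coset_of_sets[OF G0 c] by blast
    note Gr = G.rep(3)[OF G0 c] and Hr = H.rep(3)[OF H0 \<beta>c[OF c]]
    define Q where "Q = G.rep c <# P"
    have Q: "Q \<in> sets M" unfolding Q_def by (rule G.left_translate_sets[OF Gr P])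
    have mQ: "emeasure M Q = emeasure M P" unfolding Q_def by (rule G.left_invariant[OF Gr P])
    have QG0: "Q \<subseteq> G0" using G.rep_coset_of[OF G0] by (auto simp: Q_def P_def l_coset_def)
    have "f ` E \<inter> {y \<in> carrier H. H.coset_of H0 y = \<beta> c} = f ` P"
    proof (rule equalityI; rule subsetI)
      fix y assume "y \<in> f ` E \<inter> {y \<in> carrier H. H.coset_of H0 y = \<beta> c}"
      then obtain x where x: "x \<in> E" "y = f x" "H.coset_of H0 (f x) = \<beta> c" by blast
      have xc: "x \<in> carrier G" using sets.sets_into_space[OF E] x by (auto simp: G.space_M)
      have "G.coset_of G0 x = c"
        using x(3) f(3)[OF xc] bij_betw_imp_inj_on[OF \<beta>] G.coset_of_rcosets[OF G0(1) xc] c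
        by (simp add: inj_on_def)
      then show "y \<in> f ` P" using x xc by (auto simp: P_def)
    next
      fix y assume "y \<in> f ` P"
      then obtain x where x: "x \<in> E" "x \<in> carrier G" "G.coset_of G0 x = c" "y = f x"
        by (auto simp: P_def)
      then show "y \<in> f ` E \<inter> {y \<in> carrier H. H.coset_of H0 y = \<beta> c}"
        using f(2,3)[OF x(2)] by auto
    qed
    also have "f ` P = inv\<^bsub>H\<^esub> (H.rep (\<beta> c)) <#\<^bsub>H\<^esub> (\<delta> ` Q)"
      by (auto simp: f_def transport_def P_def Q_def l_coset_def)
    finally have "emeasure N (f ` E \<inter> {y \<in> carrier H. H.coset_of H0 y = \<beta> c}) = emeasure N (\<delta> ` Q)"
      using H.left_invariant[OF H.inv_closed[OF Hr] open_iso_measure(1)[OF G0 H0 \<delta> Q QG0]] by simp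
    also have "emeasure N (\<delta> ` Q) = emeasure M Q"
      using open_iso_measure(2)[OF G0 H0 \<delta> Q QG0] eqM G0pos G.emeasure_finite[of G0]
      by (auto simp: mult.commute[of _ "emeasure N H0"] ennreal_mult_cancel_left)
    finally show ?thesis using mQ by (simp add: P_def)
  qed
  have "scaled_iso 1 1 M (carrier G) N (carrier H) f"
    unfolding scaled_iso_def
  proof (intro conjI ballI impI)
    show "bij_betw f (carrier G) (carrier H)" using inj surj by (simp add: bij_betw_def)
    show "f -` F \<inter> carrier G \<in> sets M" if "F \<in> sets N" for F
      using measurable_sets[OF f(1) that] by (simp add: G.space_M)
    fix E assume E: "E \<in> sets M"
    show "f ` E \<in> sets N" by (rule fset[OF E])
    have "emeasure N (f ` E) = (\<Sum>d\<in>rcosets\<^bsub>H\<^esub> H0. emeasure N (f ` E \<inter> {y \<in> carrier H. H.coset_of H0 y = d}))"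
      by (rule H.emeasure_coset_sum[OF H0 fset[OF E]])
    also have "\<dots> = (\<Sum>c\<in>rcosets G0. emeasure N (f ` E \<inter> {y \<in> carrier H. H.coset_of H0 y = \<beta> c}))"
      by (rule sum.reindex_bij_betw[OF \<beta>, symmetric])
    also have "\<dots> = (\<Sum>c\<in>rcosets G0. emeasure M (E \<inter> {x \<in> carrier G. G.coset_of G0 x = c}))"
      by (rule sum.cong) (use piece[OF E] in auto)
    also have "\<dots> = emeasure M E" by (rule G.emeasure_coset_sum[OF G0 E, symmetric])
    finally show "1 * emeasure N (f ` E) = 1 * emeasure M E" by simp
  qed
  moreover have "(x, y) \<in> G.same_orbit \<longleftrightarrow> (f x, f y) \<in> H.same_orbit"
    if x: "x \<in> carrier G" and y: "y \<in> carrier G" for x y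
  proof -
    define r where "r x = G.rep (G.coset_of G0 x) \<otimes> x" for x
    have rG: "r x \<in> G0" if "x \<in> carrier G" for x unfolding r_def by (rule G.rep_coset_of[OF G0 that])
    note cc = G.coset_of_rcosets[OF G0(1)]
    have dH: "\<delta> (r x) \<in> carrier H" if "x \<in> carrier G" for x
      using bij_betwE[OF iso(1)] rG[OF that] Hs by blast
    have "(x, y) \<in> G.same_orbit \<longleftrightarrow> (r x, r y) \<in> G.same_orbit"
      unfolding r_def by (rule G.same_orbit_translate[symmetric]) (use G.rep(1)[OF G0 cc] x y in auto)
    also have "\<dots> \<longleftrightarrow> (\<delta> (r x), \<delta> (r y)) \<in> H.same_orbit"
      by (rule iso_same_orbit[OF G0(1) H0(1) \<delta> L rG[OF x] rG[OF y], symmetric])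
    also have "\<dots> \<longleftrightarrow> (f x, f y) \<in> H.same_orbit"
      unfolding f_def transport_def r_def[symmetric]
      by (rule H.same_orbit_translate[symmetric])
        (use H.rep(1)[OF H0 \<beta>c[OF cc]] subgroup.m_inv_closed[OF H.subgroup_L] dH x y in auto)
    finally show ?thesis .
  qed
  ultimately show ?thesis by (intro exI[of _ f] conjI ballI)
qed

section \<open>The three equivalences for a pair of filtered compact groups\<close>

lemma stably_orbit_equivalent_iff:
  assumes gap: "G.gap"
  shows "stably_orbit_equivalent M G.same_orbit N H.same_orbit \<longleftrightarrow>
    (\<exists>G\<^sub>0 H\<^sub>0 \<delta>. subgroup G\<^sub>0 G \<and> openin T G\<^sub>0 \<and> subgroup H\<^sub>0 H \<and> openin T' H\<^sub>0 \<and>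
      \<delta> \<in> isos G\<^sub>0 H\<^sub>0 \<and> \<delta> ` (L \<inter> G\<^sub>0) = L' \<inter> H\<^sub>0)"
    (is "?lhs \<longleftrightarrow> ?rhs")
proof
  assume ?lhs
  then obtain A B where A: "A \<in> sets M" and B: "B \<in> sets N"
    and pos: "emeasure M A > 0" "emeasure N B > 0"
    and oe: "orbit_equivalent (normalized_restriction M A) (G.same_orbit \<inter> A \<times> A)
      (normalized_restriction N B) (H.same_orbit \<inter> B \<times> B)"
    unfolding stably_orbit_equivalent_def by blast
  obtain X Y f where XA: "X \<in> sets (normalized_restriction M A)"
    and YB: "Y \<in> sets (normalized_restriction N B)"
    and ae: "AE x in normalized_restriction M A. x \<in> X"
    and f: "scaled_iso 1 1 (normalized_restriction M A) X (normalized_restriction N B) Y f"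
    and orb: "\<forall>x\<in>X. \<forall>y\<in>X. (x, y) \<in> G.same_orbit \<inter> A \<times> A \<longleftrightarrow> (f x, f y) \<in> H.same_orbit \<inter> B \<times> B"
    using oe unfolding orbit_equivalent_iff_scaled_iso by blast
  have X: "X \<in> sets M" "X \<subseteq> A" using XA normalized_restriction_sets(1)[OF A] by auto
  have Y: "Y \<in> sets N" "Y \<subseteq> B" using YB normalized_restriction_sets(1)[OF B] by auto
  have f': "scaled_iso (1 / emeasure M A) (1 / emeasure N B) M X N Y f"
    using f unfolding scaled_iso_normalized_restriction[OF A X(2) B Y(2)] .
  have fY: "f x \<in> Y" if "x \<in> X" for x using f' that by (auto simp: scaled_iso_def bij_betw_def)
  have Xpos: "emeasure M X > 0"
  proof (rule ccontr)
    assume "\<not> ?thesis"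
    then have 0: "emeasure M X = 0" by simp
    have "emeasure (normalized_restriction M A) A = emeasure (normalized_restriction M A) X"
      by (rule emeasure_eq_AE)
        (use ae X XA A normalized_restriction_sets(1,2)[OF A] in auto)
    then have "1 / emeasure M A * emeasure M A = 0"
      using normalized_restriction_sets(3)[OF A, of A] normalized_restriction_sets(3)[OF A X(2)] 0 by simp
    then show False using pos(1) by (auto simp: ennreal_divide_eq_0_iff)
  qed
  have a: "1 / emeasure M A \<noteq> 0" by (simp add: ennreal_divide_eq_0_iff)
  have orb': "(x, y) \<in> G.same_orbit \<longleftrightarrow> (f x, f y) \<in> H.same_orbit" if "x \<in> X" "y \<in> X" for x y
    using orb that X(2) Y(2) fY by blast
  obtain n \<delta> where "\<delta> \<in> isos (K n) (\<delta> ` K n)" "subgroup (\<delta> ` K n) H"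
      "openin T' (\<delta> ` K n)" "\<delta> ` (L \<inter> K n) = L' \<inter> \<delta> ` K n"
    using local_iso_of_scaled_iso[OF gap X(1) Xpos Y(1) f' a orb'] by blast
  then show ?rhs
    by (intro exI[of _ "K n"] exI[of _ "\<delta> ` K n"] exI[of _ \<delta>] conjI G.K_subgroup G.openin_K)
next
  assume ?rhs
  then obtain G0 H0 \<delta> where G0: "subgroup G0 G" "openin T G0" and H0: "subgroup H0 H" "openin T' H0"
    and \<delta>: "\<delta> \<in> isos G0 H0" and L: "\<delta> ` (L \<inter> G0) = L' \<inter> H0" by blast
  note sG = G.open_sets[OF G0(2)] and sH = H.open_sets[OF H0(2)]
  note iso = iso_memD[OF \<delta> subgroup.subset[OF G0(1)] subgroup.subset[OF H0(1)]]
  \<comment> \<open>Conversely, take \<open>G0\<close> and \<open>H0\<close> as the two sets: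
    \<open>\<delta>\<close> itself is an orbit equivalence between the restrictions.\<close>
  have "scaled_iso 1 1 (normalized_restriction M G0) G0 (normalized_restriction N H0) H0 \<delta>"
    unfolding scaled_iso_normalized_restriction[OF sG order_refl sH order_refl]
    by (rule scaled_iso_of_iso[OF G0 H0 \<delta>])
  moreover have "AE x in normalized_restriction M G0. x \<in> G0"
    "AE y in normalized_restriction N H0. y \<in> H0"
    using normalized_restriction_sets(2)[OF sG] normalized_restriction_sets(2)[OF sH]
    by (auto intro!: AE_I2)
  moreover have "G0 \<in> sets (normalized_restriction M G0)" "H0 \<in> sets (normalized_restriction N H0)"
    using normalized_restriction_sets(1)[OF sG] normalized_restriction_sets(1)[OF sH] sG sH by auto
  moreover have "(x, y) \<in> G.same_orbit \<inter> G0 \<times> G0 \<longleftrightarrow> (\<delta> x, \<delta> y) \<in> H.same_orbit \<inter> H0 \<times> H0"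
    if "x \<in> G0" "y \<in> G0" for x y
    using iso_same_orbit[OF G0(1) H0(1) \<delta> L that] that bij_betwE[OF iso(1)] by blast
  ultimately have "orbit_equivalent (normalized_restriction M G0) (G.same_orbit \<inter> G0 \<times> G0)
      (normalized_restriction N H0) (H.same_orbit \<inter> H0 \<times> H0)"
    unfolding orbit_equivalent_iff_scaled_iso
    by (intro bexI[of _ G0] bexI[of _ H0] exI[of _ \<delta>] conjI ballI)
  then show ?lhs
    unfolding stably_orbit_equivalent_def
    using sG sH G.open_positive[OF G0(2)] H.open_positive[OF H0(2)]
      subgroup.one_closed[OF G0(1)] subgroup.one_closed[OF H0(1)] by blast
qed

lemma orbit_equivalent_iff:
  assumes gap: "G.gap"
  shows "orbit_equivalent M G.same_orbit N H.same_orbit \<longleftrightarrow>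
    (\<exists>G\<^sub>0 H\<^sub>0 \<delta>. subgroup G\<^sub>0 G \<and> openin T G\<^sub>0 \<and> subgroup H\<^sub>0 H \<and> openin T' H\<^sub>0 \<and>
      \<delta> \<in> isos G\<^sub>0 H\<^sub>0 \<and> \<delta> ` (L \<inter> G\<^sub>0) = L' \<inter> H\<^sub>0 \<and>
      card (rcosets G\<^sub>0) = card (rcosets\<^bsub>H\<^esub> H\<^sub>0))"
    (is "?lhs \<longleftrightarrow> ?rhs")
proof
  assume ?lhs
  then obtain X Y f where X: "X \<in> sets M" and Y: "Y \<in> sets N" and ae: "AE x in M. x \<in> X"
    and f: "scaled_iso 1 1 M X N Y f"
    and orb: "\<forall>x\<in>X. \<forall>y\<in>X. (x, y) \<in> G.same_orbit \<longleftrightarrow> (f x, f y) \<in> H.same_orbit"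
    unfolding orbit_equivalent_iff_scaled_iso by blast
  have Xpos: "emeasure M X > 0" using G.prob_eq_1[OF X] ae by (simp add: G.emeasure_eq_measure)
  have orb': "(x, y) \<in> G.same_orbit \<longleftrightarrow> (f x, f y) \<in> H.same_orbit" if "x \<in> X" "y \<in> X" for x y
    using orb that by blast
  obtain n \<delta> where d: "\<delta> \<in> isos (K n) (\<delta> ` K n)" "subgroup (\<delta> ` K n) H"
      "openin T' (\<delta> ` K n)" "\<delta> ` (L \<inter> K n) = L' \<inter> \<delta> ` K n"
      and m: "1 * emeasure N (\<delta> ` K n) = 1 * emeasure M (K n)"
    using local_iso_of_scaled_iso[OF gap X Xpos Y f one_neq_zero orb'] by blast
  \<comment> \<open>Index times measure is 1 in both groups, so equal measures mean equal
    indices.\<close>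
  have "measure N (\<delta> ` K n) = measure M (K n)" using m by (simp add: measure_def)
  then have "real (card (rcosets K n)) * measure M (K n) = real (card (rcosets\<^bsub>H\<^esub> (\<delta> ` K n))) * measure M (K n)"
    using G.index_measure(2)[OF G.K_subgroup G.openin_K] H.index_measure(2)[OF d(2,3)] by simp
  then have "card (rcosets K n) = card (rcosets\<^bsub>H\<^esub> (\<delta> ` K n))"
    using G.open_subgroup_positive[OF G.K_subgroup G.openin_K, of n] by auto
  then show ?rhs using d
    by (intro exI[of _ "K n"] exI[of _ "\<delta> ` K n"] exI[of _ \<delta>] conjI G.K_subgroup G.openin_K)
next
  assume ?rhs
  then obtain G0 H0 \<delta> where G0: "subgroup G0 G" "openin T G0" and H0: "subgroup H0 H" "openin T' H0"
    and \<delta>: "\<delta> \<in> isos G0 H0" and L: "\<delta> ` (L \<inter> G0) = L' \<inter> H0"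
    and card: "card (rcosets G0) = card (rcosets\<^bsub>H\<^esub> H0)" by blast
  obtain f where f: "scaled_iso 1 1 M (carrier G) N (carrier H) f"
    and orb: "\<forall>x\<in>carrier G. \<forall>y\<in>carrier G. (x, y) \<in> G.same_orbit \<longleftrightarrow> (f x, f y) \<in> H.same_orbit"
    using scaled_iso_of_iso_equal_index[OF G0 H0 \<delta> L card] by blast
  have "carrier G \<in> sets M" "carrier H \<in> sets N"
    using sets.top[of M] sets.top[of N] by (simp_all add: G.space_M H.space_M)
  moreover have "AE x in M. x \<in> carrier G" "AE y in N. y \<in> carrier H"
    by (auto intro!: AE_I2 simp: G.space_M H.space_M)
  ultimately show ?lhs
    unfolding orbit_equivalent_iff_scaled_iso using f orb
    by (intro bexI[of _ "carrier G"] bexI[of _ "carrier H"] exI[of _ f] conjI)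
qed

text \<open>B and B' stand for the spaces \<open>borel_of\<close>, which carry the zero measure;
  having the same measurable sets is enough to pass to the Haar measures.\<close>

lemma borel_reducible_iff:
  assumes gap: "G.gap" and B: "sets B = sets M" "sets B' = sets N"
  shows "borel_reducible B G.same_orbit B' H.same_orbit \<longleftrightarrow>
    (\<exists>G\<^sub>0 H\<^sub>0 \<delta>. subgroup G\<^sub>0 G \<and> openin T G\<^sub>0 \<and> subgroup H\<^sub>0 H \<and> closedin T' H\<^sub>0 \<and>
      \<delta> \<in> isos G\<^sub>0 H\<^sub>0 \<and> \<delta> ` (L \<inter> G\<^sub>0) = L' \<inter> H\<^sub>0)"
    (is "?lhs \<longleftrightarrow> ?rhs")
proof -
  have sp: "space B = carrier G" using sets_eq_imp_space_eq[OF B(1)] by (simp add: G.space_M)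
  have me: "B \<rightarrow>\<^sub>M B' = M \<rightarrow>\<^sub>M N" by (rule measurable_cong_sets[OF B])
  show ?thesis
  proof
    assume ?lhs
    then obtain f where f: "f \<in> M \<rightarrow>\<^sub>M N"
      "\<And>x y. x \<in> carrier G \<Longrightarrow> y \<in> carrier G \<Longrightarrow> (x, y) \<in> G.same_orbit \<longleftrightarrow> (f x, f y) \<in> H.same_orbit"
      unfolding borel_reducible_def me sp by blast
    obtain n \<delta> where "\<delta> \<in> isos (K n) (\<delta> ` K n)" "subgroup (\<delta> ` K n) H"
        "closedin T' (\<delta> ` K n)" "\<delta> ` (L \<inter> K n) = L' \<inter> \<delta> ` K n"
      using local_iso_of_borel_reduction[OF gap f] by blast
    then show ?rhs
      by (intro exI[of _ "K n"] exI[of _ "\<delta> ` K n"] exI[of _ \<delta>] conjI G.K_subgroup G.openin_K)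
  next
    assume ?rhs
    then show ?lhs
      unfolding borel_reducible_def me sp using borel_reduction_of_iso by blast
  qed
qed

end

section \<open>Profinite completions\<close>

locale residual_tower = group \<Gamma> for \<Gamma> :: "('a, 'c) monoid_scheme" (structure) +
  fixes N :: "nat \<Rightarrow> 'a set"
  assumes chain: "residual_chain \<Gamma> N"
begin

abbreviation "\<G> \<equiv> profinite_completion \<Gamma> N"
abbreviation "\<iota> \<equiv> profinite_embedding \<Gamma> N"

lemma N_normal: "N n \<lhd> \<Gamma>"
  using chain by (simp add: residual_chain_def)

lemma N_subgroup: "subgroup (N n) \<Gamma>"
  using N_normal normal_imp_subgroup by blast

lemma N_mono: "m \<le> n \<Longrightarrow> N n \<subseteq> N m"
  using chain by (simp add: residual_chain_def decseq_def)

lemma finite_rcosets: "finite (rcosets (N n))"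
  using chain by (simp add: residual_chain_def)

text \<open>\<open>N n\<close> is absorbed by the larger \<open>N m\<close>, so the connecting maps
  keep representatives.\<close>

lemma coarsen:
  assumes "m \<le> n" "g \<in> carrier \<Gamma>" shows "N m <#> (N n #> g) = N m #> g"
proof -
  have "N n \<subseteq> carrier \<Gamma>" "N m \<subseteq> carrier \<Gamma>" using N_subgroup subgroup.subset by blast+
  then have "N m <#> (N n #> g) = (N m <#> N n) #> g" using assms(2) by (simp add: setmult_rcos_assoc)
  also have "N m <#> N n = N m"
  proof
    show "N m <#> N n \<subseteq> N m"
      using N_mono[OF assms(1)] subgroup.m_closed[OF N_subgroup] by (auto simp: set_mult_def)
    show "N m \<subseteq> N m <#> N n"
    proof
      fix x assume x: "x \<in> N m"
      then have "x = x \<otimes> \<one>" using subgroup.mem_carrier[OF N_subgroup] by simp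
      then show "x \<in> N m <#> N n"
        unfolding set_mult_def using x subgroup.one_closed[OF N_subgroup] by blast
    qed
  qed
  finally show ?thesis .
qed

text \<open>By \<open>coarsen\<close>, a representative of the n-th coordinate represents all
  earlier ones too. In this form closure under products and inverses, as well as density, is a
  computation with representatives.\<close>

lemma completion_carrier:
  "carrier \<G> = {x. \<forall>n. \<exists>g\<in>carrier \<Gamma>. \<forall>m\<le>n. x m = N m #> g}"
proof -
  have "carrier \<G> = {x. (\<forall>n. x n \<in> rcosets (N n)) \<and> (\<forall>m n. m \<le> n \<longrightarrow> N m <#> x n = x m)}"
    by (auto simp: profinite_completion_def FactGroup_def)
  also have "\<dots> = {x. \<forall>n. \<exists>g\<in>carrier \<Gamma>. \<forall>m\<le>n. x m = N m #> g}"
  proof (rule Collect_cong, rule iffI)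
    fix x assume h: "(\<forall>n. x n \<in> rcosets (N n)) \<and> (\<forall>m n. m \<le> n \<longrightarrow> N m <#> x n = x m)"
    show "\<forall>n. \<exists>g\<in>carrier \<Gamma>. \<forall>m\<le>n. x m = N m #> g"
    proof
      fix n
      have "x n \<in> rcosets (N n)" using h by blast
      then obtain g where g: "g \<in> carrier \<Gamma>" "x n = N n #> g" unfolding RCOSETS_def by blast
      have "x m = N m #> g" if "m \<le> n" for m
        using h that coarsen[OF that g(1)] unfolding g(2)[symmetric] by simp
      then show "\<exists>g\<in>carrier \<Gamma>. \<forall>m\<le>n. x m = N m #> g" using g(1) by blast
    qed
  next
    fix x assume h: "\<forall>n. \<exists>g\<in>carrier \<Gamma>. \<forall>m\<le>n. x m = N m #> g"
    have *: "x n \<in> rcosets (N n) \<and> (\<forall>m\<le>n. N m <#> x n = x m)" for n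
    proof -
      obtain g where g: "g \<in> carrier \<Gamma>" "\<forall>m\<le>n. x m = N m #> g" using spec[OF h, of n] by (rule bexE)
      have xn: "x n = N n #> g" using g(2) by simp
      have "N n #> g \<in> rcosets (N n)" unfolding RCOSETS_def using g(1) by blast
      moreover have "N m <#> (N n #> g) = x m" if "m \<le> n" for m
        using coarsen[OF that g(1)] g(2) that by simp
      ultimately show ?thesis unfolding xn by simp
    qed
    then show "(\<forall>n. x n \<in> rcosets (N n)) \<and> (\<forall>m n. m \<le> n \<longrightarrow> N m <#> x n = x m)" by simp
  qed
  finally show ?thesis .
qed

lemma completion_rep: "x \<in> carrier \<G> \<Longrightarrow> \<exists>g\<in>carrier \<Gamma>. \<forall>m\<le>n. x m = N m #> g"
  by (simp add: completion_carrier)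

lemma completion_coarsen: "x \<in> carrier \<G> \<Longrightarrow> m \<le> n \<Longrightarrow> N m <#> x n = x m"
  by (simp add: profinite_completion_def)

lemma completion_mult: "x \<otimes>\<^bsub>\<G>\<^esub> y = (\<lambda>n. x n <#> y n)"
  by (simp add: profinite_completion_def restrict_UNIV)

lemma completion_one: "\<one>\<^bsub>\<G>\<^esub> = N"
  by (auto simp: profinite_completion_def)

lemma coset_mult:
  "g \<in> carrier \<Gamma> \<Longrightarrow> h \<in> carrier \<Gamma> \<Longrightarrow> (N n #> g) <#> (N n #> h) = N n #> (g \<otimes> h)"
  by (rule normal.rcos_sum[OF N_normal])

lemma completion_mult_closed:
  assumes "x \<in> carrier \<G>" "y \<in> carrier \<G>" shows "x \<otimes>\<^bsub>\<G>\<^esub> y \<in> carrier \<G>"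
  unfolding completion_carrier completion_mult
proof (intro CollectI allI)
  fix n
  obtain g h where "g \<in> carrier \<Gamma>" "\<forall>m\<le>n. x m = N m #> g" "h \<in> carrier \<Gamma>" "\<forall>m\<le>n. y m = N m #> h"
    using completion_rep[OF assms(1)] completion_rep[OF assms(2)] by meson
  then show "\<exists>g\<in>carrier \<Gamma>. \<forall>m\<le>n. x m <#> y m = N m #> g"
    by (intro bexI[of _ "g \<otimes> h"]) (auto simp: coset_mult)
qed

lemma completion_subgroup:
  "subgroup (carrier \<G>) (product_group UNIV (\<lambda>n. \<Gamma> Mod N n))"
proof -
  let ?P = "product_group UNIV (\<lambda>n. \<Gamma> Mod N n)"
  have grp: "group (\<Gamma> Mod N n)" for n by (rule normal.factorgroup_is_group[OF N_normal])
  interpret P: group ?P by (rule product_group) (rule grp)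
  have sub: "carrier \<G> \<subseteq> carrier ?P" by (auto simp: profinite_completion_def)
  have mult: "x \<otimes>\<^bsub>?P\<^esub> y = x \<otimes>\<^bsub>\<G>\<^esub> y" for x y by (simp add: profinite_completion_def)
  show ?thesis
  proof (rule P.subgroupI[OF sub])
    have "N \<in> carrier \<G>"
      unfolding completion_carrier
      using subgroup.subset[OF N_subgroup] by (auto intro!: bexI[of _ \<one>] simp: coset_mult_one)
    then show "carrier \<G> \<noteq> {}" by blast
    fix x assume x: "x \<in> carrier \<G>"
    then have xP: "x \<in> (\<Pi>\<^sub>E n\<in>UNIV. carrier (\<Gamma> Mod N n))" using sub by auto
    have inv: "inv\<^bsub>?P\<^esub> x = (\<lambda>n. inv\<^bsub>\<Gamma> Mod N n\<^esub> x n)"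
      using inv_product_group[OF xP grp] by (simp add: restrict_UNIV)
    show "inv\<^bsub>?P\<^esub> x \<in> carrier \<G>"
      unfolding completion_carrier inv
    proof (intro CollectI allI)
      fix n
      obtain g where g: "g \<in> carrier \<Gamma>" "\<And>m. m \<le> n \<Longrightarrow> x m = N m #> g"
        using completion_rep[OF x, of n] by blast
      have "inv\<^bsub>\<Gamma> Mod N m\<^esub> x m = N m #> inv g" if m: "m \<le> n" for m
      proof -
        have "N m #> g \<in> carrier (\<Gamma> Mod N m)" using g(1) by (auto simp: FactGroup_def RCOSETS_def)
        then show ?thesis
          unfolding g(2)[OF m]
          by (simp add: normal.inv_FactGroup[OF N_normal] normal.rcos_inv[OF N_normal g(1)])
      qed
      then show "\<exists>g\<in>carrier \<Gamma>. \<forall>m\<le>n. inv\<^bsub>\<Gamma> Mod N m\<^esub> x m = N m #> g" using g(1) by blast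
    qed
    fix y assume "y \<in> carrier \<G>"
    then show "x \<otimes>\<^bsub>?P\<^esub> y \<in> carrier \<G>" unfolding mult using completion_mult_closed x by blast
  qed
qed

lemma completion_group: "group \<G>"
proof -
  have grp: "group (\<Gamma> Mod N n)" for n by (rule normal.factorgroup_is_group[OF N_normal])
  have "\<G> = product_group UNIV (\<lambda>n. \<Gamma> Mod N n)\<lparr>carrier := carrier \<G>\<rparr>"
    by (simp add: profinite_completion_def)
  then show ?thesis
    using subgroup.subgroup_is_group[OF completion_subgroup product_group[OF grp]] by simp
qed

lemma projection_hom: "group_hom \<G> (\<Gamma> Mod N n) (\<lambda>x. x n)"
proof (rule group_hom.intro[OF completion_group normal.factorgroup_is_group[OF N_normal]])
  show "group_hom_axioms \<G> (\<Gamma> Mod N n) (\<lambda>x. x n)"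
    by unfold_locales (auto simp: hom_def completion_mult profinite_completion_def)
qed

definition level :: "nat \<Rightarrow> (nat \<Rightarrow> 'a set) set" where
  "level n = {x \<in> carrier \<G>. x n = N n}"

lemma level_kernel: "level n = kernel \<G> (\<Gamma> Mod N n) (\<lambda>x. x n)"
  by (simp add: level_def kernel_def)

text \<open>Projection to coordinate n is a homomorphism with kernel \<open>level n\<close>, so the
  abstract cells are the sets of points sharing their n-th coordinate.\<close>

lemma level_cell:
  assumes x: "x \<in> carrier \<G>" and y: "y \<in> carrier \<G>"
  shows "inv\<^bsub>\<G>\<^esub> x \<otimes>\<^bsub>\<G>\<^esub> y \<in> level n \<longleftrightarrow> y n = x n"
proof -
  interpret h: group_hom \<G> "\<Gamma> Mod N n" "\<lambda>x. x n" by (rule projection_hom)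
  have "(inv\<^bsub>\<G>\<^esub> x \<otimes>\<^bsub>\<G>\<^esub> y) n = inv\<^bsub>\<Gamma> Mod N n\<^esub> (x n) \<otimes>\<^bsub>\<Gamma> Mod N n\<^esub> y n"
    using h.hom_mult[of "inv\<^bsub>\<G>\<^esub> x" y] h.hom_inv[OF x] x y by simp
  moreover have "inv\<^bsub>\<G>\<^esub> x \<otimes>\<^bsub>\<G>\<^esub> y \<in> level n \<longleftrightarrow> (inv\<^bsub>\<G>\<^esub> x \<otimes>\<^bsub>\<G>\<^esub> y) n = \<one>\<^bsub>\<Gamma> Mod N n\<^esub>"
    using x y by (simp add: level_def)
  ultimately show ?thesis
    using group.inv_mult_eq_one_iff[OF h.H.is_group h.hom_closed[OF x] h.hom_closed[OF y]] by metis
qed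

lemma embedding_closed: "g \<in> carrier \<Gamma> \<Longrightarrow> \<iota> g \<in> carrier \<G>"
  by (auto simp: completion_carrier profinite_embedding_def)

lemma embedding_hom: "group_hom \<Gamma> \<G> \<iota>"
proof (rule group_hom.intro[OF _ completion_group])
  show "group_hom_axioms \<Gamma> \<G> \<iota>"
  proof (unfold_locales, rule homI)
    show "\<iota> (g \<otimes> h) = \<iota> g \<otimes>\<^bsub>\<G>\<^esub> \<iota> h" if "g \<in> carrier \<Gamma>" "h \<in> carrier \<Gamma>" for g h
      using that by (simp add: completion_mult coset_mult profinite_embedding_def)
  qed (rule embedding_closed)
qed (rule is_group)

lemma topology_topspace: "topspace (profinite_topology \<Gamma> N) = carrier \<G>"
  by (auto simp: profinite_topology_def profinite_completion_def)

text \<open>A basic open set of the product restricts finitely many coordinates. In the completion a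
  coordinate determines all earlier ones, so fixing the largest restricted one suffices.\<close>

lemma openin_topology_iff:
  "openin (profinite_topology \<Gamma> N) U \<longleftrightarrow>
    U \<subseteq> carrier \<G> \<and> (\<forall>x\<in>U. \<exists>n. {y \<in> carrier \<G>. y n = x n} \<subseteq> U)"
proof
  let ?X = "product_topology (\<lambda>n. discrete_topology (carrier (\<Gamma> Mod N n))) UNIV"
  have sub: "carrier \<G> \<subseteq> topspace ?X" by (auto simp: profinite_completion_def)
  {
    assume "openin (profinite_topology \<Gamma> N) U"
    then obtain V where V: "openin ?X V" "U = V \<inter> carrier \<G>"
      unfolding profinite_topology_def openin_subtopology by blast
    have "\<exists>n. {y \<in> carrier \<G>. y n = x n} \<subseteq> U" if x: "x \<in> U" for x
    proof -
      obtain W where W: "finite {i. W i \<noteq> carrier (\<Gamma> Mod N i)}" "x \<in> Pi\<^sub>E UNIV W" "Pi\<^sub>E UNIV W \<subseteq> V"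
        using V x unfolding openin_product_topology_alt by auto
      \<comment> \<open>The inserted 0 makes \<open>Max\<close> meaningful when no coordinate is
        restricted.\<close>
      define n where "n = Max (insert 0 {i. W i \<noteq> carrier (\<Gamma> Mod N i)})"
      have "y \<in> V" if y: "y \<in> carrier \<G>" "y n = x n" for y
      proof -
        have "y i \<in> W i" for i
        proof (cases "W i = carrier (\<Gamma> Mod N i)")
          case True
          have "y \<in> topspace ?X" using y(1) sub by blast
          then show ?thesis using True by (simp add: PiE_iff)
        next
          case False
          then have "i \<le> n" unfolding n_def using W(1) by (intro Max_ge) auto
          moreover have "N i <#> x n = x i" "N i <#> y n = y i"
            using completion_coarsen[OF _ \<open>i \<le> n\<close>] x y(1) V(2) by blast+
          ultimately have "y i = x i" using y(2) by simp
          then show ?thesis using W(2) by auto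
        qed
        then show ?thesis using W(3) by blast
      qed
      then show ?thesis using V(2) by blast
    qed
    then show "U \<subseteq> carrier \<G> \<and> (\<forall>x\<in>U. \<exists>n. {y \<in> carrier \<G>. y n = x n} \<subseteq> U)" using V(2) by blast
  next
    assume U: "U \<subseteq> carrier \<G> \<and> (\<forall>x\<in>U. \<exists>n. {y \<in> carrier \<G>. y n = x n} \<subseteq> U)"
    have basic: "openin (profinite_topology \<Gamma> N) {y \<in> carrier \<G>. y n = x n}" if "x \<in> carrier \<G>" for x n
    proof -
      have "openin ?X {y \<in> topspace ?X. y n \<in> {x n}}"
        by (rule openin_continuous_map_preimage[OF continuous_map_product_projection])
          (use that sub in auto)
      then show ?thesis
        unfolding profinite_topology_def openin_subtopology using sub
        by (intro exI[of _ "{y \<in> topspace ?X. y n \<in> {x n}}"]) auto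
    qed
    show "openin (profinite_topology \<Gamma> N) U"
      unfolding openin_subopen[of _ U]
    proof
      fix x assume x: "x \<in> U"
      then obtain n where "{y \<in> carrier \<G>. y n = x n} \<subseteq> U" using U by blast
      then show "\<exists>V. openin (profinite_topology \<Gamma> N) V \<and> x \<in> V \<and> V \<subseteq> U"
        using basic[of x n] x U by (intro exI[of _ "{y \<in> carrier \<G>. y n = x n}"]) auto
    qed
  }
qed

text \<open>By Tychonoff the product of the finite quotients is compact. The completion is closed in
  it, since each compatibility condition involves only two discrete coordinates and so cuts out a
  clopen set.\<close>

lemma compact_topology: "compact_space (profinite_topology \<Gamma> N)"
proof -
  let ?X = "product_topology (\<lambda>n. discrete_topology (carrier (\<Gamma> Mod N n))) UNIV"
  have comp: "compact_space ?X"
    unfolding compact_space_product_topology compact_space_discrete_topology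
    using finite_rcosets by (simp add: FactGroup_def)
  have openR: "openin ?X {x \<in> topspace ?X. R (x m) (x n)}" for m n and R :: "'a set \<Rightarrow> 'a set \<Rightarrow> bool"
    unfolding openin_subopen[of _ "{x \<in> topspace ?X. R (x m) (x n)}"]
  proof
    fix x assume x: "x \<in> {x \<in> topspace ?X. R (x m) (x n)}"
    have "openin ?X {y \<in> topspace ?X. y i \<in> {x i}}" for i
      by (rule openin_continuous_map_preimage[OF continuous_map_product_projection]) (use x in auto)
    then have "openin ?X ({y \<in> topspace ?X. y m \<in> {x m}} \<inter> {y \<in> topspace ?X. y n \<in> {x n}})"
      by (intro openin_Int)
    then show "\<exists>V. openin ?X V \<and> x \<in> V \<and> V \<subseteq> {x \<in> topspace ?X. R (x m) (x n)}"
      using x by (intro exI[of _ "{y \<in> topspace ?X. y m \<in> {x m}} \<inter> {y \<in> topspace ?X. y n \<in> {x n}}"]) auto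
  qed
  have closedR: "closedin ?X {x \<in> topspace ?X. R (x m) (x n)}" for m n and R :: "'a set \<Rightarrow> 'a set \<Rightarrow> bool"
  proof -
    have "topspace ?X - {x \<in> topspace ?X. R (x m) (x n)} = {x \<in> topspace ?X. \<not> R (x m) (x n)}" by blast
    then show ?thesis using openR[of "\<lambda>a b. \<not> R a b" m n] by (simp add: closedin_def)
  qed
  have "carrier \<G> = (\<Inter>m. \<Inter>n. {x \<in> topspace ?X. m \<le> n \<longrightarrow> N m <#> x n = x m})"
    by (auto simp: profinite_completion_def)
  also have "closedin ?X \<dots>"
    by (intro closedin_INT closedR[of "\<lambda>a b. _ \<longrightarrow> _ <#> b = a"]) auto
  finally have "compactin ?X (carrier \<G>)" by (rule closedin_compact_space[OF comp])
  then show ?thesis unfolding profinite_topology_def by (rule compact_space_subtopology)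
qed

lemma haar_group:
  assumes "countable (carrier \<Gamma>)" and "haar_probability_measure \<G> (profinite_topology \<Gamma> N) m"
  shows "haar_group \<G> m level (profinite_topology \<Gamma> N) (\<iota> ` carrier \<Gamma>)"
proof -
  interpret C: group \<G> by (rule completion_group)
  interpret i: group_hom \<Gamma> \<G> \<iota> by (rule embedding_hom)
  have prob: "prob_space m" and sets: "sets m = sets (borel_of (profinite_topology \<Gamma> N))"
    and inv: "\<And>g A. g \<in> carrier \<G> \<Longrightarrow> A \<in> sets m \<Longrightarrow> emeasure m (g <#\<^bsub>\<G>\<^esub> A) = emeasure m A"
    using assms(2) by (auto simp: haar_probability_measure_def)
  show ?thesis
  proof (intro haar_group.intro haar_group_axioms.intro)
    show "group \<G>" by (rule completion_group)
    show "prob_space m" by (rule prob)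
    show "level n \<lhd> \<G>" for n
      unfolding level_kernel by (rule group_hom.normal_kernel[OF projection_hom])
    show "decseq level"
    proof (unfold decseq_def, intro allI impI subsetI)
      fix m n x assume mn: "m \<le> n" and x: "x \<in> level n"
      then have "x m = N m <#> x n" using completion_coarsen[OF _ mn, of x] unfolding level_def by blast
      also have "\<dots> = N m"
        using coarsen[OF mn one_closed] x subgroup.subset[OF N_subgroup] by (simp add: level_def coset_mult_one)
      finally show "x \<in> level m" using x by (simp add: level_def)
    qed
    show "(\<Inter>n. level n) = {\<one>\<^bsub>\<G>\<^esub>}"
      using C.one_closed unfolding level_def completion_one by auto
    show "topspace (profinite_topology \<Gamma> N) = carrier \<G>" by (rule topology_topspace)
    show "compact_space (profinite_topology \<Gamma> N)" by (rule compact_topology)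
    show "subgroup (\<iota> ` carrier \<Gamma>) \<G>" by (rule i.img_is_subgroup)
    show "countable (\<iota> ` carrier \<Gamma>)" using assms(1) by simp
    show "sets m = sets (borel_of (profinite_topology \<Gamma> N))" by (rule sets)
    show "emeasure m (g <#\<^bsub>\<G>\<^esub> A) = emeasure m A" if "g \<in> carrier \<G>" "A \<in> sets m" for g A
      by (rule inv[OF that])
    fix U
    have eq: "{y \<in> carrier \<G>. inv\<^bsub>\<G>\<^esub> x \<otimes>\<^bsub>\<G>\<^esub> y \<in> level n} = {y \<in> carrier \<G>. y n = x n}"
      if "x \<in> carrier \<G>" for x n using level_cell[OF that] by blast
    show "openin (profinite_topology \<Gamma> N) U \<longleftrightarrow> U \<subseteq> carrier \<G> \<and>
        (\<forall>x\<in>U. \<exists>n. {y \<in> carrier \<G>. inv\<^bsub>\<G>\<^esub> x \<otimes>\<^bsub>\<G>\<^esub> y \<in> level n} \<subseteq> U)"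
      unfolding openin_topology_iff
    proof (rule conj_cong[OF refl], rule ball_cong[OF refl])
      fix x assume "U \<subseteq> carrier \<G>" "x \<in> U"
      then have x: "x \<in> carrier \<G>" by blast
      show "(\<exists>n. {y \<in> carrier \<G>. y n = x n} \<subseteq> U) \<longleftrightarrow>
          (\<exists>n. {y \<in> carrier \<G>. inv\<^bsub>\<G>\<^esub> x \<otimes>\<^bsub>\<G>\<^esub> y \<in> level n} \<subseteq> U)"
        by (simp only: eq[OF x])
    qed
  next
    fix x n assume x: "x \<in> carrier \<G>"
    obtain g where g: "g \<in> carrier \<Gamma>" "x n = N n #> g" using completion_rep[OF x, of n] by auto
    then have "inv\<^bsub>\<G>\<^esub> x \<otimes>\<^bsub>\<G>\<^esub> \<iota> g \<in> level n"
      using level_cell[OF x embedding_closed[OF g(1)]] by (simp add: profinite_embedding_def)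
    then show "\<exists>l\<in>\<iota> ` carrier \<Gamma>. inv\<^bsub>\<G>\<^esub> x \<otimes>\<^bsub>\<G>\<^esub> l \<in> level n" using g(1) by blast
  qed
qed

text \<open>The orbit of x is the right coset through x of the embedded group, and two points share
  a right coset exactly when their quotient lies in that group.\<close>

lemma orbit_relation_eq:
  "orbit_relation \<Gamma> (carrier \<G>) (left_translation \<Gamma> N) =
    {(x, y). x \<in> carrier \<G> \<and> y \<in> carrier \<G> \<and> x \<otimes>\<^bsub>\<G>\<^esub> inv\<^bsub>\<G>\<^esub> y \<in> \<iota> ` carrier \<Gamma>}"
proof -
  interpret C: group \<G> by (rule completion_group)
  interpret i: group_hom \<Gamma> \<G> \<iota> by (rule embedding_hom)
  let ?L = "\<iota> ` carrier \<Gamma>"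
  have sub: "subgroup ?L \<G>" by (rule i.img_is_subgroup)
  have orb: "orbit \<Gamma> (left_translation \<Gamma> N) x = ?L #>\<^bsub>\<G>\<^esub> x" if "x \<in> carrier \<G>" for x
    using that by (auto simp: orbit_def left_translation_def r_coset_def)
  have "orbit \<Gamma> (left_translation \<Gamma> N) x = orbit \<Gamma> (left_translation \<Gamma> N) y \<longleftrightarrow>
      x \<otimes>\<^bsub>\<G>\<^esub> inv\<^bsub>\<G>\<^esub> y \<in> ?L" if x: "x \<in> carrier \<G>" and y: "y \<in> carrier \<G>" for x y
    unfolding orb[OF x] orb[OF y]
  proof
    assume "?L #>\<^bsub>\<G>\<^esub> x = ?L #>\<^bsub>\<G>\<^esub> y"
    then have "x \<in> ?L #>\<^bsub>\<G>\<^esub> y" using C.rcos_self[OF x sub] by simp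
    then obtain l where l: "l \<in> ?L" "x = l \<otimes>\<^bsub>\<G>\<^esub> y" unfolding r_coset_def by blast
    then have "x \<otimes>\<^bsub>\<G>\<^esub> inv\<^bsub>\<G>\<^esub> y = l"
      using y subgroup.mem_carrier[OF sub l(1)] by (simp add: C.m_assoc)
    then show "x \<otimes>\<^bsub>\<G>\<^esub> inv\<^bsub>\<G>\<^esub> y \<in> ?L" using l(1) by simp
  next
    assume l: "x \<otimes>\<^bsub>\<G>\<^esub> inv\<^bsub>\<G>\<^esub> y \<in> ?L"
    have "x = (x \<otimes>\<^bsub>\<G>\<^esub> inv\<^bsub>\<G>\<^esub> y) \<otimes>\<^bsub>\<G>\<^esub> y" using x y by (simp add: C.m_assoc)
    then have "x \<in> ?L #>\<^bsub>\<G>\<^esub> y" unfolding r_coset_def using l by blast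
    then show "?L #>\<^bsub>\<G>\<^esub> x = ?L #>\<^bsub>\<G>\<^esub> y" using C.repr_independence[OF _ y sub] by simp
  qed
  then show ?thesis unfolding orbit_relation_def by blast
qed

text \<open>The Koopman operator of g composes with translation by the inverse of g; the embedded
  group is closed under inverses, so the two forms of almost invariance agree.\<close>

lemma gap_of_spectral_gap:
  assumes c: "countable (carrier \<Gamma>)" and m: "haar_probability_measure \<G> (profinite_topology \<Gamma> N) m"
    and gap: "spectral_gap \<Gamma> m (left_translation \<Gamma> N)"
  shows "haar_group.gap \<G> m (\<iota> ` carrier \<Gamma>)"
proof -
  interpret C: haar_group \<G> m level "profinite_topology \<Gamma> N" "\<iota> ` carrier \<Gamma>"
    by (rule haar_group[OF c m])
  interpret i: group_hom \<Gamma> \<G> \<iota> by (rule embedding_hom)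
  show ?thesis
  proof (rule C.gap_if_no_almost_invariant_vectors, rule notI, elim exE conjE)
    fix \<xi> :: "nat \<Rightarrow> (nat \<Rightarrow> 'a set) \<Rightarrow> complex"
    assume \<xi>: "\<forall>n. \<xi> n \<in> L2_mean_zero m \<and> L2_norm m (\<xi> n) = 1"
      and lim: "\<forall>g\<in>\<iota> ` carrier \<Gamma>. (\<lambda>n. L2_norm m (\<lambda>x. \<xi> n (g \<otimes>\<^bsub>\<G>\<^esub> x) - \<xi> n x)) \<longlonglongrightarrow> 0"
    have "(\<lambda>n. L2_norm m (\<lambda>x. koopman \<Gamma> (left_translation \<Gamma> N) g (\<xi> n) x - \<xi> n x)) \<longlonglongrightarrow> 0"
      if g: "g \<in> carrier \<Gamma>" for g
    proof -
      have "L2_norm m (\<lambda>x. koopman \<Gamma> (left_translation \<Gamma> N) g (\<xi> n) x - \<xi> n x) =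
          L2_norm m (\<lambda>x. \<xi> n (\<iota> (inv g) \<otimes>\<^bsub>\<G>\<^esub> x) - \<xi> n x)" for n
        unfolding L2_norm_def
        by (intro arg_cong[where f = sqrt] Bochner_Integration.integral_cong refl)
          (simp add: koopman_def left_translation_def C.space_M)
      moreover have "(\<lambda>n. L2_norm m (\<lambda>x. \<xi> n (\<iota> (inv g) \<otimes>\<^bsub>\<G>\<^esub> x) - \<xi> n x)) \<longlonglongrightarrow> 0"
        by (rule bspec[OF lim]) (use g in blast)
      ultimately show ?thesis by simp
    qed
    then show False using gap \<xi> unfolding spectral_gap_def by blast
  qed
qed

end

theorem theoremA:
  fixes \<Gamma> :: "('a, 'c) monoid_scheme" and \<Lambda> :: "('b, 'd) monoid_scheme"
    and \<Gamma>s :: "nat \<Rightarrow> 'a set" and \<Lambda>s :: "nat \<Rightarrow> 'b set"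
    and G :: "(nat \<Rightarrow> 'a set) monoid" and H :: "(nat \<Rightarrow> 'b set) monoid"
    and T\<^sub>G :: "(nat \<Rightarrow> 'a set) topology" and T\<^sub>H :: "(nat \<Rightarrow> 'b set) topology"
    and m\<^sub>G :: "(nat \<Rightarrow> 'a set) measure" and m\<^sub>H :: "(nat \<Rightarrow> 'b set) measure"
  assumes "group \<Gamma>" and "countable (carrier \<Gamma>)" and "residually_finite \<Gamma>"
    and "group \<Lambda>" and "countable (carrier \<Lambda>)" and "residually_finite \<Lambda>"
    and "residual_chain \<Gamma> \<Gamma>s" and "residual_chain \<Lambda> \<Lambda>s"
    and "G = profinite_completion \<Gamma> \<Gamma>s" and "T\<^sub>G = profinite_topology \<Gamma> \<Gamma>s"
    and "H = profinite_completion \<Lambda> \<Lambda>s" and "T\<^sub>H = profinite_topology \<Lambda> \<Lambda>s"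
    and "haar_probability_measure G T\<^sub>G m\<^sub>G" and "haar_probability_measure H T\<^sub>H m\<^sub>H"
    and "spectral_gap \<Gamma> m\<^sub>G (left_translation \<Gamma> \<Gamma>s)"
  shows
    "(stably_orbit_equivalent_actions
        \<Gamma> m\<^sub>G (left_translation \<Gamma> \<Gamma>s) \<Lambda> m\<^sub>H (left_translation \<Lambda> \<Lambda>s) \<longleftrightarrow>
      (\<exists>G\<^sub>0 H\<^sub>0 \<delta>. subgroup G\<^sub>0 G \<and> openin T\<^sub>G G\<^sub>0 \<and> subgroup H\<^sub>0 H \<and> openin T\<^sub>H H\<^sub>0 \<and>
         \<delta> \<in> topological_group_iso (G\<lparr>carrier := G\<^sub>0\<rparr>) (subtopology T\<^sub>G G\<^sub>0)
                                   (H\<lparr>carrier := H\<^sub>0\<rparr>) (subtopology T\<^sub>H H\<^sub>0) \<and>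
         \<delta> ` (profinite_embedding \<Gamma> \<Gamma>s ` carrier \<Gamma> \<inter> G\<^sub>0) =
           profinite_embedding \<Lambda> \<Lambda>s ` carrier \<Lambda> \<inter> H\<^sub>0))
   \<and> (orbit_equivalent_actions
        \<Gamma> m\<^sub>G (left_translation \<Gamma> \<Gamma>s) \<Lambda> m\<^sub>H (left_translation \<Lambda> \<Lambda>s) \<longleftrightarrow>
      (\<exists>G\<^sub>0 H\<^sub>0 \<delta>. subgroup G\<^sub>0 G \<and> openin T\<^sub>G G\<^sub>0 \<and> subgroup H\<^sub>0 H \<and> openin T\<^sub>H H\<^sub>0 \<and>
         \<delta> \<in> topological_group_iso (G\<lparr>carrier := G\<^sub>0\<rparr>) (subtopology T\<^sub>G G\<^sub>0)
                                   (H\<lparr>carrier := H\<^sub>0\<rparr>) (subtopology T\<^sub>H H\<^sub>0) \<and>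
         \<delta> ` (profinite_embedding \<Gamma> \<Gamma>s ` carrier \<Gamma> \<inter> G\<^sub>0) =
           profinite_embedding \<Lambda> \<Lambda>s ` carrier \<Lambda> \<inter> H\<^sub>0 \<and>
         card (rcosets\<^bsub>G\<^esub> G\<^sub>0) = card (rcosets\<^bsub>H\<^esub> H\<^sub>0)))
   \<and> (borel_reducible
        (borel_of T\<^sub>G) (orbit_relation \<Gamma> (carrier G) (left_translation \<Gamma> \<Gamma>s))
        (borel_of T\<^sub>H) (orbit_relation \<Lambda> (carrier H) (left_translation \<Lambda> \<Lambda>s)) \<longleftrightarrow>
      (\<exists>G\<^sub>0 H\<^sub>0 \<delta>. subgroup G\<^sub>0 G \<and> openin T\<^sub>G G\<^sub>0 \<and> subgroup H\<^sub>0 H \<and> closedin T\<^sub>H H\<^sub>0 \<and>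
         \<delta> \<in> topological_group_iso (G\<lparr>carrier := G\<^sub>0\<rparr>) (subtopology T\<^sub>G G\<^sub>0)
                                   (H\<lparr>carrier := H\<^sub>0\<rparr>) (subtopology T\<^sub>H H\<^sub>0) \<and>
         \<delta> ` (profinite_embedding \<Gamma> \<Gamma>s ` carrier \<Gamma> \<inter> G\<^sub>0) =
           profinite_embedding \<Lambda> \<Lambda>s ` carrier \<Lambda> \<inter> H\<^sub>0))"
proof -
  interpret \<Gamma>: residual_tower \<Gamma> \<Gamma>s using assms(1,7) by (simp add: residual_tower_def residual_tower_axioms_def)
  interpret \<Lambda>: residual_tower \<Lambda> \<Lambda>s using assms(4,8) by (simp add: residual_tower_def residual_tower_axioms_def)
  have hG: "haar_group G m\<^sub>G \<Gamma>.level T\<^sub>G (profinite_embedding \<Gamma> \<Gamma>s ` carrier \<Gamma>)"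
    using \<Gamma>.haar_group[OF assms(2)] assms(9,10,13) by simp
  have hH: "haar_group H m\<^sub>H \<Lambda>.level T\<^sub>H (profinite_embedding \<Lambda> \<Lambda>s ` carrier \<Lambda>)"
    using \<Lambda>.haar_group[OF assms(5)] assms(11,12,14) by simp
  interpret P: haar_group_pair G m\<^sub>G \<Gamma>.level T\<^sub>G "profinite_embedding \<Gamma> \<Gamma>s ` carrier \<Gamma>"
      H m\<^sub>H \<Lambda>.level T\<^sub>H "profinite_embedding \<Lambda> \<Lambda>s ` carrier \<Lambda>"
    by (rule haar_group_pair.intro[OF hG hH])
  have gap: P.G.gap
    using \<Gamma>.gap_of_spectral_gap[OF assms(2)] assms(9,10,13,15) by simp
  have RG: "orbit_relation \<Gamma> (carrier G) (left_translation \<Gamma> \<Gamma>s) = P.G.same_orbit"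
    unfolding P.G.same_orbit_def unfolding assms(9) by (rule \<Gamma>.orbit_relation_eq)
  have RH: "orbit_relation \<Lambda> (carrier H) (left_translation \<Lambda> \<Lambda>s) = P.H.same_orbit"
    unfolding P.H.same_orbit_def unfolding assms(11) by (rule \<Lambda>.orbit_relation_eq)
  show ?thesis
    unfolding stably_orbit_equivalent_actions_def orbit_equivalent_actions_def P.G.space_M P.H.space_M RG RH
    by (intro conjI P.stably_orbit_equivalent_iff P.orbit_equivalent_iff P.borel_reducible_iff gap
        P.G.sets_M[symmetric] P.H.sets_M[symmetric])
qed

end
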